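(* Every isometric automorphism $\Phi$ of the Banach algebra $A_{ph}^{\mathbb{Z}^+}$ is of the form $$\Phi(M_\lambda)=M_{k_1\lambda},\qquad \Phi(D_\mu)=D_{k_2\mu},\qquad \Phi(V_t)=c(t)V_t\qquad (\lambda,\mu\ge 0,\ t\in\mathbb{Z}^+),$$ where $k_1,k_2>0$ satisfy $k_1k_2=1$ and $c:\mathbb{Z}^+\to\mathbb{C}$, $t\mapsto c(t)$, is multiplicative, i.e. $c(s+t)=c(s)c(t)$ for all $s,t\in\mathbb{Z}^+$.
   Context: On $L^2(\mathbb{R})$ define the unitary operators $(M_\lambda f)(x)=e^{i\lambda x}f(x)$, $(D_\mu f)(x)=f(x-\mu)$, $(V_tf)(x)=e^{t/2}f(e^tx)$ for $\lambda,\mu,t\in\mathbb{R}$. Let $\mathbb{Z}^+=\{0,1,2,\dots\}$. The algebra $A_{ph}^{\mathbb{Z}^+}$ is the operator-norm closed (non-selfadjoint) subalgebra of $B(L^2(\mathbb{R}))$ generated by $\{M_\lambda, D_\mu, V_t : \lambda,\mu\in[0,\infty),\ t\in\mathbb{Z}^+\}$. An isometric automorphism is a bijective algebra homomorphism of the algebra onto itself that is isometric for the operator norm. *)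

theory Defs
  imports "HOL-Analysis.Analysis"
begin

section \<open>The Hilbert space of square-integrable functions on the line\<close>

definition square_integrable :: "(real \<Rightarrow> complex) \<Rightarrow> bool" where
  "square_integrable f \<longleftrightarrow>
     f \<in> borel_measurable lborel \<and> integrable lborel (\<lambda>x. (cmod (f x))\<^sup>2)"

text \<open>
  Functions are Borel measurable rather than Lebesgue measurable; as every Lebesgue measurable
  function agrees almost everywhere with a Borel one, the quotient is the usual space.
\<close>

definition L2_rel :: "(real \<Rightarrow> complex) \<Rightarrow> (real \<Rightarrow> complex) \<Rightarrow> bool" where
  "L2_rel f g \<longleftrightarrow> square_integrable f \<and> square_integrable g \<and> (AE x in lborel. f x = g x)"

lemma square_integrable_zero: "square_integrable (\<lambda>x. 0)"
  by (simp add: square_integrable_def)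

lemma L2_rel_part_equivp: "part_equivp L2_rel"
proof (rule part_equivpI)
  show "\<exists>f. L2_rel f f"
    using square_integrable_zero by (auto simp: L2_rel_def)
  show "symp L2_rel"
    unfolding symp_def L2_rel_def by (auto elim: eventually_mono)
  show "transp L2_rel"
    unfolding transp_def L2_rel_def by (auto elim: eventually_elim2)
qed

quotient_type L2R = "real \<Rightarrow> complex" / partial: L2_rel
  by (rule L2_rel_part_equivp)

lemma square_integrable_meas [measurable_dest]:
  "square_integrable f \<Longrightarrow> f \<in> borel_measurable lborel"
  by (simp add: square_integrable_def)

lemma square_integrable_add:
  assumes "square_integrable f" "square_integrable g"
  shows "square_integrable (\<lambda>x. f x + g x)"
proof -
  note [measurable] = assms[THEN square_integrable_meas]
  have i: "integrable lborel (\<lambda>x. 2 * (cmod (f x))\<^sup>2 + 2 * (cmod (g x))\<^sup>2)"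
    using assms by (simp add: square_integrable_def)
  have b: "(cmod (a + b))\<^sup>2 \<le> 2 * (cmod a)\<^sup>2 + 2 * (cmod b)\<^sup>2" for a b
  proof -
    have "(cmod (a + b))\<^sup>2 \<le> (cmod a + cmod b)\<^sup>2"
      by (intro power_mono norm_triangle_ineq) auto
    also have "\<dots> \<le> 2 * (cmod a)\<^sup>2 + 2 * (cmod b)\<^sup>2"
      using sum_squares_bound[of "cmod a" "cmod b"] by (simp add: power2_sum)
    finally show ?thesis .
  qed
  have "integrable lborel (\<lambda>x. (cmod (f x + g x))\<^sup>2)"
    by (rule Bochner_Integration.integrable_bound[OF i]) (auto intro!: order_trans[OF b])
  then show ?thesis
    by (simp add: square_integrable_def)
qed

lemma square_integrable_cmult:
  assumes "square_integrable f"
  shows "square_integrable (\<lambda>x. c * f x)"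
proof -
  note [measurable] = assms[THEN square_integrable_meas]
  show ?thesis
    using assms by (auto simp: square_integrable_def norm_mult power_mult_distrib)
qed

lemma square_integrable_scaleR:
  "square_integrable f \<Longrightarrow> square_integrable (\<lambda>x. r *\<^sub>R f x)"
  using square_integrable_cmult[of f "complex_of_real r"] by (simp add: scaleR_conv_of_real)

lemma square_integrable_uminus:
  "square_integrable f \<Longrightarrow> square_integrable (\<lambda>x. - f x)"
  using square_integrable_cmult[of f "-1"] by simp

lemma square_integrable_diff:
  "square_integrable f \<Longrightarrow> square_integrable g \<Longrightarrow> square_integrable (\<lambda>x. f x - g x)"
  using square_integrable_add[of f "\<lambda>x. - g x"] square_integrable_uminus[of g] by simp

lemma square_integrable_inner:
  assumes "square_integrable f" "square_integrable g"
  shows "integrable lborel (\<lambda>x. f x \<bullet> g x)"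
proof -
  note [measurable] = assms[THEN square_integrable_meas]
  have i: "integrable lborel (\<lambda>x. (cmod (f x))\<^sup>2 + (cmod (g x))\<^sup>2)"
    using assms by (simp add: square_integrable_def)
  have b: "\<bar>a \<bullet> b\<bar> \<le> (cmod a)\<^sup>2 + (cmod b)\<^sup>2" for a b
  proof -
    have "\<bar>a \<bullet> b\<bar> \<le> cmod a * cmod b"
      by (rule Cauchy_Schwarz_ineq2)
    moreover have "2 * cmod a * cmod b \<le> (cmod a)\<^sup>2 + (cmod b)\<^sup>2"
      by (rule sum_squares_bound)
    moreover have "0 \<le> cmod a * cmod b"
      by simp
    ultimately show ?thesis
      by linarith
  qed
  show ?thesis
    by (rule Bochner_Integration.integrable_bound[OF i]) (auto intro!: order_trans[OF b])
qed

instantiation L2R :: real_inner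
begin

lift_definition zero_L2R :: L2R is "\<lambda>x. 0"
  by (simp add: L2_rel_def square_integrable_zero)

lift_definition plus_L2R :: "L2R \<Rightarrow> L2R \<Rightarrow> L2R" is "\<lambda>f g x. f x + g x"
  by (auto simp: L2_rel_def square_integrable_add)

lift_definition uminus_L2R :: "L2R \<Rightarrow> L2R" is "\<lambda>f x. - f x"
  by (auto simp: L2_rel_def square_integrable_uminus)

lift_definition minus_L2R :: "L2R \<Rightarrow> L2R \<Rightarrow> L2R" is "\<lambda>f g x. f x - g x"
  by (auto simp: L2_rel_def square_integrable_diff)

lift_definition scaleR_L2R :: "real \<Rightarrow> L2R \<Rightarrow> L2R" is "\<lambda>r f x. r *\<^sub>R f x"
  unfolding L2_rel_def by (auto intro: square_integrable_scaleR)

text \<open>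
  On \<^typ>\<open>complex\<close>, the library inner product is the real part of the Hermitian one, so this
  is the real part of the usual inner product.
\<close>

lift_definition inner_L2R :: "L2R \<Rightarrow> L2R \<Rightarrow> real" is
  "\<lambda>f g. integral\<^sup>L lborel (\<lambda>x. f x \<bullet> g x)"
proof -
  fix f f' g g' assume *: "L2_rel f f'" "L2_rel g g'"
  then have [measurable]: "f \<in> borel_measurable lborel" "f' \<in> borel_measurable lborel"
      "g \<in> borel_measurable lborel" "g' \<in> borel_measurable lborel"
    by (auto simp: L2_rel_def square_integrable_def)
  have "AE x in lborel. f x = f' x" "AE x in lborel. g x = g' x"
    using * by (auto simp: L2_rel_def)
  then have "AE x in lborel. f x \<bullet> g x = f' x \<bullet> g' x"
    by eventually_elim simp
  then show "integral\<^sup>L lborel (\<lambda>x. f x \<bullet> g x) = integral\<^sup>L lborel (\<lambda>x. f' x \<bullet> g' x)"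
    by (intro integral_cong_AE) auto
qed

lift_definition norm_L2R :: "L2R \<Rightarrow> real" is
  "\<lambda>f. sqrt (integral\<^sup>L lborel (\<lambda>x. (cmod (f x))\<^sup>2))"
proof -
  fix f f' assume *: "L2_rel f f'"
  then have [measurable]: "f \<in> borel_measurable lborel" "f' \<in> borel_measurable lborel"
    by (auto simp: L2_rel_def square_integrable_def)
  have "AE x in lborel. f x = f' x"
    using * by (auto simp: L2_rel_def)
  then have "AE x in lborel. (cmod (f x))\<^sup>2 = (cmod (f' x))\<^sup>2"
    by eventually_elim simp
  then show "sqrt (integral\<^sup>L lborel (\<lambda>x. (cmod (f x))\<^sup>2)) =
      sqrt (integral\<^sup>L lborel (\<lambda>x. (cmod (f' x))\<^sup>2))"
    by (intro arg_cong[of _ _ sqrt] integral_cong_AE) auto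
qed

definition sgn_L2R :: "L2R \<Rightarrow> L2R" where
  "sgn_L2R F = inverse (norm F) *\<^sub>R F"

definition dist_L2R :: "L2R \<Rightarrow> L2R \<Rightarrow> real" where
  "dist_L2R F G = norm (F - G)"

definition uniformity_L2R :: "(L2R \<times> L2R) filter" where
  "uniformity_L2R = (INF e\<in>{0<..}. principal {(F, G). dist F G < e})"

definition open_L2R :: "L2R set \<Rightarrow> bool" where
  "open_L2R U = (\<forall>F\<in>U. eventually (\<lambda>(F', G). F' = F \<longrightarrow> G \<in> U) uniformity)"

instance
proof
  fix F G H :: L2R and a b r :: real
  show "F + G + H = F + (G + H)"
    by transfer (auto simp: L2_rel_def algebra_simps intro!: square_integrable_add)
  show "F + G = G + F"
    by transfer (auto simp: L2_rel_def algebra_simps intro!: square_integrable_add)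
  show "0 + F = F"
    by transfer (auto simp: L2_rel_def)
  show "- F + F = 0"
    by transfer (auto simp: L2_rel_def square_integrable_zero)
  show "F - G = F + - G"
    by transfer (auto simp: L2_rel_def square_integrable_diff)
  show "a *\<^sub>R (F + G) = a *\<^sub>R F + a *\<^sub>R G"
    by transfer (auto simp: L2_rel_def algebra_simps
        intro!: square_integrable_add square_integrable_scaleR)
  show "(a + b) *\<^sub>R F = a *\<^sub>R F + b *\<^sub>R F"
    by transfer (auto simp: L2_rel_def scaleR_left_distrib
        intro!: square_integrable_add square_integrable_scaleR)
  show "a *\<^sub>R b *\<^sub>R F = (a * b) *\<^sub>R F"
    by transfer (auto simp only: L2_rel_def scaleR_scaleR intro!: square_integrable_scaleR)
  show "1 *\<^sub>R F = F"
    by transfer (auto simp: L2_rel_def)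
  show "dist F G = norm (F - G)"
    by (rule dist_L2R_def)
  show "sgn F = inverse (norm F) *\<^sub>R F"
    by (rule sgn_L2R_def)
  show "(uniformity :: (L2R \<times> L2R) filter) =
      (INF e\<in>{0<..}. principal {(F, G). dist F G < e})"
    by (rule uniformity_L2R_def)
  show "open U = (\<forall>F\<in>U. eventually (\<lambda>(F', G). F' = F \<longrightarrow> G \<in> U) uniformity)"
    for U :: "L2R set"
    by (rule open_L2R_def)
  show "F \<bullet> G = G \<bullet> F"
    by transfer (simp add: inner_commute)
  show "(F + G) \<bullet> H = F \<bullet> H + G \<bullet> H"
    by transfer (simp add: L2_rel_def inner_add_left square_integrable_inner)
  show "r *\<^sub>R F \<bullet> G = r * (F \<bullet> G)"
    by transfer simp
  show "0 \<le> F \<bullet> F"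
    by transfer simp
  show "F \<bullet> F = 0 \<longleftrightarrow> F = 0"
  proof transfer
    fix f assume f: "L2_rel f f"
    then have "integrable lborel (\<lambda>x. f x \<bullet> f x)"
      by (auto simp: L2_rel_def square_integrable_inner)
    then show "integral\<^sup>L lborel (\<lambda>x. f x \<bullet> f x) = 0 \<longleftrightarrow> L2_rel f (\<lambda>x. 0)"
      using f by (subst integral_nonneg_eq_0_iff_AE)
        (auto simp: L2_rel_def square_integrable_zero)
  qed
  show "norm F = sqrt (F \<bullet> F)"
    by transfer (simp add: power2_norm_eq_inner)
qed

end

lift_definition scaleC :: "complex \<Rightarrow> L2R \<Rightarrow> L2R" (infixr "*\<^sub>C" 75) is "\<lambda>c f x. c * f x"
  unfolding L2_rel_def by (auto intro: square_integrable_cmult)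

lemma norm_scaleC: "norm (c *\<^sub>C F) = cmod c * norm F"
  by transfer (simp add: norm_mult power_mult_distrib real_sqrt_mult)

lemma scaleC_add: "c *\<^sub>C (F + G) = c *\<^sub>C F + c *\<^sub>C G"
  by transfer (auto simp: L2_rel_def algebra_simps
      intro!: square_integrable_add square_integrable_cmult)

lemma scaleC_scaleR: "c *\<^sub>C (r *\<^sub>R F) = r *\<^sub>R (c *\<^sub>C F)"
  by transfer (auto simp: L2_rel_def intro!: square_integrable_cmult square_integrable_scaleR)

lemma bounded_linear_scaleC: "bounded_linear (\<lambda>F. c *\<^sub>C F)"
  by (rule bounded_linear_intro[where K = "cmod c"])
     (simp_all add: scaleC_add scaleC_scaleR norm_scaleC)


section \<open>Bounded operators\<close>

text \<open>
  The type \<^typ>\<open>L2R \<Rightarrow>\<^sub>L L2R\<close> consists of the bounded real-linear operators, normed by the operator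
  norm; the bounded complex-linear ones are cut out by the following set.
\<close>

definition bounded_ops :: "(L2R \<Rightarrow>\<^sub>L L2R) set" where
  "bounded_ops = {T. \<forall>c F. blinfun_apply T (c *\<^sub>C F) = c *\<^sub>C blinfun_apply T F}"

definition scale_op :: "complex \<Rightarrow> (L2R \<Rightarrow>\<^sub>L L2R) \<Rightarrow> (L2R \<Rightarrow>\<^sub>L L2R)" where
  "scale_op c T = Blinfun (\<lambda>F. c *\<^sub>C blinfun_apply T F)"

lemma blinfun_apply_scale_op [simp]: "blinfun_apply (scale_op c T) F = c *\<^sub>C blinfun_apply T F"
  unfolding scale_op_def
  by (simp add: bounded_linear_Blinfun_apply
      bounded_linear_compose[OF bounded_linear_scaleC blinfun.bounded_linear_right])

definition closed_subalgebra :: "(L2R \<Rightarrow>\<^sub>L L2R) set \<Rightarrow> bool" where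
  "closed_subalgebra A \<longleftrightarrow>
     A \<subseteq> bounded_ops \<and> closed A \<and> 0 \<in> A \<and>
     (\<forall>S\<in>A. \<forall>T\<in>A. S + T \<in> A) \<and>
     (\<forall>c. \<forall>T\<in>A. scale_op c T \<in> A) \<and>
     (\<forall>S\<in>A. \<forall>T\<in>A. S o\<^sub>L T \<in> A)"


section \<open>Modulations, translations and dilations\<close>

lemma square_integrable_modulate:
  assumes "square_integrable f"
  shows "square_integrable (\<lambda>x. cis (l * x) * f x)"
proof -
  note [measurable] = assms[THEN square_integrable_meas]
  have [measurable]: "(\<lambda>x. cis (l * x)) \<in> borel_measurable lborel"
    by (simp, intro borel_measurable_continuous_onI continuous_intros)
  show ?thesis
    using assms by (simp add: square_integrable_def norm_mult)
qed

lemma square_integrable_affine: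
  assumes "square_integrable f" "c \<noteq> 0"
  shows "square_integrable (\<lambda>x. f (t + c * x))"
proof -
  note [measurable] = square_integrable_meas[OF assms(1)]
  show ?thesis
    using assms lborel_integrable_real_affine[of "\<lambda>x. (cmod (f x))\<^sup>2" c t]
    by (simp add: square_integrable_def)
qed

lemma square_integrable_translate:
  "square_integrable f \<Longrightarrow> square_integrable (\<lambda>x. f (x - m))"
  using square_integrable_affine[of f 1 "- m"] by simp

lemma square_integrable_dilate:
  "square_integrable f \<Longrightarrow> square_integrable (\<lambda>x. f (exp t * x))"
  using square_integrable_affine[of f "exp t" 0] by simp

lemma L2_rel_affine:
  assumes "L2_rel f g" "c \<noteq> 0"
  shows "L2_rel (\<lambda>x. f (t + c * x)) (\<lambda>x. g (t + c * x))"
proof -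
  have [measurable]: "f \<in> borel_measurable lborel" "g \<in> borel_measurable lborel"
    using assms by (auto simp: L2_rel_def square_integrable_def)
  have "Measurable.pred borel (\<lambda>x. f x = g x)"
    by measurable
  then show ?thesis
    using assms AE_borel_affine[of c "\<lambda>x. f x = g x" t]
    by (auto simp: L2_rel_def square_integrable_affine)
qed

lemma L2_rel_cmult: "L2_rel f g \<Longrightarrow> L2_rel (\<lambda>x. c * f x) (\<lambda>x. c * g x)"
  unfolding L2_rel_def by (auto intro: square_integrable_cmult)

lift_definition modulate :: "real \<Rightarrow> L2R \<Rightarrow> L2R" is
  "\<lambda>l f x. exp (\<i> * of_real l * of_real x) * f x"
  by (auto simp: L2_rel_def mult.assoc simp flip: cis_conv_exp of_real_mult
      intro: square_integrable_modulate)

lift_definition translate :: "real \<Rightarrow> L2R \<Rightarrow> L2R" is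
  "\<lambda>m f x. f (x - m)"
  using L2_rel_affine[of _ _ 1 "- m" for m] by simp

lift_definition dilate :: "real \<Rightarrow> L2R \<Rightarrow> L2R" is
  "\<lambda>t f x. of_real (exp (t / 2)) * f (exp t * x)"
  using L2_rel_cmult[OF L2_rel_affine[of _ _ "exp t" 0 for t]] by simp

lemma norm_modulate: "norm (modulate l F) = norm F"
  by transfer (simp add: norm_mult)

lemma norm_translate: "norm (translate m F) = norm F"
proof transfer
  fix m :: real and f :: "real \<Rightarrow> complex"
  show "sqrt (integral\<^sup>L lborel (\<lambda>x. (cmod (f (x - m)))\<^sup>2)) =
      sqrt (integral\<^sup>L lborel (\<lambda>x. (cmod (f x))\<^sup>2))"
    using lborel_integral_real_affine[of 1 "\<lambda>x. (cmod (f x))\<^sup>2" "- m"] by simp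
qed

lemma norm_dilate: "norm (dilate t F) = norm F"
proof transfer
  fix t :: real and f :: "real \<Rightarrow> complex"
  have "(exp (t / 2))\<^sup>2 = exp t"
    by (simp flip: exp_of_nat_mult)
  then show "sqrt (integral\<^sup>L lborel (\<lambda>x. (cmod (of_real (exp (t / 2)) * f (exp t * x)))\<^sup>2)) =
      sqrt (integral\<^sup>L lborel (\<lambda>x. (cmod (f x))\<^sup>2))"
    using lborel_integral_real_affine[of "exp t" "\<lambda>x. (cmod (f x))\<^sup>2" 0]
    by (simp add: norm_mult power_mult_distrib)
qed

lemma bounded_linear_modulate: "bounded_linear (modulate l)"
proof (rule bounded_linear_intro[where K = 1])
  fix r :: real and F G :: L2R
  show "modulate l (F + G) = modulate l F + modulate l G"
    by transfer (auto simp: L2_rel_def mult.assoc distrib_left simp flip: cis_conv_exp of_real_mult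
        intro!: square_integrable_add square_integrable_modulate)
  show "modulate l (r *\<^sub>R F) = r *\<^sub>R modulate l F"
    by transfer (auto simp: L2_rel_def mult.assoc simp flip: cis_conv_exp of_real_mult
        intro!: square_integrable_scaleR square_integrable_modulate)
  show "norm (modulate l F) \<le> norm F * 1"
    by (simp add: norm_modulate)
qed

definition M_op :: "real \<Rightarrow> (L2R \<Rightarrow>\<^sub>L L2R)" where
  "M_op l = Blinfun (modulate l)"

lemma blinfun_apply_M_op [simp]: "blinfun_apply (M_op l) = modulate l"
  by (simp add: M_op_def bounded_linear_Blinfun_apply bounded_linear_modulate)

lemma bounded_linear_translate: "bounded_linear (translate m)"
proof (rule bounded_linear_intro[where K = 1])
  fix r :: real and F G :: L2R
  show "translate m (F + G) = translate m F + translate m G"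
  proof transfer
    fix m :: real and f g assume "L2_rel f f" "L2_rel g g"
    then show "L2_rel (\<lambda>x. f (x - m) + g (x - m)) (\<lambda>x. f (x - m) + g (x - m))"
      using square_integrable_add[OF square_integrable_translate[of f m] square_integrable_translate[of g m]]
      by (simp add: L2_rel_def)
  qed
  show "translate m (r *\<^sub>R F) = r *\<^sub>R translate m F"
  proof transfer
    fix m r :: real and f assume "L2_rel f f"
    then show "L2_rel (\<lambda>x. r *\<^sub>R f (x - m)) (\<lambda>x. r *\<^sub>R f (x - m))"
      using square_integrable_scaleR[OF square_integrable_translate[of f m], of r]
      by (simp add: L2_rel_def)
  qed
  show "norm (translate m F) \<le> norm F * 1"
    by (simp add: norm_translate)
qed

definition D_op :: "real \<Rightarrow> (L2R \<Rightarrow>\<^sub>L L2R)" where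
  "D_op m = Blinfun (translate m)"

lemma blinfun_apply_D_op [simp]: "blinfun_apply (D_op m) = translate m"
  by (simp add: D_op_def bounded_linear_Blinfun_apply bounded_linear_translate)

lemma bounded_linear_dilate: "bounded_linear (dilate t)"
proof (rule bounded_linear_intro[where K = 1])
  fix r :: real and F G :: L2R
  have sq: "square_integrable (\<lambda>x. of_real (exp (t / 2)) * f (exp t * x))"
    if "square_integrable f" for f t
    using that by (intro square_integrable_cmult square_integrable_dilate)
  show "dilate t (F + G) = dilate t F + dilate t G"
  proof transfer
    fix t :: real and f g assume "L2_rel f f" "L2_rel g g"
    then show "L2_rel (\<lambda>x. of_real (exp (t / 2)) * (f (exp t * x) + g (exp t * x)))
        (\<lambda>x. of_real (exp (t / 2)) * f (exp t * x) + of_real (exp (t / 2)) * g (exp t * x))"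
      using square_integrable_add[OF sq[of f t] sq[of g t]] by (simp add: L2_rel_def distrib_left)
  qed
  show "dilate t (r *\<^sub>R F) = r *\<^sub>R dilate t F"
  proof transfer
    fix t r :: real and f assume "L2_rel f f"
    then show "L2_rel (\<lambda>x. of_real (exp (t / 2)) * r *\<^sub>R f (exp t * x))
        (\<lambda>x. r *\<^sub>R (of_real (exp (t / 2)) * f (exp t * x)))"
      using square_integrable_scaleR[OF sq[of f t], of r] by (simp add: L2_rel_def)
  qed
  show "norm (dilate t F) \<le> norm F * 1"
    by (simp add: norm_dilate)
qed

definition V_op :: "real \<Rightarrow> (L2R \<Rightarrow>\<^sub>L L2R)" where
  "V_op t = Blinfun (dilate t)"

lemma blinfun_apply_V_op [simp]: "blinfun_apply (V_op t) = dilate t"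
  by (simp add: V_op_def bounded_linear_Blinfun_apply bounded_linear_dilate)


section \<open>The algebra and its isometric automorphisms\<close>

definition A_ph_Zplus :: "(L2R \<Rightarrow>\<^sub>L L2R) set" where
  "A_ph_Zplus = closed_subalgebra hull
     ({M_op l | l. 0 \<le> l} \<union> {D_op m | m. 0 \<le> m} \<union> {V_op (real t) | t :: nat. True})"

text \<open>
  The generators are complex-linear and \<^const>\<open>bounded_ops\<close> is itself a closed subalgebra, so the
  hull is an intersection of a nonempty family and is a closed subalgebra.
\<close>

lemma closed_subalgebra_bounded_ops: "closed_subalgebra bounded_ops"
proof -
  have "closed {T. blinfun_apply T (c *\<^sub>C F) = c *\<^sub>C blinfun_apply T F}" for c F
    by (intro closed_Collect_eq continuous_intros
        bounded_linear.continuous_on[OF bounded_linear_scaleC])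
  then have "closed bounded_ops"
    unfolding bounded_ops_def by (intro closed_Collect_all)
  moreover have "c *\<^sub>C 0 = 0" for c
    using bounded_linear_scaleC by (rule linear_simps(3))
  moreover have "c *\<^sub>C d *\<^sub>C F = d *\<^sub>C c *\<^sub>C F" for c d F
    by transfer (auto simp: L2_rel_def mult.left_commute intro!: square_integrable_cmult)
  ultimately show ?thesis
    by (simp add: closed_subalgebra_def bounded_ops_def blinfun.add_left scaleC_add)
qed

lemma generators_bounded_ops: "M_op l \<in> bounded_ops" "D_op m \<in> bounded_ops" "V_op t \<in> bounded_ops"
proof -
  have "modulate l (c *\<^sub>C F) = c *\<^sub>C modulate l F" for c F
    by transfer (auto simp: L2_rel_def mult.assoc mult.left_commute
        simp flip: cis_conv_exp of_real_mult
        intro!: square_integrable_cmult square_integrable_modulate)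
  then show "M_op l \<in> bounded_ops"
    by (simp add: bounded_ops_def)
  have "translate m (c *\<^sub>C F) = c *\<^sub>C translate m F" for c F
  proof transfer
    fix m c f assume "L2_rel f f"
    then show "L2_rel (\<lambda>x. c * f (x - m)) (\<lambda>x. c * f (x - m))"
      using square_integrable_cmult[OF square_integrable_translate[of f m], of c]
      by (simp add: L2_rel_def)
  qed
  then show "D_op m \<in> bounded_ops"
    by (simp add: bounded_ops_def)
  have "dilate t (c *\<^sub>C F) = c *\<^sub>C dilate t F" for c F
  proof transfer
    fix t c f assume "L2_rel f f"
    then show "L2_rel (\<lambda>x. of_real (exp (t / 2)) * (c * f (exp t * x)))
        (\<lambda>x. c * (of_real (exp (t / 2)) * f (exp t * x)))"
      using square_integrable_cmult[OF square_integrable_cmult[OF square_integrable_dilate[of f t]],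
          of c "of_real (exp (t / 2))"]
      by (simp add: L2_rel_def mult.left_commute)
  qed
  then show "V_op t \<in> bounded_ops"
    by (simp add: bounded_ops_def)
qed

lemma closed_subalgebra_A_ph_Zplus: "closed_subalgebra A_ph_Zplus"
proof -
  let ?G = "{M_op l | l. 0 \<le> l} \<union> {D_op m | m. 0 \<le> m} \<union> {V_op (real t) | t :: nat. True}"
  have "?G \<subseteq> bounded_ops"
    using generators_bounded_ops by auto
  then have "A_ph_Zplus \<subseteq> bounded_ops"
    unfolding A_ph_Zplus_def
    by (rule hull_minimal[where S = closed_subalgebra]) (rule closed_subalgebra_bounded_ops)
  moreover have "closed A_ph_Zplus"
    unfolding A_ph_Zplus_def hull_def closed_subalgebra_def by (rule closed_Inter) auto
  ultimately show ?thesis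
    unfolding closed_subalgebra_def by (auto simp: A_ph_Zplus_def hull_def closed_subalgebra_def)
qed

text \<open>
  A map on operators is only constrained on \<open>A\<close>; its values outside \<open>A\<close> are irrelevant.
\<close>

definition isometric_automorphism ::
  "(L2R \<Rightarrow>\<^sub>L L2R) set \<Rightarrow> ((L2R \<Rightarrow>\<^sub>L L2R) \<Rightarrow> (L2R \<Rightarrow>\<^sub>L L2R)) \<Rightarrow> bool" where
  "isometric_automorphism A \<Phi> \<longleftrightarrow>
     bij_betw \<Phi> A A \<and>
     (\<forall>S\<in>A. \<forall>T\<in>A. \<Phi> (S + T) = \<Phi> S + \<Phi> T) \<and>
     (\<forall>c. \<forall>T\<in>A. \<Phi> (scale_op c T) = scale_op c (\<Phi> T)) \<and>
     (\<forall>S\<in>A. \<forall>T\<in>A. \<Phi> (S o\<^sub>L T) = \<Phi> S o\<^sub>L \<Phi> T) \<and>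
     (\<forall>T\<in>A. norm (\<Phi> T) = norm T)"

end

theory Submission
  imports Defs "HOL-Complex_Analysis.Complex_Analysis" "HOL-Real_Asymp.Real_Asymp"
begin

text \<open>
  Formally, an operator in the algebra is a series of terms \<open>f D_op m V_op n\<close>, where \<open>f\<close> is
  multiplication by a uniform limit of exponential sums with nonnegative frequencies. The coefficient
  functions are made precise as the \<open>entry\<close> functions of the operator, which are limits of inner
  products against concentrated bumps. Three properties of the entries carry the argument: they
  extend to bounded analytic functions on the upper half-plane, so that a product of two of them
  vanishes only if a factor does; they satisfy a Bessel inequality (\<open>entry_bessel\<close>); and an
  operator without nonzero entries is zero (\<open>A_ph_Zplus_entry_zero\<close>).

  Let \<open>\<Phi>\<close> be an isometric automorphism. The entry \<open>\<rho>\<close> of \<open>\<Phi> T\<close> of degree zero is multiplicative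
  in \<open>T\<close>, and the entry \<open>\<delta>\<close> of degree one is a derivation between the characters \<open>\<rho>\<close> at \<open>x\<close> and
  at \<open>exp 1 * x\<close>. The commutation relations of the generators force \<open>\<rho>\<close> to vanish on
  \<open>V_op 1\<close> and on one of the two semigroups. If \<open>\<delta>\<close> vanished on \<open>V_op 1\<close> as well, the derivation
  property would make every \<open>\<rho> T\<close> constant, against surjectivity. Hence \<open>\<delta>\<close> does not vanish there, and
  the relations between \<open>V_op 1\<close> and the semigroups become scaling laws for \<open>\<rho>\<close>.

  These scaling laws are rigid. A nonzero contractive semigroup \<open>F\<^sub>t\<close> of bounded analytic functions has no zeros,
  and unless it is constant, \<open>- \<i> log F\<^sub>t\<close> maps the upper half-plane to itself. By the scaling law,
  the imaginary part of this map grows by the factor \<open>exp 1\<close> from \<open>\<i>\<close> to \<open>\<i> exp 1\<close>, which is the most that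
  the Schwarz lemma allows, and in the equality case the map is affine. For the modulations this gives
  \<open>\<rho> (M_op l) x = \<alpha> exp (\<i> k l x)\<close>, while the opposite scaling law of the translations admits
  only constants. Since \<open>\<rho> (M_op l)\<close> has modulus one and \<open>\<Phi> (M_op l)\<close> has norm one, the Bessel
  inequality leaves no room for further entries, and \<open>\<Phi> (M_op l)\<close> is a unimodular multiple of
  \<open>M_op (k * l)\<close>.

  Commuting with the modulations locates the entries of \<open>\<Phi> (V_op 1)\<close> and \<open>\<Phi> (D_op p)\<close>: each has a single
  one, in the position that conjugation by a translation \<open>D_op d\<close> and a dilation would give, with
  \<open>0 \<le> d\<close>. The inverse of \<open>\<Phi>\<close> has the same form, and as the two shifts cancel, both are zero. The
  coefficients that remain are contractive analytic functions with contractive inverses, hence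
  constants. The constant \<open>\<beta> p\<close> belonging to \<open>D_op p\<close> is multiplicative in \<open>p\<close> and invariant under the
  scaling of \<open>p\<close> by \<open>exp (- 1)\<close>, which leaves only \<open>\<beta> p = 1\<close>.
\<close>

section \<open>Bounded analytic functions on the upper half-plane\<close>

definition upper_half :: "complex set" where
  "upper_half = {z. 0 < Im z}"

definition closed_upper_half :: "complex set" where
  "closed_upper_half = {z. 0 \<le> Im z}"

lemma open_upper_half: "open upper_half"
  unfolding upper_half_def by (rule open_halfspace_Im_gt)

lemma closed_closed_upper_half: "closed closed_upper_half"
  unfolding closed_upper_half_def by (rule closed_halfspace_Im_ge)

lemma convex_upper_half: "convex upper_half"
  unfolding upper_half_def by (rule convex_halfspace_Im_gt)

lemma connected_upper_half: "connected upper_half"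
  by (rule convex_connected[OF convex_upper_half])

lemma upper_half_subset: "upper_half \<subseteq> closed_upper_half"
  by (auto simp: upper_half_def closed_upper_half_def)

lemma of_real_closed_upper_half [simp]: "of_real x \<in> closed_upper_half"
  by (simp add: closed_upper_half_def)

lemma ii_upper_half [simp]: "\<i> \<in> upper_half"
  by (simp add: upper_half_def)

lemma closed_upper_half_approx:
  assumes "z \<in> closed_upper_half"
  shows "(\<lambda>n. z + \<i> * of_real (inverse (real (Suc n)))) \<longlonglongrightarrow> z"
    "z + \<i> * of_real (inverse (real (Suc n))) \<in> upper_half"
proof -
  have "(\<lambda>n. z + \<i> * of_real (inverse (real (Suc n)))) \<longlonglongrightarrow> z + \<i> * of_real 0"
    by (intro tendsto_intros LIMSEQ_inverse_real_of_nat)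
  then show "(\<lambda>n. z + \<i> * of_real (inverse (real (Suc n)))) \<longlonglongrightarrow> z"
    by simp
  show "z + \<i> * of_real (inverse (real (Suc n))) \<in> upper_half"
    using assms by (simp add: upper_half_def closed_upper_half_def add_nonneg_pos)
qed

lemma closed_upper_half_cong:
  assumes "continuous_on closed_upper_half F" "continuous_on closed_upper_half G"
    and eq: "\<And>z. z \<in> upper_half \<Longrightarrow> F z = G z" and z: "z \<in> closed_upper_half"
  shows "F z = (G z :: complex)"
proof -
  let ?s = "\<lambda>n. z + \<i> * of_real (inverse (real (Suc n)))"
  have "\<forall>\<^sub>F n in sequentially. ?s n \<in> closed_upper_half"
    using closed_upper_half_approx(2)[OF z] upper_half_subset by (intro always_eventually) blast
  then have "(\<lambda>n. F (?s n)) \<longlonglongrightarrow> F z" "(\<lambda>n. G (?s n)) \<longlonglongrightarrow> G z"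
    by (rule continuous_on_tendsto_compose[OF assms(1) closed_upper_half_approx(1)[OF z] z]
        continuous_on_tendsto_compose[OF assms(2) closed_upper_half_approx(1)[OF z] z])+
  then show ?thesis
    using eq closed_upper_half_approx(2)[OF z] LIMSEQ_unique by simp
qed

text \<open>
  A Phragmen-Lindelof argument: division by \<open>1 - \<i> \<delta> z\<close>, whose modulus is at least one on the
  half-plane, makes a bounded function small on large half-circles, so the maximum modulus principle on
  a half-disc applies; then \<open>\<delta>\<close> tends to zero.
\<close>
lemma half_plane_maximum_modulus:
  assumes cont: "continuous_on closed_upper_half F"
    and hol: "F holomorphic_on upper_half"
    and bdd: "\<And>z. z \<in> closed_upper_half \<Longrightarrow> cmod (F z) \<le> C"
    and bnd: "\<And>x. cmod (F (of_real x)) \<le> B"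
    and z: "z \<in> closed_upper_half"
  shows "cmod (F z) \<le> B"
proof -
  have B0: "0 \<le> B"
    using bnd[of 0] norm_ge_zero order_trans by blast
  have C0: "0 \<le> C"
    using bdd[OF z] norm_ge_zero order_trans by blast
  have key: "cmod (F z) \<le> (B + \<eta>) * cmod (1 - \<i> * of_real \<delta> * z)" if "\<eta> > 0" "\<delta> > 0" for \<eta> \<delta>
  proof -
    \<comment> \<open>On the half-circle of radius \<open>R\<close> the denominator is at least \<open>\<delta> * R - 1\<close>, hence at least \<open>C / (B + \<eta>)\<close>.\<close>
    define R where "R = cmod z + (C / (B + \<eta>) + 1) / \<delta>"
    have Rz: "cmod z \<le> R"
      unfolding R_def using that B0 C0 by simp
    have CR: "C \<le> (B + \<eta>) * (\<delta> * R - 1)"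
    proof -
      have "\<delta> * R = \<delta> * cmod z + (C / (B + \<eta>) + 1)"
        using that unfolding R_def distrib_left by (simp only: times_divide_eq_right nonzero_mult_div_cancel_left)
      then have "C / (B + \<eta>) + 1 \<le> \<delta> * R"
        using that by simp
      then have "(B + \<eta>) * (C / (B + \<eta>)) \<le> (B + \<eta>) * (\<delta> * R - 1)"
        using that B0 by (intro mult_left_mono) auto
      moreover have "(B + \<eta>) * (C / (B + \<eta>)) = C"
        using that B0 by (simp add: field_simps)
      ultimately show ?thesis
        by simp
    qed
    define S where "S = closed_upper_half \<inter> cball 0 R"
    define G where "G = (\<lambda>w. F w / (1 - \<i> * of_real \<delta> * w))"
    have den: "1 \<le> cmod (1 - \<i> * of_real \<delta> * w)" if "w \<in> closed_upper_half" for w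
    proof -
      have "1 \<le> Re (1 - \<i> * of_real \<delta> * w)"
        using that \<open>\<delta> > 0\<close> by (simp add: closed_upper_half_def)
      also have "\<dots> \<le> cmod (1 - \<i> * of_real \<delta> * w)"
        by (rule complex_Re_le_cmod)
      finally show ?thesis .
    qed
    have den0: "1 - \<i> * of_real \<delta> * w \<noteq> 0" if "w \<in> closed_upper_half" for w
      using den[OF that] by auto
    have clS: "closed S"
      by (auto simp: S_def closed_closed_upper_half)
    have int: "interior S \<subseteq> upper_half"
    proof -
      have "interior S \<subseteq> interior closed_upper_half"
        by (rule interior_mono) (auto simp: S_def)
      also have "\<dots> \<subseteq> upper_half"
        unfolding upper_half_def closed_upper_half_def
        using interior_halfspace_ge[of \<i> 0] by (simp add: inner_complex_def)
      finally show ?thesis .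
    qed
    have "cmod (G z) \<le> B + \<eta>"
    proof (rule maximum_modulus_frontier[of G S])
      show "G holomorphic_on interior S"
        unfolding G_def using int upper_half_subset den0
        by (intro holomorphic_intros holomorphic_on_subset[OF hol]) auto
      show "continuous_on (closure S) G"
        unfolding G_def closure_closed[OF clS]
        by (intro continuous_intros continuous_on_subset[OF cont]) (use den0 in \<open>auto simp: S_def simp del: eq_iff_diff_eq_0\<close>)
      show "bounded S"
        by (auto simp: S_def)
      show "z \<in> S"
        using z Rz by (auto simp: S_def)
      fix w assume w: "w \<in> frontier S"
      then have wS: "w \<in> S" "w \<notin> interior S"
        using clS by (auto simp: frontier_def)
      then have wc: "w \<in> closed_upper_half"
        by (auto simp: S_def)
      have "Im w = 0 \<or> cmod w = R"
      proof (rule ccontr)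
        assume "\<not> ?thesis"
        then have "w \<in> upper_half \<inter> ball 0 R"
          using wS by (auto simp: S_def upper_half_def closed_upper_half_def)
        moreover have "upper_half \<inter> ball 0 R \<subseteq> S"
          using upper_half_subset by (auto simp: S_def)
        ultimately have "w \<in> interior S"
          by (meson interiorI open_Int open_ball open_upper_half)
        with wS show False by simp
      qed
      then show "cmod (G w) \<le> B + \<eta>"
      proof
        assume "Im w = 0"
        then have "w = of_real (Re w)"
          by (simp add: complex_eq_iff)
        then have "cmod (F w) \<le> B"
          by (metis bnd)
        then have "cmod (F w) / cmod (1 - \<i> * of_real \<delta> * w) \<le> B / 1"
          using den[OF wc] B0 by (intro frac_le) auto
        then show ?thesis
          using that by (simp add: G_def norm_divide)
      next
        assume wR: "cmod w = R"
        have "\<delta> * R - 1 \<le> cmod (1 - \<i> * of_real \<delta> * w)"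
          using norm_triangle_ineq2[of "\<i> * of_real \<delta> * w" 1] that wR
          by (simp add: norm_mult norm_minus_commute)
        then have "C \<le> (B + \<eta>) * cmod (1 - \<i> * of_real \<delta> * w)"
          using CR that B0 by (auto intro: order_trans[OF CR] mult_left_mono)
        then have "cmod (F w) \<le> (B + \<eta>) * cmod (1 - \<i> * of_real \<delta> * w)"
          using bdd[OF wc] by linarith
        then show ?thesis
          using den[OF wc] that B0 by (simp add: G_def norm_divide divide_le_eq)
      qed
    qed
    then show ?thesis
      using den[OF z] that B0 by (simp add: G_def norm_divide divide_le_eq split: if_splits)
  qed
  have key2: "cmod (F z) \<le> B + \<eta>" if "\<eta> > 0" for \<eta>
  proof (rule tendsto_lowerbound)
    have "((\<lambda>\<delta>. (B + \<eta>) * cmod (1 - \<i> * of_real \<delta> * z)) \<longlongrightarrow> (B + \<eta>) * cmod (1 - \<i> * of_real 0 * z)) (at_right 0)"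
      by (intro tendsto_intros)
    then show "((\<lambda>\<delta>. (B + \<eta>) * cmod (1 - \<i> * of_real \<delta> * z)) \<longlongrightarrow> B + \<eta>) (at_right 0)"
      by simp
    show "\<forall>\<^sub>F \<delta> in at_right 0. cmod (F z) \<le> (B + \<eta>) * cmod (1 - \<i> * of_real \<delta> * z)"
      using key[OF that] by (auto simp: eventually_at_right_field intro!: exI[of _ 1])
  qed auto
  show ?thesis
    by (rule field_le_epsilon) (use key2 in auto)
qed

definition hardy_extension :: "(real \<Rightarrow> complex) \<Rightarrow> (complex \<Rightarrow> complex) \<Rightarrow> bool" where
  "hardy_extension f F \<longleftrightarrow> continuous_on closed_upper_half F \<and> F holomorphic_on upper_half \<and>
     bounded (F ` closed_upper_half) \<and> (\<forall>x. F (of_real x) = f x)"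

lemma hardy_extension_bound:
  assumes F: "hardy_extension f F" and "\<And>x. cmod (f x) \<le> B" "z \<in> closed_upper_half"
  shows "cmod (F z) \<le> B"
proof -
  obtain C where "\<And>z. z \<in> closed_upper_half \<Longrightarrow> cmod (F z) \<le> C"
    using F by (auto simp: hardy_extension_def bounded_iff)
  then show ?thesis
    using half_plane_maximum_modulus[of F C B z] assms by (auto simp: hardy_extension_def)
qed

lemma hardy_extension_diff:
  "hardy_extension f F \<Longrightarrow> hardy_extension g G \<Longrightarrow> hardy_extension (\<lambda>x. f x - g x) (\<lambda>z. F z - G z)"
  unfolding hardy_extension_def
  by (intro conjI continuous_on_diff holomorphic_on_diff bounded_minus_comp) auto

lemma hardy_extension_mult:
  assumes F: "hardy_extension f F" and G: "hardy_extension g G"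
  shows "hardy_extension (\<lambda>x. f x * g x) (\<lambda>z. F z * G z)"
proof -
  obtain C where C: "\<And>z. z \<in> closed_upper_half \<Longrightarrow> cmod (F z) \<le> C"
    using F by (auto simp: hardy_extension_def bounded_iff)
  obtain D where D: "\<And>z. z \<in> closed_upper_half \<Longrightarrow> cmod (G z) \<le> D"
    using G by (auto simp: hardy_extension_def bounded_iff)
  have "cmod (F z * G z) \<le> C * D" if "z \<in> closed_upper_half" for z
    using C[OF that] D[OF that] by (simp add: norm_mult mult_mono')
  then have "bounded ((\<lambda>z. F z * G z) ` closed_upper_half)"
    by (auto simp: bounded_iff)
  then show ?thesis
    using F G by (auto simp: hardy_extension_def intro!: continuous_intros holomorphic_intros)
qed

lemma hardy_extension_const: "hardy_extension (\<lambda>x. c) (\<lambda>z. c)"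
  by (auto simp: hardy_extension_def bounded_iff)

lemma hardy_extension_dilate:
  assumes F: "hardy_extension f F" and c: "0 < c"
  shows "hardy_extension (\<lambda>x. f (c * x)) (\<lambda>z. F (of_real c * z))"
proof -
  have sub: "(\<lambda>z. of_real c * z) ` closed_upper_half \<subseteq> closed_upper_half"
      "(\<lambda>z. of_real c * z) ` upper_half \<subseteq> upper_half"
    using c by (auto simp: closed_upper_half_def upper_half_def)
  have F': "continuous_on closed_upper_half F" "F holomorphic_on upper_half"
      "bounded (F ` closed_upper_half)" "F (of_real x) = f x" for x
    using F by (auto simp: hardy_extension_def)
  have "bounded ((\<lambda>z. F (of_real c * z)) ` closed_upper_half)"
    using sub(1) by (intro bounded_subset[OF F'(3)]) auto
  moreover have "continuous_on closed_upper_half (\<lambda>z. F (of_real c * z))"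
    by (rule continuous_on_compose2[OF F'(1) _ sub(1)]) (intro continuous_intros)
  moreover have "(\<lambda>z. F (of_real c * z)) holomorphic_on upper_half"
    using holomorphic_on_compose_gen[OF _ F'(2) sub(2)] by (simp add: o_def holomorphic_intros)
  moreover have "F (of_real c * of_real x) = f (c * x)" for x
    using F'(4)[of "c * x"] by simp
  ultimately show ?thesis
    by (simp add: hardy_extension_def)
qed

lemma hardy_extension_unique:
  assumes F: "hardy_extension f F" and G: "hardy_extension f G" and z: "z \<in> closed_upper_half"
  shows "F z = G z"
  using hardy_extension_bound[OF hardy_extension_diff[OF F G], of 0 z] z by simp

text \<open>
  By the maximum principle the product of the extensions vanishes, so one extension vanishes on the
  open set where the other does not.
\<close>
lemma hardy_zero_divisor:
  assumes F: "hardy_extension f F" and G: "hardy_extension g G" and fg: "\<And>x. f x * g x = 0"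
  shows "(\<forall>x. f x = 0) \<or> (\<forall>x. g x = 0)"
proof (rule disjCI)
  assume "\<not> (\<forall>x. g x = 0)"
  then obtain x0 where x0: "g x0 \<noteq> 0" by auto
  have FG: "F z * G z = 0" if "z \<in> closed_upper_half" for z
    using hardy_extension_bound[OF hardy_extension_mult[OF F G], of 0 z] fg that by simp
  have cont: "continuous_on closed_upper_half F" "continuous_on closed_upper_half G"
    and hol: "F holomorphic_on upper_half" "G holomorphic_on upper_half"
    using F G by (auto simp: hardy_extension_def)
  have lim: "(\<lambda>n. H (z + \<i> * of_real (inverse (real (Suc n))))) \<longlonglongrightarrow> H z"
    if "continuous_on closed_upper_half H" "z \<in> closed_upper_half" for H :: "complex \<Rightarrow> complex" and z
    by (rule continuous_on_tendsto_compose[OF that(1) closed_upper_half_approx(1)])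
       (use that(2) closed_upper_half_approx(2) upper_half_subset in \<open>auto intro!: always_eventually\<close>)
  obtain w where w: "w \<in> upper_half" "G w \<noteq> 0"
  proof -
    have "\<exists>w\<in>upper_half. G w \<noteq> 0"
    proof (rule ccontr)
      assume "\<not> ?thesis"
      then have "(\<lambda>n. G (of_real x0 + \<i> * of_real (inverse (real (Suc n))))) \<longlonglongrightarrow> 0"
        using closed_upper_half_approx(2)[of "of_real x0"] by simp
      then have "G (of_real x0) = 0"
        using lim[OF cont(2), of "of_real x0"] LIMSEQ_unique by auto
      then show False
        using x0 G by (simp add: hardy_extension_def)
    qed
    then show ?thesis using that by auto
  qed
  define U where "U = upper_half \<inter> G -` (- {0})"
  have "open U"
    unfolding U_def using hol(2) open_upper_half
    by (intro continuous_open_preimage holomorphic_on_imp_continuous_on) auto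
  have F0: "F z = 0" if "z \<in> upper_half" for z
  proof (rule analytic_continuation_open[of U upper_half F "\<lambda>_. 0" z])
    show "U \<noteq> {}" using w by (auto simp: U_def)
    show "F z = 0" if "z \<in> U" for z
      using FG[of z] that upper_half_subset by (auto simp: U_def)
  qed (use \<open>open U\<close> open_upper_half connected_upper_half hol that in \<open>auto simp: U_def\<close>)
  show "\<forall>x. f x = 0"
  proof
    fix x
    have "(\<lambda>n. F (of_real x + \<i> * of_real (inverse (real (Suc n))))) \<longlonglongrightarrow> 0"
      using F0 closed_upper_half_approx(2)[of "of_real x"] by simp
    then have "F (of_real x) = 0"
      using lim[OF cont(1), of "of_real x"] LIMSEQ_unique by auto
    then show "f x = 0"
      using F by (simp add: hardy_extension_def)
  qed
qed

text \<open>
  The extensions are inverse to each other and bounded by one, so both have modulus one everywhere,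
  and the maximum modulus principle applies.
\<close>
lemma hardy_inverse_constant:
  assumes F: "hardy_extension f F" and G: "hardy_extension g G"
    and f1: "\<And>x. cmod (f x) \<le> 1" and g1: "\<And>x. cmod (g x) \<le> 1" and fg: "\<And>x. f x * g x = 1"
  shows "\<exists>c. \<forall>x. f x = c"
proof -
  have FG: "F z * G z = 1" if "z \<in> closed_upper_half" for z
    using hardy_extension_unique[OF hardy_extension_mult[OF F G] _ that] hardy_extension_const[of 1] fg by simp
  have n: "cmod (F z) = 1" if "z \<in> closed_upper_half" for z
  proof -
    have "cmod (F z) * cmod (G z) = 1"
      using FG[OF that] by (metis norm_mult norm_one)
    moreover have "cmod (F z) \<le> 1" "cmod (G z) \<le> 1"
      using hardy_extension_bound[OF F f1 that] hardy_extension_bound[OF G g1 that] by auto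
    ultimately show ?thesis
      by (metis mult_left_le norm_ge_zero order_antisym)
  qed
  have "F constant_on upper_half"
    using F n upper_half_subset
    by (intro maximum_modulus_principle[of F upper_half upper_half \<i>])
       (auto simp: hardy_extension_def open_upper_half connected_upper_half subset_eq)
  then obtain c where c: "\<And>z. z \<in> upper_half \<Longrightarrow> F z = c"
    by (auto simp: constant_on_def)
  have "f x = c" for x
  proof -
    have "(\<lambda>n. F (of_real x + \<i> * of_real (inverse (real (Suc n))))) \<longlonglongrightarrow> F (of_real x)"
      using F upper_half_subset closed_upper_half_approx(2)[of "of_real x"]
      by (intro continuous_on_tendsto_compose[of closed_upper_half F] closed_upper_half_approx(1))
         (auto simp: hardy_extension_def intro!: always_eventually)
    then have "(\<lambda>n. c) \<longlonglongrightarrow> F (of_real x)"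
      using c closed_upper_half_approx(2)[of "of_real x"] by simp
    then show ?thesis
      using F by (metis LIMSEQ_const_iff hardy_extension_def)
  qed
  then show ?thesis by auto
qed

text \<open>
  By the maximum principle, uniform convergence on the real line propagates to the half-plane.
\<close>
lemma hardy_extension_limit:
  assumes approx: "\<And>e. 0 < e \<Longrightarrow> \<exists>g G. hardy_extension g G \<and> (\<forall>x. cmod (f x - g x) \<le> e)"
  shows "\<exists>F. hardy_extension f F"
proof -
  have "\<forall>n. \<exists>g G. hardy_extension g G \<and> (\<forall>x. cmod (f x - g x) \<le> inverse (real (Suc n)))"
    using approx by simp
  then obtain g G where G: "\<And>n. hardy_extension (g n) (G n)"
      and g: "\<And>n x. cmod (f x - g n x) \<le> inverse (real (Suc n))"
    by metis
  have GG: "cmod (G m z - G n z) \<le> inverse (real (Suc m)) + inverse (real (Suc n))"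
    if "z \<in> closed_upper_half" for m n z
  proof (rule hardy_extension_bound[OF hardy_extension_diff[OF G G] _ that])
    show "cmod (g m x - g n x) \<le> inverse (real (Suc m)) + inverse (real (Suc n))" for x
      using norm_triangle_ineq4[of "f x - g n x" "f x - g m x"] g[of x m] g[of x n] by simp
  qed
  have small: "\<exists>N. \<forall>n\<ge>N. inverse (real (Suc n)) < e" if "0 < e" for e :: real
    using order_tendstoD(2)[OF LIMSEQ_inverse_real_of_nat that] by (simp add: eventually_sequentially)
  have "uniformly_Cauchy_on closed_upper_half G"
  proof (rule uniformly_Cauchy_onI)
    fix e :: real assume "0 < e"
    then obtain N where "\<And>n. n \<ge> N \<Longrightarrow> inverse (real (Suc n)) < e / 2"
      using small[of "e / 2"] by auto
    then have "inverse (real (Suc m)) + inverse (real (Suc n)) < e" if "m \<ge> N" "n \<ge> N" for m n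
      using that[THEN \<open>\<And>n. n \<ge> N \<Longrightarrow> inverse (real (Suc n)) < e / 2\<close>] by linarith
    then have "dist (G m z) (G n z) < e" if "z \<in> closed_upper_half" "m \<ge> N" "n \<ge> N" for z m n
      using GG[OF that(1), of m n] that(2,3) unfolding dist_norm by (meson le_less_trans)
    then show "\<exists>M. \<forall>x\<in>closed_upper_half. \<forall>m\<ge>M. \<forall>n\<ge>M. dist (G m x) (G n x) < e"
      by blast
  qed
  then obtain F where F: "uniform_limit closed_upper_half G F sequentially"
    using Cauchy_uniformly_convergent uniformly_convergent_on_def by blast
  have cont: "continuous_on closed_upper_half F"
    using G by (intro uniform_limit_theorem[OF _ F]) (auto simp: hardy_extension_def)
  have hol: "F holomorphic_on upper_half"
  proof (rule holomorphic_uniform_sequence[of _ G])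
    show "G n holomorphic_on upper_half" for n
      using G by (simp add: hardy_extension_def)
    fix z assume "z \<in> upper_half"
    then obtain d where d: "0 < d" "cball z d \<subseteq> upper_half"
      using open_upper_half open_contains_cball by blast
    then show "\<exists>d>0. cball z d \<subseteq> upper_half \<and> uniform_limit (cball z d) G F sequentially"
      using uniform_limit_on_subset[OF F] upper_half_subset by (meson subset_trans)
  qed (rule open_upper_half)
  have real: "F (of_real x) = f x" for x
  proof (rule LIMSEQ_unique)
    show "(\<lambda>n. G n (of_real x)) \<longlonglongrightarrow> F (of_real x)"
      using tendsto_uniform_limitI[OF F] by simp
    have "(\<lambda>n. g n x) \<longlonglongrightarrow> f x"
    proof (rule metric_LIMSEQ_I)
      fix e :: real assume "0 < e"
      then show "\<exists>N. \<forall>n\<ge>N. dist (g n x) (f x) < e"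
        using small g by (metis dist_norm dist_commute le_less_trans)
    qed
    then show "(\<lambda>n. G n (of_real x)) \<longlonglongrightarrow> f x"
      using G by (simp add: hardy_extension_def)
  qed
  have "bounded (F ` closed_upper_half)"
  proof -
    obtain N where N: "\<forall>z\<in>closed_upper_half. dist (G N z) (F z) < 1"
      using uniform_limitD[OF F, of 1] by (auto simp: eventually_sequentially)
    obtain C where C: "\<And>z. z \<in> closed_upper_half \<Longrightarrow> cmod (G N z) \<le> C"
      using G[of N] by (auto simp: hardy_extension_def bounded_iff)
    have "cmod (F z) \<le> C + 1" if "z \<in> closed_upper_half" for z
      using C[OF that] N that norm_triangle_sub[of "F z" "G N z"]
      by (smt (verit) dist_norm dist_commute)
    then show ?thesis
      by (auto simp: bounded_iff)
  qed
  then show ?thesis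
    using cont hol real by (auto simp: hardy_extension_def)
qed

section \<open>Analytic almost periodic functions\<close>

definition exp_sum :: "real set \<Rightarrow> (real \<Rightarrow> complex) \<Rightarrow> real \<Rightarrow> complex" where
  "exp_sum I c x = (\<Sum>l\<in>I. c l * exp (\<i> * of_real l * of_real x))"

text \<open>
  The uniform closure of the algebra generated by the characters with nonnegative frequencies: the
  analytic almost periodic functions on the line.
\<close>
definition analytic_ap :: "(real \<Rightarrow> complex) \<Rightarrow> bool" where
  "analytic_ap f \<longleftrightarrow>
     (\<forall>e>0. \<exists>I c. finite I \<and> I \<subseteq> {0..} \<and> (\<forall>x. cmod (f x - exp_sum I c x) \<le> e))"

lemma analytic_apE:
  assumes "analytic_ap f" "0 < e"
  obtains I c where "finite I" "I \<subseteq> {0..}" "\<And>x. cmod (f x - exp_sum I c x) \<le> e"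
  using assms(1)[unfolded analytic_ap_def, rule_format, OF assms(2)] that by auto

lemma analytic_apI:
  assumes "\<And>e. 0 < e \<Longrightarrow>
    \<exists>I c. finite I \<and> I \<subseteq> {0..} \<and> (\<forall>x. cmod (f x - exp_sum I c x) \<le> e)"
  shows "analytic_ap f"
  using assms by (simp add: analytic_ap_def)

lemma exp_sum_extend:
  assumes "finite J" "I \<subseteq> J"
  shows "exp_sum I c x = exp_sum J (\<lambda>l. if l \<in> I then c l else 0) x"
proof -
  have "exp_sum I c x = (\<Sum>l\<in>I. (if l \<in> I then c l else 0) * exp (\<i> * of_real l * of_real x))"
    unfolding exp_sum_def by (intro sum.cong) auto
  also have "\<dots> = exp_sum J (\<lambda>l. if l \<in> I then c l else 0) x"
    unfolding exp_sum_def using assms by (intro sum.mono_neutral_left) auto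
  finally show ?thesis .
qed

lemma analytic_ap_add:
  assumes "analytic_ap f" "analytic_ap g"
  shows "analytic_ap (\<lambda>x. f x + g x)"
proof (rule analytic_apI)
  fix e :: real assume "0 < e"
  then have e2: "0 < e / 2"
    by simp
  obtain I c where I: "finite I" "I \<subseteq> {0..}" "\<And>x. cmod (f x - exp_sum I c x) \<le> e / 2"
    using analytic_apE[OF assms(1) e2] by blast
  obtain J d where J: "finite J" "J \<subseteq> {0..}" "\<And>x. cmod (g x - exp_sum J d x) \<le> e / 2"
    using analytic_apE[OF assms(2) e2] by blast
  let ?h = "\<lambda>l. (if l \<in> I then c l else 0) + (if l \<in> J then d l else 0)"
  have "exp_sum (I \<union> J) ?h x = exp_sum I c x + exp_sum J d x" for x
    using I J exp_sum_extend[of "I \<union> J" I c x] exp_sum_extend[of "I \<union> J" J d x]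
    by (simp add: exp_sum_def distrib_right sum.distrib)
  then have "cmod (f x + g x - exp_sum (I \<union> J) ?h x) \<le> e" for x
    using norm_triangle_ineq[of "f x - exp_sum I c x" "g x - exp_sum J d x"] I(3)[of x] J(3)[of x]
    by (simp add: algebra_simps)
  then show "\<exists>I c. finite I \<and> I \<subseteq> {0..} \<and> (\<forall>x. cmod (f x + g x - exp_sum I c x) \<le> e)"
    using I J by (intro exI[of _ "I \<union> J"] exI[of _ ?h]) auto
qed

lemma analytic_ap_cmult:
  assumes "analytic_ap f"
  shows "analytic_ap (\<lambda>x. a * f x)"
proof (rule analytic_apI)
  fix e :: real assume e: "0 < e"
  then have "0 < e / (cmod a + 1)"
    by (simp add: add_nonneg_pos)
  then obtain I c where I: "finite I" "I \<subseteq> {0..}" "\<And>x. cmod (f x - exp_sum I c x) \<le> e / (cmod a + 1)"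
    using analytic_apE[OF assms] by blast
  have "cmod (a * f x - exp_sum I (\<lambda>l. a * c l) x) \<le> e" for x
  proof -
    have "a * f x - exp_sum I (\<lambda>l. a * c l) x = a * (f x - exp_sum I c x)"
      by (simp add: exp_sum_def sum_distrib_left algebra_simps)
    then have "cmod (a * f x - exp_sum I (\<lambda>l. a * c l) x) \<le> cmod a * (e / (cmod a + 1))"
      using I(3)[of x] by (simp add: norm_mult mult_left_mono del: times_divide_eq_right)
    also have "\<dots> \<le> (cmod a + 1) * (e / (cmod a + 1))"
      using e by (intro mult_right_mono) auto
    also have "\<dots> = e"
      using norm_ge_zero[of a] by (simp add: add_nonneg_eq_0_iff)
    finally show ?thesis .
  qed
  then show "\<exists>I c. finite I \<and> I \<subseteq> {0..} \<and> (\<forall>x. cmod (a * f x - exp_sum I c x) \<le> e)"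
    using I by blast
qed

lemma analytic_ap_diff: "analytic_ap f \<Longrightarrow> analytic_ap g \<Longrightarrow> analytic_ap (\<lambda>x. f x - g x)"
  using analytic_ap_add[of f "\<lambda>x. - 1 * g x"] analytic_ap_cmult[of g "- 1"] by simp

lemma analytic_ap_exp:
  assumes "0 \<le> l"
  shows "analytic_ap (\<lambda>x. exp (\<i> * of_real l * of_real x))"
  unfolding analytic_ap_def
  using assms by (intro allI impI exI[of _ "{l}"] exI[of _ "\<lambda>_. 1"]) (simp add: exp_sum_def)

lemma analytic_ap_limit:
  assumes "\<And>e. 0 < e \<Longrightarrow> \<exists>g. analytic_ap g \<and> (\<forall>x. cmod (f x - g x) \<le> e)"
  shows "analytic_ap f"
proof (rule analytic_apI)
  fix e :: real assume "0 < e"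
  then obtain g where g: "analytic_ap g" "\<And>x. cmod (f x - g x) \<le> e / 2"
    using assms[of "e / 2"] by auto
  then obtain I c where I: "finite I" "I \<subseteq> {0..}" "\<And>x. cmod (g x - exp_sum I c x) \<le> e / 2"
    using analytic_apE[OF g(1) half_gt_zero[OF \<open>0 < e\<close>]] by blast
  have "cmod (f x - exp_sum I c x) \<le> e" for x
    using norm_triangle_ineq[of "f x - g x" "g x - exp_sum I c x"] g(2)[of x] I(3)[of x] by simp
  then show "\<exists>I c. finite I \<and> I \<subseteq> {0..} \<and> (\<forall>x. cmod (f x - exp_sum I c x) \<le> e)"
    using I by blast
qed

lemma exp_sum_hardy_extension:
  assumes "finite I" "I \<subseteq> {0..}"
  shows "hardy_extension (exp_sum I c) (\<lambda>z. \<Sum>l\<in>I. c l * exp (\<i> * of_real l * z))"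
proof -
  have "cmod (\<Sum>l\<in>I. c l * exp (\<i> * of_real l * z)) \<le> (\<Sum>l\<in>I. cmod (c l))"
    if "z \<in> closed_upper_half" for z
  proof (rule order_trans[OF norm_sum sum_mono])
    fix l assume "l \<in> I"
    then have "0 \<le> l * Im z"
      using that assms by (auto simp: closed_upper_half_def)
    then show "cmod (c l * exp (\<i> * of_real l * z)) \<le> cmod (c l)"
      by (simp add: norm_mult mult_left_le del: mult_le_0_iff zero_le_mult_iff)
  qed
  then have "bounded ((\<lambda>z. \<Sum>l\<in>I. c l * exp (\<i> * of_real l * z)) ` closed_upper_half)"
    by (auto simp: bounded_iff)
  then show ?thesis
    unfolding hardy_extension_def exp_sum_def
    by (intro conjI continuous_intros holomorphic_intros allI refl)
qed

lemma analytic_ap_hardy_extension: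
  assumes "analytic_ap f"
  shows "\<exists>F. hardy_extension f F"
proof (rule hardy_extension_limit)
  fix e :: real assume e: "0 < e"
  obtain I c where I: "finite I" "I \<subseteq> {0..}" "\<And>x. cmod (f x - exp_sum I c x) \<le> e"
    using analytic_apE[OF assms e] by blast
  show "\<exists>g G. hardy_extension g G \<and> (\<forall>x. cmod (f x - g x) \<le> e)"
    using exp_sum_hardy_extension[OF I(1,2), of c] I(3) by (intro exI conjI allI)
qed

lemma analytic_ap_zero_divisor:
  assumes "analytic_ap f" "analytic_ap g" "\<And>x. f x * g x = 0"
  shows "(\<forall>x. f x = 0) \<or> (\<forall>x. g x = 0)"
proof -
  obtain F G where "hardy_extension f F" "hardy_extension g G"
    using assms(1,2) analytic_ap_hardy_extension by blast
  then show ?thesis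
    using assms(3) by (rule hardy_zero_divisor)
qed

lemma analytic_ap_continuous:
  assumes "analytic_ap f"
  shows "continuous_on UNIV f"
proof -
  obtain F where F: "hardy_extension f F"
    using analytic_ap_hardy_extension[OF assms] by blast
  have "continuous_on closed_upper_half F"
    using F by (simp add: hardy_extension_def)
  then have "continuous_on UNIV (\<lambda>x. F (of_real x))"
    by (rule continuous_on_compose2) (auto intro: continuous_on_of_real_id)
  then show ?thesis
    using F by (simp add: hardy_extension_def)
qed

lemma analytic_ap_bounded:
  assumes "analytic_ap f"
  shows "bounded (range f)"
proof -
  obtain F where F: "hardy_extension f F"
    using analytic_ap_hardy_extension[OF assms] by blast
  have "range f \<subseteq> F ` closed_upper_half"
  proof
    fix w assume "w \<in> range f"
    then obtain x where "w = F (of_real x)"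
      using F by (auto simp: hardy_extension_def)
    then show "w \<in> F ` closed_upper_half"
      by simp
  qed
  moreover have "bounded (F ` closed_upper_half)"
    using F by (simp add: hardy_extension_def)
  ultimately show ?thesis
    using bounded_subset by blast
qed

section \<open>Rigidity of analytic semigroups under scaling\<close>

text \<open>
  The equality case of the Schwarz lemma, transported by the Cayley transform. After an affine
  normalisation the map fixes \<open>\<i>\<close> and sends \<open>\<i> exp 1\<close> to a point of the same height. Since it does not
  increase hyperbolic distances, that point is \<open>\<i> exp 1\<close> itself, and a map with two fixed points
  is the identity.
\<close>
lemma upper_half_isometry_rigid:
  assumes hol: "G holomorphic_on upper_half"
    and pos: "\<And>z. z \<in> upper_half \<Longrightarrow> 0 < Im (G z)"
    and eq: "Im (G (\<i> * of_real (exp 1))) = exp 1 * Im (G \<i>)"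
  shows "\<exists>q r::real. 0 < q \<and> (\<forall>z\<in>upper_half. G z = of_real q * z + of_real r)"
proof -
  define e where "e = exp (1::real)"
  have e1: "1 < e" by (simp add: e_def)
  define q where "q = Im (G \<i>)"
  define r where "r = Re (G \<i>)"
  have q: "0 < q" using pos by (simp add: q_def)
  \<comment> \<open>\<open>A\<close> is the affine normalisation with \<open>A \<i> = \<i>\<close>; \<open>C\<close> and \<open>D\<close> are the Cayley transform and its inverse.\<close>
  define A where "A = (\<lambda>z. (G z - of_real r) / of_real q)"
  define C where "C = (\<lambda>z::complex. (z - \<i>) / (z + \<i>))"
  define D where "D = (\<lambda>w::complex. \<i> * (1 + w) / (1 - w))"
  define B where "B = (\<lambda>w. C (A (D w)))"
  have ne: "z + \<i> \<noteq> 0" if "z \<in> upper_half" for z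
    using that by (auto simp: upper_half_def complex_eq_iff)
  have Cball: "cmod (C z) < 1" if "z \<in> upper_half" for z
  proof -
    have "(cmod (z - \<i>))\<^sup>2 < (cmod (z + \<i>))\<^sup>2"
      using that unfolding cmod_power2 by (simp add: upper_half_def power2_eq_square algebra_simps)
    then have "cmod (z - \<i>) < cmod (z + \<i>)"
      by (rule power2_less_imp_less) simp
    then show ?thesis
      using ne[OF that] by (simp add: C_def norm_divide)
  qed
  have Dup: "D w \<in> upper_half" if "cmod w < 1" for w
  proof -
    have w1: "w \<noteq> 1" using that by auto
    have "(cmod w)\<^sup>2 < 1"
      using that by (simp add: abs_square_less_1)
    then have *: "(Re w)\<^sup>2 + (Im w)\<^sup>2 < 1"
      by (simp add: cmod_power2)
    have "0 < (cmod (1 - w))\<^sup>2"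
      using w1 by simp
    then have **: "0 < (1 - Re w)\<^sup>2 + (Im w)\<^sup>2"
      by (simp add: cmod_power2)
    have "Im (D w) = (1 - (Re w)\<^sup>2 - (Im w)\<^sup>2) / ((1 - Re w)\<^sup>2 + (Im w)\<^sup>2)"
      by (simp add: D_def Im_divide power2_eq_square algebra_simps)
    then show ?thesis
      using * ** by (simp add: upper_half_def)
  qed
  have DC: "D (C z) = z" if "z \<in> upper_half" for z
  proof -
    have 1: "1 + C z = 2 * z / (z + \<i>)" "1 - C z = 2 * \<i> / (z + \<i>)"
      using ne[OF that] by (simp_all add: C_def field_simps)
    show ?thesis
      unfolding D_def 1 using ne[OF that] by simp
  qed
  have Cinj: "z = w" if "C z = C w" "z \<in> upper_half" "w \<in> upper_half" for z w
    using DC that by metis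
  have Aup: "A z \<in> upper_half" if "z \<in> upper_half" for z
    using pos[OF that] q by (simp add: A_def upper_half_def Im_divide_of_real)
  have Ai: "A \<i> = \<i>"
    using q by (simp add: A_def q_def r_def complex_eq_iff Re_divide_of_real Im_divide_of_real)
  have holB: "B holomorphic_on ball 0 1"
  proof -
    have "D holomorphic_on ball 0 1"
      unfolding D_def by (intro holomorphic_intros) auto
    moreover have "A holomorphic_on upper_half"
      unfolding A_def using q by (intro holomorphic_intros hol) auto
    moreover have "C holomorphic_on upper_half"
      unfolding C_def using ne by (intro holomorphic_intros) auto
    ultimately have "C \<circ> (A \<circ> D) holomorphic_on ball 0 1"
      using Dup Aup by (intro holomorphic_on_compose_gen[of _ _ _ upper_half]) auto
    then show ?thesis
      by (simp add: B_def o_def)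
  qed
  have B0: "B 0 = 0"
    by (simp add: B_def D_def Ai) (simp add: C_def)
  have B1: "cmod (B w) < 1" if "cmod w < 1" for w
    unfolding B_def by (intro Cball Aup Dup that)
  define a where "a = A (\<i> * of_real e)"
  define \<zeta> where "\<zeta> = C (\<i> * of_real e)"
  have ie: "\<i> * of_real e \<in> upper_half"
    using e1 by (simp add: upper_half_def)
  have aup: "a \<in> upper_half"
    unfolding a_def by (rule Aup[OF ie])
  have \<zeta>: "\<zeta> = of_real ((e - 1) / (e + 1))"
    using e1 ne[OF ie] by (simp add: \<zeta>_def C_def complex_eq_iff Re_divide Im_divide power2_eq_square divide_simps)
  have \<zeta>1: "cmod \<zeta> < 1"
    unfolding \<zeta>_def by (rule Cball[OF ie])
  have c\<zeta>: "cmod \<zeta> = (e - 1) / (e + 1)"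
    using e1 unfolding \<zeta> norm_of_real by simp
  have B\<zeta>: "B \<zeta> = C a"
    by (simp add: B_def \<zeta>_def DC[OF ie] a_def)
  have Ima: "Im a = e"
    using eq q by (simp add: a_def A_def Im_divide_of_real e_def q_def)
  define x where "x = Re a"
  have mods: "(cmod (a - \<i>))\<^sup>2 = x\<^sup>2 + (e - 1)\<^sup>2" "(cmod (a + \<i>))\<^sup>2 = x\<^sup>2 + (e + 1)\<^sup>2"
    by (simp_all add: cmod_power2 Ima x_def)
  \<comment> \<open>Among the points of height \<open>e\<close>, the one closest to \<open>\<i>\<close> in the hyperbolic metric is \<open>\<i> * e\<close>.\<close>
  have le: "cmod (C a) \<le> cmod \<zeta>"
    using Schwarz_Lemma(1)[OF holB B0 B1 \<zeta>1] by (simp add: B\<zeta>)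
  then have "cmod (a - \<i>) * (e + 1) \<le> (e - 1) * cmod (a + \<i>)"
    using e1 ne[OF aup] by (simp add: C_def norm_divide c\<zeta> divide_simps mult.commute)
  then have "(cmod (a - \<i>) * (e + 1))\<^sup>2 \<le> ((e - 1) * cmod (a + \<i>))\<^sup>2"
    using e1 by (intro power_mono) auto
  then have "(x\<^sup>2 + (e - 1)\<^sup>2) * (e + 1)\<^sup>2 \<le> (e - 1)\<^sup>2 * (x\<^sup>2 + (e + 1)\<^sup>2)"
    by (simp add: power_mult_distrib mods)
  then have "4 * e * x\<^sup>2 \<le> 0"
    by (simp add: power2_eq_square algebra_simps)
  then have "x = 0"
    using e1 by (simp add: mult_le_0_iff)
  then have a: "a = \<i> * of_real e"
    using Ima by (simp add: complex_eq_iff x_def)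
  have \<zeta>0: "\<zeta> \<noteq> 0"
    using e1 c\<zeta> by auto
  have B\<zeta>': "B \<zeta> = \<zeta>"
    by (metis B\<zeta> a \<zeta>_def)
  then have "\<exists>z. cmod z < 1 \<and> z \<noteq> 0 \<and> cmod (B z) = cmod z"
    using \<zeta>0 \<zeta>1 by metis
  then obtain \<alpha> where \<alpha>: "\<And>z. cmod z < 1 \<Longrightarrow> B z = \<alpha> * z"
    using Schwarz_Lemma(3)[OF holB B0 B1 \<zeta>1] by blast
  have "\<alpha> = 1"
    using \<alpha>[OF \<zeta>1] B\<zeta>' \<zeta>0 by simp
  have "G z = of_real q * z + of_real r" if "z \<in> upper_half" for z
  proof -
    have "C (A z) = C z"
      using \<alpha>[OF Cball[OF that]] \<open>\<alpha> = 1\<close> by (simp add: B_def DC[OF that])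
    then have "A z = z"
      using Cinj Aup that by blast
    then show ?thesis
      using q by (simp add: A_def field_simps)
  qed
  then show ?thesis
    using q by blast
qed

text \<open>
  If \<open>F\<close> attains modulus one it is constant; otherwise \<open>- \<i> log F\<close> maps the half-plane to itself and
  is affine by \<open>upper_half_isometry_rigid\<close>.
\<close>
lemma upper_half_scaling_exponential:
  assumes hol: "F holomorphic_on upper_half"
    and nz: "\<And>z. z \<in> upper_half \<Longrightarrow> F z \<noteq> 0"
    and le1: "\<And>z. z \<in> upper_half \<Longrightarrow> cmod (F z) \<le> 1"
    and scale: "ln (cmod (F (\<i> * of_real (exp 1)))) = exp 1 * ln (cmod (F \<i>))"
  shows "\<exists>\<alpha> k. cmod \<alpha> = 1 \<and> 0 \<le> k \<and> (\<forall>z\<in>upper_half. F z = \<alpha> * exp (\<i> * of_real k * z))"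
proof -
  obtain g where g: "g holomorphic_on upper_half" "\<And>z. z \<in> upper_half \<Longrightarrow> exp (g z) = F z"
    using holomorphic_logarithm_exists[OF convex_upper_half open_upper_half hol nz ii_upper_half] by metis
  have Re: "Re (g z) = ln (cmod (F z))" if "z \<in> upper_half" for z
    unfolding g(2)[OF that, symmetric] norm_exp_eq_Re ln_exp ..
  show ?thesis
  proof (cases "\<exists>w\<in>upper_half. cmod (F w) = 1")
    case True
    then obtain w where w: "w \<in> upper_half" "cmod (F w) = 1" by blast
    have "F constant_on upper_half"
      using w le1 by (intro maximum_modulus_principle[OF hol open_upper_half connected_upper_half open_upper_half _ w(1)]) auto
    then obtain c where c: "\<And>z. z \<in> upper_half \<Longrightarrow> F z = c"
      unfolding constant_on_def by blast
    then have "cmod c = 1" "\<forall>z\<in>upper_half. F z = c * exp (\<i> * of_real 0 * z)"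
      using w by auto
    then show ?thesis
      by (intro exI[of _ c] exI[of _ "0::real"]) simp
  next
    case False
    define G where "G = (\<lambda>z. - \<i> * g z)"
    have pos: "0 < Im (G z)" if "z \<in> upper_half" for z
      using Re[OF that] False le1[OF that] nz[OF that] that
      by (simp add: G_def order_less_le)
    have "\<exists>q r::real. 0 < q \<and> (\<forall>z\<in>upper_half. G z = of_real q * z + of_real r)"
    proof (rule upper_half_isometry_rigid)
      show "G holomorphic_on upper_half"
        unfolding G_def by (intro holomorphic_intros g)
      have "\<i> * of_real (exp 1) \<in> upper_half"
        by (simp add: upper_half_def)
      from Re[OF this] show "Im (G (\<i> * of_real (exp 1))) = exp 1 * Im (G \<i>)"
        using scale Re[OF ii_upper_half] by (simp add: G_def)
    qed (rule pos)
    then obtain q r :: real where q: "0 < q" "\<And>z. z \<in> upper_half \<Longrightarrow> G z = of_real q * z + of_real r"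
      by blast
    have "F z = exp (\<i> * of_real r) * exp (\<i> * of_real q * z)" if "z \<in> upper_half" for z
    proof -
      have "g z = \<i> * G z"
        by (simp add: G_def)
      then have "g z = \<i> * of_real r + \<i> * of_real q * z"
        using q(2)[OF that] by (simp add: algebra_simps)
      then show ?thesis
        using g(2)[OF that] by (simp add: exp_add)
    qed
    then show ?thesis
      using q by (intro exI[of _ "exp (\<i> * of_real r)"] exI[of _ q]) auto
  qed
qed

text \<open>
  Cauchy's functional equation; nonnegativity makes \<open>g\<close> monotone, which replaces continuity.
\<close>
lemma additive_nonneg_linear:
  fixes g :: "real \<Rightarrow> real"
  assumes add: "\<And>s t. 0 < s \<Longrightarrow> 0 < t \<Longrightarrow> g (s + t) = g s + g t"
    and pos: "\<And>t. 0 < t \<Longrightarrow> 0 \<le> g t" and t: "0 < t"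
  shows "g t = t * g 1"
proof -
  have mono: "g s \<le> g t" if "0 < s" "s \<le> t" for s t
  proof (cases "s = t")
    case False
    then have "g t = g s + g (t - s)"
      using add[of s "t - s"] that by simp
    then show ?thesis
      using pos[of "t - s"] False that by simp
  qed simp
  have mult: "g (real (Suc n) * s) = real (Suc n) * g s" if "0 < s" for n s
  proof (induction n)
    case (Suc n)
    have "real (Suc (Suc n)) * s = s + real (Suc n) * s"
      by (simp add: algebra_simps)
    also have "g \<dots> = g s + g (real (Suc n) * s)"
      using that by (intro add) auto
    finally show ?case
      using Suc by (simp add: algebra_simps)
  qed simp
  have close: "\<bar>g t - t * g 1\<bar> \<le> g 1 / real (Suc n)" for n
  proof -
    define N where "N = real (Suc n)"
    have N: "0 < N" by (simp add: N_def)
    define m where "m = nat \<lfloor>N * t\<rfloor>"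
    have m: "real m \<le> N * t" "N * t < real m + 1"
      using N t by (auto simp: m_def)
    have gN: "g (N * t) = N * g t"
      using mult[OF t, of n] by (simp add: N_def)
    have g1: "0 \<le> g 1" using pos by simp
    have lower: "real m * g 1 \<le> g (N * t)"
    proof (cases m)
      case 0
      then show ?thesis using pos[of "N * t"] N t by simp
    next
      case (Suc k)
      then have "real m * g 1 = g (real m * 1)"
        using mult[of 1 k] by simp
      also have "\<dots> \<le> g (N * t)"
        using Suc m by (intro mono) auto
      finally show ?thesis .
    qed
    have "g (N * t) \<le> g (real (Suc m) * 1)"
      using m N t by (intro mono) auto
    then have upper: "g (N * t) \<le> (real m + 1) * g 1"
      using mult[of 1 m] by (simp add: add.commute)
    have "N * t * g 1 \<le> (real m + 1) * g 1" "real m * g 1 \<le> N * t * g 1"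
      using m g1 by (auto intro!: mult_right_mono)
    then have "\<bar>N * g t - N * t * g 1\<bar> \<le> g 1"
      using lower upper gN by (simp add: abs_le_iff algebra_simps)
    then have "N * \<bar>g t - t * g 1\<bar> \<le> g 1"
      using N by (simp add: abs_mult[symmetric, of N, simplified] right_diff_distrib mult.assoc)
         (metis abs_mult abs_of_pos mult.assoc right_diff_distrib)
    then show ?thesis
      unfolding N_def[symmetric] using N by (simp add: pos_le_divide_eq mult.commute)
  qed
  have "(\<lambda>n. g 1 / real (Suc n)) \<longlonglongrightarrow> 0"
    using tendsto_mult[OF tendsto_const[of "g 1"] LIMSEQ_inverse_real_of_nat] by (simp add: divide_inverse)
  then have "\<bar>g t - t * g 1\<bar> \<le> 0"
    using close by (intro LIMSEQ_le_const) auto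
  then show ?thesis by simp
qed

lemma hardy_semigroup_mult:
  fixes f :: "real \<Rightarrow> real \<Rightarrow> complex"
  assumes ext: "\<And>t. 0 < t \<Longrightarrow> hardy_extension (f t) (F t)"
    and mult: "\<And>s t x. 0 < s \<Longrightarrow> 0 < t \<Longrightarrow> f (s + t) x = f s x * f t x"
    and st: "0 < s" "0 < t" and z: "z \<in> closed_upper_half"
  shows "F (s + t) z = F s z * F t z"
proof -
  have "hardy_extension (f (s + t)) (F (s + t))"
    by (rule ext) (use st in simp)
  moreover have "hardy_extension (f (s + t)) (\<lambda>z. F s z * F t z)"
    using hardy_extension_mult[OF ext[OF st(1)] ext[OF st(2)]] unfolding mult[OF st, symmetric] .
  ultimately show ?thesis
    using z by (rule hardy_extension_unique)
qed

text \<open>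
  At a zero of order \<open>n\<close>, \<open>F t\<close> cannot be a power with exponent \<open>Suc n\<close> of an analytic function, but
  \<open>F t\<close> is such a power of \<open>F (t / Suc n)\<close>.
\<close>
lemma hardy_semigroup_nonzero:
  fixes f :: "real \<Rightarrow> real \<Rightarrow> complex"
  assumes ext: "\<And>t. 0 < t \<Longrightarrow> hardy_extension (f t) (F t)"
    and mult: "\<And>s t x. 0 < s \<Longrightarrow> 0 < t \<Longrightarrow> f (s + t) x = f s x * f t x"
    and nz: "\<And>t. 0 < t \<Longrightarrow> \<exists>x. f t x \<noteq> 0"
    and t: "0 < t" and z: "z \<in> upper_half"
  shows "F t z \<noteq> 0"
proof
  assume Fz: "F t z = 0"
  have Fhol: "F s holomorphic_on upper_half" and Fcont: "continuous_on closed_upper_half (F s)"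
    and Fre: "F s (of_real x) = f s x" if "0 < s" for s x
    using ext[OF that] by (auto simp: hardy_extension_def)
  have nonconst: "\<not> F t constant_on upper_half"
  proof
    assume "F t constant_on upper_half"
    then have "F t w = 0" if "w \<in> upper_half" for w
      using Fz z that unfolding constant_on_def by metis
    then have "F t w = 0" if "w \<in> closed_upper_half" for w
      using closed_upper_half_cong[OF Fcont[OF t] continuous_on_const _ that, of 0] by simp
    then have "f t x = 0" for x
      using Fre[OF t] of_real_closed_upper_half by metis
    then show False using nz[OF t] by simp
  qed
  obtain n r h where h: "0 < n" "0 < r" "ball z r \<subseteq> upper_half" "h holomorphic_on ball z r"
      "\<And>w. w \<in> ball z r \<Longrightarrow> F t w = (w - z) ^ n * h w" "\<And>w. w \<in> ball z r \<Longrightarrow> h w \<noteq> 0"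
  proof (rule holomorphic_factor_zero_nonconstant[OF Fhol[OF t] open_upper_half connected_upper_half
          z Fz nonconst])
    fix g r n
    assume "0 < n" "0 < r" "ball z r \<subseteq> upper_half" "g holomorphic_on ball z r"
      "\<And>w. w \<in> ball z r \<Longrightarrow> F t w = (w - z) ^ n * g w" "\<And>w. w \<in> ball z r \<Longrightarrow> g w \<noteq> 0"
    then show thesis
      by (rule that)
  qed
  define s where "s = t / real (Suc n)"
  have s: "0 < s" using t by (simp add: s_def)
  have pow: "F (real (Suc m) * s) w = F s w ^ Suc m" if "w \<in> closed_upper_half" for m w
  proof (induction m)
    case (Suc m)
    have eq: "real (Suc (Suc m)) * s = s + real (Suc m) * s"
      by (simp add: algebra_simps)
    have "F (s + real (Suc m) * s) w = F s w * F (real (Suc m) * s) w"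
      using s by (intro hardy_semigroup_mult[where f = f and F = F, OF ext mult _ _ that]) auto
    then show ?case
      unfolding eq using Suc by simp
  qed simp
  have Fpow: "F t w = F s w ^ Suc n" if "w \<in> upper_half" for w
    using pow[of w n] that upper_half_subset by (auto simp: s_def)
  then have "F s z = 0"
    using Fz z by (metis power_eq_0_iff)
  have D: "(F s has_field_derivative deriv (F s) z) (at z)"
    using holomorphic_derivI[OF Fhol[OF s] open_upper_half z] .
  have "((\<lambda>w. (F s w - F s z) / (w - z)) \<longlongrightarrow> deriv (F s) z) (at z)"
    using D by (simp add: has_field_derivative_iff)
  \<comment> \<open>Dividing \<open>F s ^ Suc n\<close> by \<open>(w - z) ^ n\<close> leaves a function that vanishes at \<open>z\<close>, unlike \<open>h\<close>.\<close>
  then have "((\<lambda>w. (w - z) * ((F s w - F s z) / (w - z)) ^ Suc n) \<longlongrightarrow> (z - z) * deriv (F s) z ^ Suc n) (at z)"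
    by (intro tendsto_intros)
  moreover have "\<forall>\<^sub>F w in at z. (w - z) * ((F s w - F s z) / (w - z)) ^ Suc n = h w"
  proof -
    have "\<forall>\<^sub>F w in at z. w \<in> ball z r \<and> w \<noteq> z"
      using h(2) eventually_at_ball'[of r z UNIV] by (auto elim: eventually_mono)
    then show ?thesis
    proof eventually_elim
      case (elim w)
      then have "w \<in> upper_half" using h(3) by blast
      then have "F s w ^ Suc n = (w - z) ^ n * h w"
        using Fpow[of w] h(5)[of w] elim by metis
      then have "(w - z) * (F s w / (w - z)) ^ Suc n = h w"
        using elim by (simp only: power_divide) (simp add: divide_simps)
      then show ?case
        using \<open>F s z = 0\<close> by simp
    qed
  qed
  ultimately have "(h \<longlongrightarrow> 0) (at z)"
    by (simp add: tendsto_cong)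
  moreover have "(h \<longlongrightarrow> h z) (at z)"
    using continuous_on_interior[OF holomorphic_on_imp_continuous_on[OF h(4)], of z] h(2)
    by (simp add: isCont_def interior_open)
  ultimately have "h z = 0"
    using tendsto_unique[OF at_neq_bot] by blast
  then show False
    using h(6)[of z] h(2) by simp
qed

lemma hardy_semigroup_modulus:
  fixes f :: "real \<Rightarrow> real \<Rightarrow> complex"
  assumes ext: "\<And>t. 0 < t \<Longrightarrow> hardy_extension (f t) (F t)"
    and mult: "\<And>s t x. 0 < s \<Longrightarrow> 0 < t \<Longrightarrow> f (s + t) x = f s x * f t x"
    and nz: "\<And>t. 0 < t \<Longrightarrow> \<exists>x. f t x \<noteq> 0"
    and le1: "\<And>t x. 0 < t \<Longrightarrow> cmod (f t x) \<le> 1"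
    and t: "0 < t" and z: "z \<in> upper_half"
  shows "ln (cmod (F t z)) = t * ln (cmod (F 1 z))"
proof -
  have zc: "z \<in> closed_upper_half"
    using z upper_half_subset by blast
  have nzF: "F t z \<noteq> 0" if "0 < t" for t
    using hardy_semigroup_nonzero[where f = f and F = F, OF ext mult nz that z] by simp
  have "- ln (cmod (F t z)) = t * - ln (cmod (F 1 z))"
  proof (rule additive_nonneg_linear[OF _ _ t, of "\<lambda>t. - ln (cmod (F t z))"])
    fix s t :: real assume st: "0 < s" "0 < t"
    then show "- ln (cmod (F (s + t) z)) = - ln (cmod (F s z)) + - ln (cmod (F t z))"
      using hardy_semigroup_mult[where f = f and F = F, OF ext mult st zc] nzF by (simp add: norm_mult ln_mult)
  next
    fix t :: real assume "0 < t"
    then show "0 \<le> - ln (cmod (F t z))"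
      using hardy_extension_bound[OF ext le1 zc, of t] nzF[of t] by simp
  qed
  then show ?thesis by simp
qed

text \<open>
  The scaling law moves the value at \<open>\<i> exp 1\<close> to time \<open>exp 1 * t\<close>, where the logarithm of the
  modulus is \<open>exp 1\<close> times as large. This is the hypothesis of \<open>upper_half_scaling_exponential\<close>.
\<close>
lemma hardy_semigroup_expanding:
  fixes f :: "real \<Rightarrow> real \<Rightarrow> complex"
  assumes hardy: "\<And>t. 0 < t \<Longrightarrow> \<exists>F. hardy_extension (f t) F"
    and mult: "\<And>s t x. 0 < s \<Longrightarrow> 0 < t \<Longrightarrow> f (s + t) x = f s x * f t x"
    and nz: "\<And>t. 0 < t \<Longrightarrow> \<exists>x. f t x \<noteq> 0"
    and le1: "\<And>t x. 0 < t \<Longrightarrow> cmod (f t x) \<le> 1"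
    and scale: "\<And>t x. 0 < t \<Longrightarrow> f t (exp 1 * x) = f (exp 1 * t) x"
    and t: "0 < t"
  shows "\<exists>\<alpha> k. cmod \<alpha> = 1 \<and> 0 \<le> k \<and> (\<forall>x. f t x = \<alpha> * exp (\<i> * of_real k * of_real x))"
proof -
  obtain F where ext: "\<And>t. 0 < t \<Longrightarrow> hardy_extension (f t) (F t)"
    using hardy by metis
  have i: "\<i> \<in> closed_upper_half"
    using ii_upper_half upper_half_subset by blast
  have et: "0 < exp 1 * t"
    using t by simp
  have "hardy_extension (\<lambda>x. f t (exp 1 * x)) (F (exp 1 * t))"
    using ext[OF et] unfolding scale[OF t] .
  then have "F t (of_real (exp 1) * \<i>) = F (exp 1 * t) \<i>"
    by (rule hardy_extension_unique[OF hardy_extension_dilate[OF ext[OF t] exp_gt_zero] _ i])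
  then have "ln (cmod (F t (\<i> * of_real (exp 1)))) = exp 1 * t * ln (cmod (F 1 \<i>))"
    using hardy_semigroup_modulus[where f = f and F = F, OF ext mult nz le1 _ ii_upper_half, of "exp 1 * t"] t by (simp add: mult.commute)
  then have sc: "ln (cmod (F t (\<i> * of_real (exp 1)))) = exp 1 * ln (cmod (F t \<i>))"
    using hardy_semigroup_modulus[where f = f and F = F, OF ext mult nz le1 t ii_upper_half] by simp
  have "\<exists>\<alpha> k. cmod \<alpha> = 1 \<and> 0 \<le> k \<and> (\<forall>z\<in>upper_half. F t z = \<alpha> * exp (\<i> * of_real k * z))"
  proof (rule upper_half_scaling_exponential[OF _ _ _ sc])
    show "F t holomorphic_on upper_half"
      using ext[OF t] by (simp add: hardy_extension_def)
    show "F t z \<noteq> 0" if "z \<in> upper_half" for z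
      by (rule hardy_semigroup_nonzero[where f = f and F = F, OF ext mult nz t that])
    show "cmod (F t z) \<le> 1" if "z \<in> upper_half" for z
      using hardy_extension_bound[OF ext[OF t] le1[OF t]] that upper_half_subset by blast
  qed
  then obtain \<alpha> k where k: "cmod \<alpha> = 1" "0 \<le> k" "\<And>z. z \<in> upper_half \<Longrightarrow> F t z = \<alpha> * exp (\<i> * of_real k * z)"
    by blast
  have "F t (of_real x) = \<alpha> * exp (\<i> * of_real k * of_real x)" for x
    by (rule closed_upper_half_cong[of "F t" "\<lambda>z. \<alpha> * exp (\<i> * of_real k * z)"])
       (use ext[OF t] k in \<open>auto simp: hardy_extension_def intro!: continuous_intros\<close>)
  moreover have "F t (of_real x) = f t x" for x
    using ext[OF t] by (simp add: hardy_extension_def)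
  ultimately show ?thesis
    using k by (intro exI[of _ \<alpha>] exI[of _ k]) simp
qed

text \<open>
  With the opposite scaling law, \<open>upper_half_scaling_exponential\<close> applies after the inversion
  \<open>z \<mapsto> - 1 / z\<close> and gives \<open>\<alpha> exp (- \<i> k / z)\<close>. Unless \<open>k = 0\<close>, its modulus has different limits at zero
  along the imaginary axis and along a horocycle, whereas the extension is continuous up to the
  boundary.
\<close>
lemma hardy_semigroup_contracting:
  fixes f :: "real \<Rightarrow> real \<Rightarrow> complex"
  assumes hardy: "\<And>t. 0 < t \<Longrightarrow> \<exists>F. hardy_extension (f t) F"
    and mult: "\<And>s t x. 0 < s \<Longrightarrow> 0 < t \<Longrightarrow> f (s + t) x = f s x * f t x"
    and nz: "\<And>t. 0 < t \<Longrightarrow> \<exists>x. f t x \<noteq> 0"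
    and le1: "\<And>t x. 0 < t \<Longrightarrow> cmod (f t x) \<le> 1"
    and scale: "\<And>t x. 0 < t \<Longrightarrow> f (exp 1 * t) (exp 1 * x) = f t x"
    and t: "0 < t"
  shows "\<exists>\<alpha>. \<forall>x. f t x = \<alpha>"
proof -
  obtain F where ext: "\<And>t. 0 < t \<Longrightarrow> hardy_extension (f t) (F t)"
    using hardy by metis
  define w where "w = \<i> * of_real (exp (- 1))"
  have w: "w \<in> closed_upper_half" "w \<in> upper_half"
    by (auto simp: w_def closed_upper_half_def upper_half_def)
  have "of_real (exp 1) * w = \<i>"
    by (simp add: w_def complex_eq_iff flip: exp_add)
  moreover have "F (exp 1 * t) (of_real (exp 1) * w) = F t w"
  proof -
    have et: "0 < exp 1 * t"
      using t by simp
    have "hardy_extension (\<lambda>x. f (exp 1 * t) (exp 1 * x)) (F t)"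
      using ext[OF t] unfolding scale[OF t] .
    then show ?thesis
      by (rule hardy_extension_unique[OF hardy_extension_dilate[OF ext[OF et] exp_gt_zero] _ w(1)])
  qed
  ultimately have "ln (cmod (F t w)) = exp 1 * t * ln (cmod (F 1 \<i>))"
    using hardy_semigroup_modulus[where f = f and F = F, OF ext mult nz le1 _ ii_upper_half, of "exp 1 * t"] t by (simp add: mult.commute)
  then have sc: "ln (cmod (F t w)) = exp 1 * ln (cmod (F t \<i>))"
    using hardy_semigroup_modulus[where f = f and F = F, OF ext mult nz le1 t ii_upper_half] by simp
  define J where "J = (\<lambda>z::complex. - (1 / z))"
  have J: "J z \<in> upper_half" if "z \<in> upper_half" for z
    using that by (auto simp: J_def upper_half_def Im_divide divide_less_0_iff sum_power2_gt_zero_iff)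
  have JJ: "J (J z) = z" for z
    by (simp add: J_def)
  have Jw: "J (\<i> * of_real (exp 1)) = w"
    by (simp add: J_def w_def complex_eq_iff Re_divide Im_divide exp_minus power2_eq_square field_simps)
  have Ji: "J \<i> = \<i>"
    by (simp add: J_def)
  have z0: "z \<noteq> 0" if "z \<in> upper_half" for z
    using that by (auto simp: upper_half_def)
  have "\<exists>\<alpha> k. cmod \<alpha> = 1 \<and> 0 \<le> k \<and> (\<forall>z\<in>upper_half. F t (J z) = \<alpha> * exp (\<i> * of_real k * z))"
  proof (rule upper_half_scaling_exponential)
    have "F t holomorphic_on upper_half"
      using ext[OF t] by (simp add: hardy_extension_def)
    moreover have "J holomorphic_on upper_half"
      unfolding J_def using z0 by (intro holomorphic_intros) auto
    ultimately have "F t \<circ> J holomorphic_on upper_half"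
      using J by (intro holomorphic_on_compose_gen[of _ _ _ upper_half]) auto
    then show "(\<lambda>z. F t (J z)) holomorphic_on upper_half"
      by (simp add: o_def)
    show "F t (J z) \<noteq> 0" if "z \<in> upper_half" for z
      by (rule hardy_semigroup_nonzero[where f = f and F = F, OF ext mult nz t J[OF that]])
    show "cmod (F t (J z)) \<le> 1" if "z \<in> upper_half" for z
      using hardy_extension_bound[OF ext[OF t] le1[OF t]] J[OF that] upper_half_subset by blast
    show "ln (cmod (F t (J (\<i> * of_real (exp 1))))) = exp 1 * ln (cmod (F t (J \<i>)))"
      using sc by (simp add: Jw Ji)
  qed
  then obtain \<alpha> k where k: "cmod \<alpha> = 1" "0 \<le> k" "\<And>z. z \<in> upper_half \<Longrightarrow> F t (J z) = \<alpha> * exp (\<i> * of_real k * z)"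
    by blast
  have cont: "continuous_on closed_upper_half (F t)"
    using ext[OF t] by (simp add: hardy_extension_def)
  have mod: "cmod (F t (J z)) = exp (- k * Im z)" if "z \<in> upper_half" for z
    using k(1) k(3)[OF that] by (simp add: norm_mult)
  have lim: "(\<lambda>n. cmod (F t (J (z n)))) \<longlonglongrightarrow> cmod (F t 0)"
    if "\<And>n. z n \<in> upper_half" "(\<lambda>n. J (z n)) \<longlonglongrightarrow> 0" for z
  proof (rule tendsto_norm, rule continuous_on_tendsto_compose[OF cont that(2)])
    show "0 \<in> closed_upper_half"
      by (simp add: closed_upper_half_def)
    show "\<forall>\<^sub>F n in sequentially. J (z n) \<in> closed_upper_half"
      using J[OF that(1)] upper_half_subset by (intro always_eventually) blast
  qed
  have "k = 0"
  proof (rule ccontr)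
    assume "k \<noteq> 0"
    then have k0: "0 < k" using k(2) by simp
    \<comment> \<open>Along \<open>?y\<close> the modulus tends to zero, along \<open>?h\<close> it is constantly \<open>exp (- k)\<close>.\<close>
    let ?y = "\<lambda>n. \<i> * of_real (real (Suc n))" and ?h = "\<lambda>n. of_real (real (Suc n)) + \<i>"
    have inv: "(\<lambda>n. inverse (of_real (real (Suc n)))) \<longlonglongrightarrow> (0::complex)"
      using LIMSEQ_inverse_real_of_nat tendsto_of_real[of _ 0 sequentially, where 'a = complex] by fastforce
    have "(\<lambda>n. \<i> * inverse (of_real (real (Suc n)))) \<longlonglongrightarrow> \<i> * 0"
      by (intro tendsto_intros inv)
    moreover have "J (?y n) = \<i> * inverse (of_real (real (Suc n)))" for n
      by (simp add: J_def divide_inverse del: of_nat_Suc)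
    ultimately have y: "(\<lambda>n. J (?y n)) \<longlonglongrightarrow> 0"
      by simp
    have "(\<lambda>n. cmod (F t (J (?y n)))) \<longlonglongrightarrow> cmod (F t 0)"
      by (rule lim[OF _ y]) (simp add: upper_half_def)
    moreover have "cmod (F t (J (?y n))) = exp (- k * real (Suc n))" for n
      by (subst mod) (simp_all add: upper_half_def)
    moreover have "(\<lambda>n. exp (- k * real (Suc n))) \<longlonglongrightarrow> 0"
      using k0 by real_asymp
    ultimately have "(\<lambda>n. exp (- k * real (Suc n))) \<longlonglongrightarrow> cmod (F t 0)"
      "(\<lambda>n. exp (- k * real (Suc n))) \<longlonglongrightarrow> 0"
      by (simp_all del: of_nat_Suc)
    then have F0: "cmod (F t 0) = 0"
      by (rule LIMSEQ_unique)
    have h: "(\<lambda>n. J (?h n)) \<longlonglongrightarrow> 0"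
    proof (rule Lim_null_comparison[OF always_eventually LIMSEQ_inverse_real_of_nat], rule allI)
      fix n
      have "real (Suc n) \<le> cmod (?h n)"
        using complex_Re_le_cmod[of "?h n"] by simp
      then show "cmod (J (?h n)) \<le> inverse (real (Suc n))"
        using le_imp_inverse_le[of "real (Suc n)" "cmod (?h n)"]
        by (simp add: J_def norm_divide norm_inverse divide_inverse del: of_nat_Suc)
    qed
    have "(\<lambda>n. cmod (F t (J (?h n)))) \<longlonglongrightarrow> cmod (F t 0)"
      by (rule lim[OF _ h]) (simp add: upper_half_def)
    moreover have "cmod (F t (J (?h n))) = exp (- k)" for n
      by (subst mod) (simp_all add: upper_half_def)
    ultimately have "(\<lambda>n. exp (- k)) \<longlonglongrightarrow> cmod (F t 0)"
      by (simp del: of_nat_Suc)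
    then have "cmod (F t 0) = exp (- k)"
      by (simp add: LIMSEQ_const_iff)
    then show False
      using F0 by simp
  qed
  have const: "F t z = \<alpha>" if "z \<in> upper_half" for z
    using k(3)[OF J[OF that]] \<open>k = 0\<close> by (simp add: JJ)
  have "F t (of_real x) = \<alpha>" for x
    by (rule closed_upper_half_cong[OF cont continuous_on_const const]) auto
  moreover have "F t (of_real x) = f t x" for x
    using ext[OF t] by (simp add: hardy_extension_def)
  ultimately show ?thesis
    by auto
qed

section \<open>The Hermitian inner product\<close>

lemma L2_relI: "square_integrable f \<Longrightarrow> (\<And>x. f x = g x) \<Longrightarrow> L2_rel f g"
proof -
  assume f: "square_integrable f" and fg: "\<And>x. f x = g x"
  then have "f = g" by auto
  with f show ?thesis by (simp add: L2_rel_def)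
qed

lemma L2_rel_square_integrable: "L2_rel f g \<Longrightarrow> square_integrable f"
  by (simp add: L2_rel_def)

lemma square_integrable_exp_mult:
  "square_integrable f \<Longrightarrow> square_integrable (\<lambda>x. exp (\<i> * of_real l * of_real x) * f x)"
  using square_integrable_modulate[of f l] by (simp add: cis_conv_exp mult.assoc)

lemma scaleC_add_left: "(a + b) *\<^sub>C F = a *\<^sub>C F + b *\<^sub>C F"
proof transfer
  fix a b :: complex and f assume "L2_rel f f"
  then have "square_integrable (\<lambda>x. (a + b) * f x)"
    by (intro square_integrable_cmult) (simp add: L2_rel_def)
  then show "L2_rel (\<lambda>x. (a + b) * f x) (\<lambda>x. a * f x + b * f x)"
    by (rule L2_relI) (simp add: distrib_right)
qed

lemma scaleC_scaleC [simp]: "a *\<^sub>C b *\<^sub>C F = (a * b) *\<^sub>C F"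
  by transfer (auto intro!: L2_relI square_integrable_cmult dest: L2_rel_square_integrable)

lemma scaleC_one [simp]: "1 *\<^sub>C F = F"
  by transfer (auto intro!: L2_relI dest: L2_rel_square_integrable)

lemma scaleC_of_real: "of_real r *\<^sub>C F = r *\<^sub>R F"
  by transfer (auto intro!: L2_relI square_integrable_cmult dest: L2_rel_square_integrable simp: scaleR_conv_of_real)

lemma scaleC_zero_left [simp]: "0 *\<^sub>C F = 0"
  using scaleC_of_real[of 0 F] by simp

lemma scaleC_minus_left: "(- c) *\<^sub>C F = - (c *\<^sub>C F)"
  using scaleC_add_left[of "- c" c F] by (simp add: eq_neg_iff_add_eq_0)

lemma scaleC_diff_left: "(a - b) *\<^sub>C F = a *\<^sub>C F - b *\<^sub>C F"
  using scaleC_add_left[of a "- b" F] by (simp add: scaleC_minus_left)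

lemma scaleC_sum: "c *\<^sub>C (\<Sum>i\<in>I. F i) = (\<Sum>i\<in>I. c *\<^sub>C F i)"
  by (rule linear_sum[OF bounded_linear.linear[OF bounded_linear_scaleC]])

text \<open>
  The library inner product on the Hilbert space is the real part; the imaginary part is recovered by
  rotating one argument. The form is linear in the first argument.
\<close>
definition cinner :: "L2R \<Rightarrow> L2R \<Rightarrow> complex" where
  "cinner F G = Complex (F \<bullet> G) (F \<bullet> (\<i> *\<^sub>C G))"

lemma inner_scaleC_left: "(c *\<^sub>C F) \<bullet> G = F \<bullet> (cnj c *\<^sub>C G)"
proof transfer
  fix c :: complex and f g :: "real \<Rightarrow> complex"
  have "(c * f x) \<bullet> g x = f x \<bullet> (cnj c * g x)" for x
    by (simp add: inner_complex_def algebra_simps)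
  then show "integral\<^sup>L lborel (\<lambda>x. (c * f x) \<bullet> g x) = integral\<^sup>L lborel (\<lambda>x. f x \<bullet> (cnj c * g x))"
    by simp
qed

lemma Re_cinner [simp]: "Re (cinner F G) = F \<bullet> G"
  by (simp add: cinner_def)

lemma cinner_add_left: "cinner (F + G) H = cinner F H + cinner G H"
  by (simp add: cinner_def inner_add_left complex_eq_iff)

lemma cinner_diff_left: "cinner (F - G) H = cinner F H - cinner G H"
  by (simp add: cinner_def inner_diff_left complex_eq_iff)

lemma complex_scaleC: "c *\<^sub>C F = Re c *\<^sub>R F + Im c *\<^sub>R (\<i> *\<^sub>C F)"
proof -
  have "c = of_real (Re c) + of_real (Im c) * \<i>"
    by (simp add: complex_eq_iff)
  then have "c *\<^sub>C F = of_real (Re c) *\<^sub>C F + of_real (Im c) *\<^sub>C \<i> *\<^sub>C F"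
    by (metis scaleC_add_left scaleC_scaleC)
  then show ?thesis
    by (simp only: scaleC_of_real)
qed

lemma cinner_scaleC_right: "cinner F (c *\<^sub>C G) = cnj c * cinner F G"
proof -
  have "\<i> *\<^sub>C c *\<^sub>C G = Re c *\<^sub>R (\<i> *\<^sub>C G) + (- Im c) *\<^sub>R G"
    using complex_scaleC[of "\<i> * c" G] by simp
  then show ?thesis
    unfolding cinner_def complex_scaleC[of c G]
    by (simp add: complex_eq_iff inner_add_right inner_diff_right)
qed

lemma cinner_scaleC_left: "cinner (c *\<^sub>C F) G = c * cinner F G"
proof -
  have "cinner (c *\<^sub>C F) G = cinner F (cnj c *\<^sub>C G)"
    by (simp add: cinner_def inner_scaleC_left mult.commute)
  then show ?thesis
    by (simp add: cinner_scaleC_right)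
qed

lemma norm_cinner_le: "cmod (cinner F G) \<le> norm F * norm G"
proof (cases "cinner F G = 0")
  case False
  define c where "c = cnj (cinner F G) / of_real (cmod (cinner F G))"
  have c: "cmod c = 1"
    using False by (simp add: c_def norm_divide)
  have "cinner (c *\<^sub>C F) G = of_real (cmod (cinner F G))"
    using False complex_norm_square[of "cinner F G"]
    by (simp add: cinner_scaleC_left c_def field_simps power2_eq_square mult.commute)
  then have "cmod (cinner F G) = (c *\<^sub>C F) \<bullet> G"
    by (metis Re_cinner Re_complex_of_real)
  also have "\<dots> \<le> norm (c *\<^sub>C F) * norm G"
    by (rule norm_cauchy_schwarz)
  finally show ?thesis
    by (simp add: norm_scaleC c)
qed simp

lemma cinner_self: "cinner F F = of_real ((norm F)\<^sup>2)"
proof -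
  have "F \<bullet> (\<i> *\<^sub>C F) = - (F \<bullet> (\<i> *\<^sub>C F))"
    using inner_scaleC_left[of \<i> F F] by (simp add: inner_commute scaleC_minus_left)
  then show ?thesis
    by (simp add: cinner_def complex_eq_iff power2_norm_eq_inner)
qed

lemma cinner_sum_left: "cinner (\<Sum>i\<in>I. F i) G = (\<Sum>i\<in>I. cinner (F i) G)"
  by (induction I rule: infinite_finite_induct) (simp_all add: cinner_add_left, simp_all add: cinner_def complex_eq_iff)

lemma bessel_inequality:
  assumes fin: "finite I" and norm1: "\<And>i. i \<in> I \<Longrightarrow> norm (E i) = 1"
    and orth: "\<And>i j. i \<in> I \<Longrightarrow> j \<in> I \<Longrightarrow> i \<noteq> j \<Longrightarrow> cinner (E i) (E j) = 0"
  shows "(\<Sum>i\<in>I. (cmod (cinner F (E i)))\<^sup>2) \<le> (norm F)\<^sup>2"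
proof -
  let ?c = "\<lambda>i. cinner F (E i)"
  define P where "P = (\<Sum>i\<in>I. ?c i *\<^sub>C E i)"
  have PE: "cinner P (E j) = ?c j" if "j \<in> I" for j
  proof -
    have "cinner P (E j) = (\<Sum>i\<in>I. if i = j then ?c j else 0)"
      unfolding P_def cinner_sum_left cinner_scaleC_left
      using orth norm1 that by (intro sum.cong) (auto simp: cinner_self)
    then show ?thesis
      using fin that by simp
  qed
  have inner_P: "G \<bullet> P = (\<Sum>i\<in>I. Re (cnj (?c i) * cinner G (E i)))" for G
    unfolding P_def inner_sum_right
    by (intro sum.cong refl) (metis Re_cinner cinner_scaleC_right)
  have "F \<bullet> P = (\<Sum>i\<in>I. (cmod (?c i))\<^sup>2)"
    unfolding inner_P by (intro sum.cong refl) (simp only: cmod_power2, simp add: power2_eq_square)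
  moreover have "P \<bullet> P = (\<Sum>i\<in>I. (cmod (?c i))\<^sup>2)"
    unfolding inner_P by (intro sum.cong refl) (simp only: PE cmod_power2, simp add: power2_eq_square)
  moreover have "0 \<le> (F - P) \<bullet> (F - P)"
    by simp
  ultimately show ?thesis
    by (simp add: inner_diff_left inner_diff_right power2_norm_eq_inner inner_commute)
qed

section \<open>Commutation relations\<close>

lemma modulate_scaleC: "modulate l (c *\<^sub>C F) = c *\<^sub>C modulate l F"
  using generators_bounded_ops(1)[of l] by (simp add: bounded_ops_def)

lemma translate_scaleC: "translate m (c *\<^sub>C F) = c *\<^sub>C translate m F"
  using generators_bounded_ops(2)[of m] by (simp add: bounded_ops_def)

lemma modulate_0 [simp]: "modulate 0 F = F"
  by transfer (auto intro!: L2_relI dest: L2_rel_square_integrable)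

lemma translate_0 [simp]: "translate 0 F = F"
  by transfer (auto intro!: L2_relI dest: L2_rel_square_integrable)

lemma dilate_0 [simp]: "dilate 0 F = F"
  by transfer (auto intro!: L2_relI dest: L2_rel_square_integrable)

lemma modulate_modulate: "modulate l (modulate m F) = modulate (l + m) F"
proof transfer
  fix l m :: real and f assume "L2_rel f f"
  then have "square_integrable (\<lambda>x. exp (\<i> * of_real l * of_real x) * (exp (\<i> * of_real m * of_real x) * f x))"
    by (intro square_integrable_exp_mult) (simp add: L2_rel_def)
  then show "L2_rel (\<lambda>x. exp (\<i> * of_real l * of_real x) * (exp (\<i> * of_real m * of_real x) * f x))
      (\<lambda>x. exp (\<i> * of_real (l + m) * of_real x) * f x)"
    by (rule L2_relI) (simp add: mult.assoc[symmetric] distrib_left distrib_right flip: exp_add)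
qed

lemma translate_translate: "translate l (translate m F) = translate (l + m) F"
proof transfer
  fix l m :: real and f assume "L2_rel f f"
  then have "square_integrable (\<lambda>x. f (x - l - m))"
    using square_integrable_translate[OF square_integrable_translate[of f m], of l] by (simp add: L2_rel_def)
  then show "L2_rel (\<lambda>x. f (x - l - m)) (\<lambda>x. f (x - (l + m)))"
    by (rule L2_relI) (simp add: algebra_simps)
qed

lemma dilate_dilate: "dilate s (dilate t F) = dilate (s + t) F"
proof transfer
  fix s t :: real and f assume "L2_rel f f"
  then have "square_integrable (\<lambda>x. of_real (exp (s / 2)) * (of_real (exp (t / 2)) * f (exp t * (exp s * x))))"
    by (intro square_integrable_cmult square_integrable_dilate[of "\<lambda>x. f (exp t * x)"] square_integrable_dilate)
      (simp add: L2_rel_def)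
  then show "L2_rel (\<lambda>x. of_real (exp (s / 2)) * (of_real (exp (t / 2)) * f (exp t * (exp s * x))))
      (\<lambda>x. of_real (exp ((s + t) / 2)) * f (exp (s + t) * x))"
    by (rule L2_relI) (simp add: exp_add add_divide_distrib algebra_simps)
qed

lemma modulate_translate:
  "modulate l (translate m F) = exp (\<i> * of_real (l * m)) *\<^sub>C translate m (modulate l F)"
proof transfer
  fix l m :: real and f assume "L2_rel f f"
  then have "square_integrable (\<lambda>x. exp (\<i> * of_real l * of_real x) * f (x - m))"
    by (intro square_integrable_exp_mult square_integrable_translate) (simp add: L2_rel_def)
  then show "L2_rel (\<lambda>x. exp (\<i> * of_real l * of_real x) * f (x - m))
      (\<lambda>x. exp (\<i> * of_real (l * m)) * (exp (\<i> * of_real l * of_real (x - m)) * f (x - m)))"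
    by (rule L2_relI) (simp add: mult.assoc[symmetric] flip: exp_add, simp add: algebra_simps)
qed

lemma dilate_modulate: "dilate t (modulate l F) = modulate (exp t * l) (dilate t F)"
proof transfer
  fix l t :: real and f assume "L2_rel f f"
  then have "square_integrable (\<lambda>x. exp (\<i> * of_real (exp t * l) * of_real x) * (of_real (exp (t / 2)) * f (exp t * x)))"
    by (intro square_integrable_exp_mult square_integrable_cmult square_integrable_dilate) (simp add: L2_rel_def)
  moreover have "exp (\<i> * of_real (exp t * l) * of_real x) * (of_real (exp (t / 2)) * f (exp t * x)) =
      of_real (exp (t / 2)) * (exp (\<i> * of_real l * of_real (exp t * x)) * f (exp t * x))" for x
    by (simp add: ac_simps)
  ultimately show "L2_rel (\<lambda>x. of_real (exp (t / 2)) * (exp (\<i> * of_real l * of_real (exp t * x)) * f (exp t * x)))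
      (\<lambda>x. exp (\<i> * of_real (exp t * l) * of_real x) * (of_real (exp (t / 2)) * f (exp t * x)))"
    by (simp only: L2_rel_def) simp
qed

lemma dilate_translate: "dilate t (translate m F) = translate (exp (- t) * m) (dilate t F)"
proof transfer
  fix m t :: real and f assume "L2_rel f f"
  then have "square_integrable (\<lambda>x. of_real (exp (t / 2)) * f (exp t * x - m))"
    by (intro square_integrable_cmult square_integrable_dilate[of "\<lambda>x. f (x - m)"] square_integrable_translate)
      (simp add: L2_rel_def)
  moreover have "exp t * x - m = exp t * (x - exp (- t) * m)" for x
    by (simp add: right_diff_distrib mult.assoc[symmetric] flip: exp_add)
  ultimately show "L2_rel (\<lambda>x. of_real (exp (t / 2)) * f (exp t * x - m))
      (\<lambda>x. of_real (exp (t / 2)) * f (exp t * (x - exp (- t) * m)))"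
    by (simp add: L2_rel_def)
qed

section \<open>Bumps and multiplication operators\<close>

lemma square_integrable_bump:
  "square_integrable (\<lambda>x. complex_of_real (indicator {a<..<b} x / sqrt (b - a)))"
proof -
  have "integrable lborel (\<lambda>x. indicator {a<..<b} x * (1 / sqrt (b - a))\<^sup>2 :: real)"
    by (cases "a \<le> b") (auto intro!: integrable_mult_left integrable_real_indicator)
  then have "integrable lborel (\<lambda>x. (cmod (complex_of_real (indicator {a<..<b} x / sqrt (b - a))))\<^sup>2)"
    by (rule back_subst[of "integrable lborel"])
      (auto simp: fun_eq_iff norm_divide indicator_def power_divide)
  then show ?thesis
    unfolding square_integrable_def
    by (intro conjI borel_measurable_of_real borel_measurable_divide borel_measurable_indicator) auto
qed

lift_definition bump :: "real \<Rightarrow> real \<Rightarrow> L2R" is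
  "\<lambda>a b x. complex_of_real (indicator {a<..<b} x / sqrt (b - a))"
  by (intro L2_relI square_integrable_bump refl)

lemma norm_bump:
  assumes "a < b"
  shows "norm (bump a b) = 1"
  using assms
proof transfer
  fix a b :: real assume ab: "a < b"
  have "(\<lambda>x. (cmod (complex_of_real (indicator {a<..<b} x / sqrt (b - a))))\<^sup>2) =
      (\<lambda>x. indicator {a<..<b} x * (1 / (b - a)))"
    using ab by (auto simp: fun_eq_iff norm_divide indicator_def power_divide)
  then show "sqrt (integral\<^sup>L lborel (\<lambda>x. (cmod (complex_of_real (indicator {a<..<b} x / sqrt (b - a))))\<^sup>2)) = 1"
    using ab by simp
qed

lemma translate_bump: "translate m (bump a b) = bump (m + a) (m + b)"
proof transfer
  fix m a b :: real
  have "indicator {a<..<b} (x - m) = (indicator {m + a<..<m + b} x :: real)" for x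
    by (auto simp: indicator_def)
  then show "L2_rel (\<lambda>x. complex_of_real (indicator {a<..<b} (x - m) / sqrt (b - a)))
      (\<lambda>x. complex_of_real (indicator {m + a<..<m + b} x / sqrt (m + b - (m + a))))"
    using square_integrable_bump[of "m + a" "m + b"] by (simp add: L2_rel_def)
qed

lemma dilate_bump: "dilate t (bump a b) = bump (exp (- t) * a) (exp (- t) * b)"
proof transfer
  fix t a b :: real
  have ind: "indicator {a<..<b} (exp t * x) = (indicator {exp (- t) * a<..<exp (- t) * b} x :: real)" for x
    by (auto simp: indicator_def exp_minus field_simps)
  have "sqrt (exp (- t) * b - exp (- t) * a) = exp (- (t / 2)) * sqrt (b - a)"
  proof -
    have "sqrt (exp (- t)) = exp (- (t / 2))"
      by (rule real_sqrt_unique) (simp_all flip: exp_double)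
    then show ?thesis
      using real_sqrt_mult[of "exp (- t)" "b - a"] by (simp add: right_diff_distrib)
  qed
  then have q: "exp (t / 2) / sqrt (b - a) = 1 / sqrt (exp (- t) * b - exp (- t) * a)"
    by (metis divide_divide_eq_left' exp_minus inverse_eq_divide inverse_inverse_eq mult.commute)
  have "exp (t / 2) * (indicator {a<..<b} (exp t * x) / sqrt (b - a)) =
      indicator {exp (- t) * a<..<exp (- t) * b} x / sqrt (exp (- t) * b - exp (- t) * a)" for x
  proof -
    have "exp (t / 2) * (indicator {a<..<b} (exp t * x) / sqrt (b - a)) =
        indicator {exp (- t) * a<..<exp (- t) * b} x * (exp (t / 2) / sqrt (b - a))"
      unfolding ind by simp
    then show ?thesis
      unfolding q by simp
  qed
  then have "of_real (exp (t / 2)) * complex_of_real (indicator {a<..<b} (exp t * x) / sqrt (b - a)) =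
      complex_of_real (indicator {exp (- t) * a<..<exp (- t) * b} x / sqrt (exp (- t) * b - exp (- t) * a))" for x
    by (metis of_real_mult)
  then show "L2_rel (\<lambda>x. of_real (exp (t / 2)) * complex_of_real (indicator {a<..<b} (exp t * x) / sqrt (b - a)))
      (\<lambda>x. complex_of_real (indicator {exp (- t) * a<..<exp (- t) * b} x / sqrt (exp (- t) * b - exp (- t) * a)))"
    using square_integrable_bump by (simp only: L2_rel_def) simp
qed

definition admissible :: "(real \<Rightarrow> complex) \<Rightarrow> bool" where
  "admissible \<phi> \<longleftrightarrow> \<phi> \<in> borel_measurable borel \<and> bounded (range \<phi>)"

lemma square_integrable_admissible_mult:
  assumes \<phi>: "admissible \<phi>" and f: "square_integrable f"
  shows "square_integrable (\<lambda>x. \<phi> x * f x)"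
proof -
  have [measurable]: "\<phi> \<in> borel_measurable lborel" "f \<in> borel_measurable lborel"
    using \<phi> f by (auto simp: admissible_def square_integrable_def)
  obtain B where B: "\<And>x. cmod (\<phi> x) \<le> B"
    using \<phi> by (auto simp: admissible_def bounded_iff)
  have i: "integrable lborel (\<lambda>x. B\<^sup>2 * (cmod (f x))\<^sup>2)"
    using f by (simp add: square_integrable_def)
  have "integrable lborel (\<lambda>x. (cmod (\<phi> x * f x))\<^sup>2)"
  proof (rule Bochner_Integration.integrable_bound[OF i])
    show "AE x in lborel. norm ((cmod (\<phi> x * f x))\<^sup>2) \<le> norm (B\<^sup>2 * (cmod (f x))\<^sup>2)"
      using B by (auto simp: norm_mult power_mult_distrib intro!: mult_right_mono power_mono always_eventually)
  qed measurable
  then show ?thesis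
    by (simp add: square_integrable_def)
qed

text \<open>
  Multiplication is set to zero for functions that are not bounded and measurable, so that it
  respects the quotient for every function.
\<close>
lift_definition multiply :: "(real \<Rightarrow> complex) \<Rightarrow> L2R \<Rightarrow> L2R" is
  "\<lambda>\<phi> f x. (if admissible \<phi> then \<phi> x else 0) * f x"
proof -
  fix \<phi> :: "real \<Rightarrow> complex" and f g assume fg: "L2_rel f g"
  define \<psi> where "\<psi> = (\<lambda>x. if admissible \<phi> then \<phi> x else 0)"
  have "admissible \<psi>"
    by (cases "admissible \<phi>") (simp_all add: \<psi>_def, simp add: admissible_def)
  then have "square_integrable (\<lambda>x. \<psi> x * f x)" "square_integrable (\<lambda>x. \<psi> x * g x)"
    using fg by (auto simp: L2_rel_def square_integrable_admissible_mult)
  then have "L2_rel (\<lambda>x. \<psi> x * f x) (\<lambda>x. \<psi> x * g x)"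
    using fg by (auto simp: L2_rel_def elim: eventually_mono)
  then show "L2_rel (\<lambda>x. (if admissible \<phi> then \<phi> x else 0) * f x) (\<lambda>x. (if admissible \<phi> then \<phi> x else 0) * g x)"
    by (simp add: \<psi>_def)
qed

lemma admissible_mult: "admissible \<phi> \<Longrightarrow> admissible \<psi> \<Longrightarrow> admissible (\<lambda>x. \<phi> x * \<psi> x)"
  by (auto simp: admissible_def bounded_iff norm_mult intro!: borel_measurable_times)
    (meson mult_mono' norm_ge_zero)

lemma admissible_add: "admissible \<phi> \<Longrightarrow> admissible \<psi> \<Longrightarrow> admissible (\<lambda>x. \<phi> x + \<psi> x)"
  by (auto simp: admissible_def intro!: borel_measurable_add bounded_plus_comp)

lemma admissible_diff: "admissible \<phi> \<Longrightarrow> admissible \<psi> \<Longrightarrow> admissible (\<lambda>x. \<phi> x - \<psi> x)"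
  by (auto simp: admissible_def intro!: borel_measurable_diff bounded_minus_comp)

lemma admissible_const: "admissible (\<lambda>x. c)"
  by (auto simp: admissible_def)

lemma admissible_indicator: "A \<in> sets borel \<Longrightarrow> admissible (indicator A)"
  by (auto simp: admissible_def bounded_iff indicator_def intro!: exI[of _ 1])

lemma admissible_exp: "admissible (\<lambda>x. exp (\<i> * of_real l * of_real x))"
proof -
  have "continuous_on UNIV (\<lambda>x. exp (\<i> * of_real l * complex_of_real x))"
    by (intro continuous_intros)
  moreover have "bounded (range (\<lambda>x. exp (\<i> * of_real l * complex_of_real x)))"
    by (auto simp: bounded_iff intro!: exI[of _ 1])
  ultimately show ?thesis
    by (simp add: admissible_def borel_measurable_continuous_onI)
qed

lemma analytic_ap_admissible: "analytic_ap \<phi> \<Longrightarrow> admissible \<phi>"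
  by (simp add: admissible_def borel_measurable_continuous_onI analytic_ap_continuous analytic_ap_bounded)

lemma admissible_affine:
  assumes "admissible \<phi>"
  shows "admissible (\<lambda>x. \<phi> (c * x + d))"
proof -
  have "(\<lambda>x. \<phi> (c * x + d)) \<in> borel_measurable borel"
    using assms by (intro measurable_compose[of "\<lambda>x. c * x + d" borel borel \<phi>]) (auto simp: admissible_def)
  moreover have "bounded (range (\<lambda>x. \<phi> (c * x + d)))"
    using assms by (auto simp: admissible_def intro: bounded_subset)
  ultimately show ?thesis
    by (simp add: admissible_def)
qed

lemma multiply_exp: "multiply (\<lambda>x. exp (\<i> * of_real l * of_real x)) F = modulate l F"
  by transfer (auto simp: admissible_exp intro!: L2_relI square_integrable_exp_mult dest: L2_rel_square_integrable)

lemma multiply_const: "multiply (\<lambda>x. c) F = c *\<^sub>C F"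
  by transfer (auto simp: admissible_const intro!: L2_relI square_integrable_cmult dest: L2_rel_square_integrable)

lemma multiply_add: "multiply \<phi> (F + G) = multiply \<phi> F + multiply \<phi> G"
proof transfer
  fix \<phi> :: "real \<Rightarrow> complex" and f g assume "L2_rel f f" "L2_rel g g"
  then have "square_integrable (\<lambda>x. (if admissible \<phi> then \<phi> x else 0) * (f x + g x))"
    by (cases "admissible \<phi>")
      (auto simp: L2_rel_def square_integrable_zero intro!: square_integrable_admissible_mult square_integrable_add)
  then show "L2_rel (\<lambda>x. (if admissible \<phi> then \<phi> x else 0) * (f x + g x))
      (\<lambda>x. (if admissible \<phi> then \<phi> x else 0) * f x + (if admissible \<phi> then \<phi> x else 0) * g x)"
    by (rule L2_relI) (simp add: distrib_left)
qed

lemma multiply_scaleC: "multiply \<phi> (c *\<^sub>C F) = c *\<^sub>C multiply \<phi> F"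
proof transfer
  fix \<phi> :: "real \<Rightarrow> complex" and c f assume "L2_rel f f"
  then have "square_integrable (\<lambda>x. (if admissible \<phi> then \<phi> x else 0) * (c * f x))"
    by (cases "admissible \<phi>")
      (auto simp: L2_rel_def square_integrable_zero intro!: square_integrable_admissible_mult square_integrable_cmult)
  then show "L2_rel (\<lambda>x. (if admissible \<phi> then \<phi> x else 0) * (c * f x))
      (\<lambda>x. c * ((if admissible \<phi> then \<phi> x else 0) * f x))"
    by (rule L2_relI) simp
qed

lemma multiply_multiply:
  assumes "admissible \<phi>" "admissible \<psi>"
  shows "multiply \<phi> (multiply \<psi> F) = multiply (\<lambda>x. \<phi> x * \<psi> x) F"
  using assms
proof transfer
  fix \<phi> \<psi> :: "real \<Rightarrow> complex" and f assume *: "L2_rel f f" "admissible \<phi>" "admissible \<psi>"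
  then have "square_integrable (\<lambda>x. \<phi> x * (\<psi> x * f x))"
    by (intro square_integrable_admissible_mult) (auto simp: L2_rel_def)
  then show "L2_rel (\<lambda>x. (if admissible \<phi> then \<phi> x else 0) * ((if admissible \<psi> then \<psi> x else 0) * f x))
      (\<lambda>x. (if admissible (\<lambda>x. \<phi> x * \<psi> x) then \<phi> x * \<psi> x else 0) * f x)"
    using * by (simp add: admissible_mult L2_rel_def mult.assoc)
qed

lemma multiply_diff_left:
  assumes "admissible \<phi>" "admissible \<psi>"
  shows "multiply \<phi> F - multiply \<psi> F = multiply (\<lambda>x. \<phi> x - \<psi> x) F"
  using assms
proof transfer
  fix \<phi> \<psi> :: "real \<Rightarrow> complex" and f assume *: "L2_rel f f" "admissible \<phi>" "admissible \<psi>"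
  then have "square_integrable (\<lambda>x. (\<phi> x - \<psi> x) * f x)"
    by (intro square_integrable_admissible_mult admissible_diff) (auto simp: L2_rel_def)
  then show "L2_rel (\<lambda>x. (if admissible \<phi> then \<phi> x else 0) * f x - (if admissible \<psi> then \<psi> x else 0) * f x)
      (\<lambda>x. (if admissible (\<lambda>x. \<phi> x - \<psi> x) then \<phi> x - \<psi> x else 0) * f x)"
    using * by (simp add: admissible_diff L2_rel_def left_diff_distrib)
qed

lemma multiply_sum:
  assumes "finite I" "\<And>i. i \<in> I \<Longrightarrow> admissible (\<phi> i)"
  shows "admissible (\<lambda>x. \<Sum>i\<in>I. \<phi> i x) \<and> multiply (\<lambda>x. \<Sum>i\<in>I. \<phi> i x) F = (\<Sum>i\<in>I. multiply (\<phi> i) F)"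
  using assms
proof (induction I rule: finite_induct)
  case empty
  show ?case
    using multiply_const[of 0 F] by (simp add: admissible_const)
next
  case (insert i I)
  define \<psi> where "\<psi> = (\<lambda>x. \<Sum>i\<in>I. \<phi> i x)"
  have a: "admissible (\<phi> i)" "admissible \<psi>"
    using insert by (auto simp: \<psi>_def)
  have "multiply (\<lambda>x. \<phi> i x + \<psi> x) F - multiply \<psi> F = multiply (\<phi> i) F"
    by (subst multiply_diff_left) (auto simp: a admissible_add)
  then have "multiply (\<lambda>x. \<phi> i x + \<psi> x) F = multiply (\<phi> i) F + multiply \<psi> F"
    by (simp add: algebra_simps)
  then show ?case
    using insert a admissible_add[OF a] by (simp add: \<psi>_def)
qed

lemma translate_multiply:
  assumes "admissible \<phi>"
  shows "translate m (multiply \<phi> F) = multiply (\<lambda>x. \<phi> (x - m)) (translate m F)"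
  using assms
proof transfer
  fix \<phi> :: "real \<Rightarrow> complex" and m f assume *: "L2_rel f f" "admissible \<phi>"
  have a: "admissible (\<lambda>x. \<phi> (x - m))"
    using admissible_affine[OF *(2), of 1 "- m"] by simp
  then have "square_integrable (\<lambda>x. \<phi> (x - m) * f (x - m))"
    using * by (intro square_integrable_admissible_mult square_integrable_translate) (auto simp: L2_rel_def)
  then show "L2_rel (\<lambda>x. (if admissible \<phi> then \<phi> (x - m) else 0) * f (x - m))
      (\<lambda>x. (if admissible (\<lambda>x. \<phi> (x - m)) then \<phi> (x - m) else 0) * f (x - m))"
    using * a by (simp add: L2_rel_def)
qed

text \<open>
  Pointwise square sums of multipliers control the sum of the squared norms. This is sharper than
  adding operator norms, and it is what turns the Bessel inequality for entries into a norm bound.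
\<close>
lemma sum_norm_multiply_le:
  assumes fin: "finite I" and a: "\<And>i. i \<in> I \<Longrightarrow> admissible (\<phi> i)"
    and B: "\<And>x. (\<Sum>i\<in>I. (cmod (\<phi> i x))\<^sup>2) \<le> B"
  shows "(\<Sum>i\<in>I. (norm (multiply (\<phi> i) F))\<^sup>2) \<le> B * (norm F)\<^sup>2"
  using a B fin
proof (transfer fixing: I B)
  fix \<phi> :: "'a \<Rightarrow> real \<Rightarrow> complex" and f
  assume f: "L2_rel f f" and a: "\<And>i. i \<in> I \<Longrightarrow> admissible (\<phi> i)"
    and B: "\<And>x. (\<Sum>i\<in>I. (cmod (\<phi> i x))\<^sup>2) \<le> B" and fin: "finite I"
  have int: "integrable lborel (\<lambda>x. (cmod (\<phi> i x * f x))\<^sup>2)" if "i \<in> I" for i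
    using square_integrable_admissible_mult[OF a[OF that], of f] f by (simp add: L2_rel_def square_integrable_def)
  have intf: "integrable lborel (\<lambda>x. (cmod (f x))\<^sup>2)"
    using f by (simp add: L2_rel_def square_integrable_def)
  have "(\<Sum>i\<in>I. integral\<^sup>L lborel (\<lambda>x. (cmod (\<phi> i x * f x))\<^sup>2)) =
      integral\<^sup>L lborel (\<lambda>x. \<Sum>i\<in>I. (cmod (\<phi> i x * f x))\<^sup>2)"
    by (rule Bochner_Integration.integral_sum[symmetric]) (rule int)
  also have "\<dots> \<le> integral\<^sup>L lborel (\<lambda>x. B * (cmod (f x))\<^sup>2)"
  proof (rule integral_mono)
    show "integrable lborel (\<lambda>x. \<Sum>i\<in>I. (cmod (\<phi> i x * f x))\<^sup>2)"
      by (intro Bochner_Integration.integrable_sum int)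
    show "integrable lborel (\<lambda>x. B * (cmod (f x))\<^sup>2)"
      using intf by simp
    show "(\<Sum>i\<in>I. (cmod (\<phi> i x * f x))\<^sup>2) \<le> B * (cmod (f x))\<^sup>2" for x
      using B[of x] by (simp add: norm_mult power_mult_distrib mult_right_mono flip: sum_distrib_right)
  qed
  also have "\<dots> = B * (integral\<^sup>L lborel (\<lambda>x. (cmod (f x))\<^sup>2))"
    by simp
  finally show "(\<Sum>i\<in>I. (sqrt (integral\<^sup>L lborel (\<lambda>x. (cmod ((if admissible (\<phi> i) then \<phi> i x else 0) * f x))\<^sup>2)))\<^sup>2)
      \<le> B * (sqrt (integral\<^sup>L lborel (\<lambda>x. (cmod (f x))\<^sup>2)))\<^sup>2"
    using a by simp
qed

lemma norm_multiply_le: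
  assumes a: "admissible \<phi>" and B: "\<And>x. cmod (\<phi> x) \<le> B"
  shows "norm (multiply \<phi> F) \<le> B * norm F"
proof -
  have B0: "0 \<le> B"
    using B[of 0] norm_ge_zero order_trans by blast
  have "(\<Sum>i\<in>{()}. (norm (multiply ((\<lambda>_. \<phi>) i) F))\<^sup>2) \<le> B\<^sup>2 * (norm F)\<^sup>2"
    using a B B0 by (intro sum_norm_multiply_le) (auto intro: power_mono)
  then have "(norm (multiply \<phi> F))\<^sup>2 \<le> (B * norm F)\<^sup>2"
    by (simp add: power_mult_distrib)
  then show ?thesis
    by (rule power2_le_imp_le) (simp add: B0)
qed

lemma inner_multiply_disjoint:
  assumes "\<And>x. \<phi> x = 0 \<or> \<psi> x = 0"
  shows "multiply \<phi> F \<bullet> multiply \<psi> G = 0"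
  using assms
proof transfer
  fix \<phi> \<psi> f g :: "real \<Rightarrow> complex"
  assume *: "\<And>x. \<phi> x = 0 \<or> \<psi> x = 0"
  have "((if admissible \<phi> then \<phi> x else 0) * f x) \<bullet> ((if admissible \<psi> then \<psi> x else 0) * g x) = 0" for x
    using *[of x] by auto
  then show "integral\<^sup>L lborel (\<lambda>x. ((if admissible \<phi> then \<phi> x else 0) * f x) \<bullet> ((if admissible \<psi> then \<psi> x else 0) * g x)) = 0"
    by simp
qed

lemma norm_multiply_tendsto_0:
  assumes a: "\<And>n. admissible (\<phi> n)" and B: "\<And>n x. cmod (\<phi> n x) \<le> 1"
    and lim: "\<And>x. \<forall>\<^sub>F n in sequentially. \<phi> n x = 0"
  shows "(\<lambda>n. (norm (multiply (\<phi> n) F))\<^sup>2) \<longlonglongrightarrow> 0"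
  using a B lim
proof (transfer fixing: \<phi>)
  fix f assume f: "L2_rel f f" and a: "\<And>n. admissible (\<phi> n)" and B: "\<And>n x. cmod (\<phi> n x) \<le> 1"
    and lim: "\<And>x. \<forall>\<^sub>F n in sequentially. \<phi> n x = 0"
  have [measurable]: "f \<in> borel_measurable lborel" "\<phi> n \<in> borel_measurable lborel" for n
    using f a by (auto simp: L2_rel_def square_integrable_def admissible_def)
  have intf: "integrable lborel (\<lambda>x. (cmod (f x))\<^sup>2)"
    using f by (simp add: L2_rel_def square_integrable_def)
  have "(\<lambda>n. integral\<^sup>L lborel (\<lambda>x. (cmod (\<phi> n x * f x))\<^sup>2)) \<longlonglongrightarrow> integral\<^sup>L lborel (\<lambda>x::real. 0::real)"
  proof (rule integral_dominated_convergence[OF _ _ intf])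
    show "AE x in lborel. (\<lambda>n. (cmod (\<phi> n x * f x))\<^sup>2) \<longlonglongrightarrow> 0"
    proof (rule always_eventually, rule allI, rule tendsto_eventually)
      show "\<forall>\<^sub>F n in sequentially. (cmod (\<phi> n x * f x))\<^sup>2 = 0" for x
        using lim[of x] by eventually_elim simp
    qed
    show "AE x in lborel. norm ((cmod (\<phi> n x * f x))\<^sup>2) \<le> (cmod (f x))\<^sup>2" for n
      using B by (intro always_eventually allI) (simp add: norm_mult mult_left_le_one_le power_mono)
  qed measurable
  then show "(\<lambda>n. (sqrt (integral\<^sup>L lborel (\<lambda>x. (cmod ((if admissible (\<phi> n) then \<phi> n x else 0) * f x))\<^sup>2)))\<^sup>2) \<longlonglongrightarrow> 0"
    by (simp add: a)
qed

lemma multiply_cutoff_tendsto: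
  "(\<lambda>n. multiply (indicator {- real n..real n}) F) \<longlonglongrightarrow> F"
proof -
  have "(\<lambda>n. (norm (multiply (\<lambda>x. 1 - indicator {- real n..real n} x) F))\<^sup>2) \<longlonglongrightarrow> 0"
  proof (rule norm_multiply_tendsto_0)
    show "admissible (\<lambda>x. 1 - indicator {- real n..real n} x)" for n
      by (intro admissible_diff admissible_const admissible_indicator) simp
    show "cmod (1 - indicator {- real n..real n} x) \<le> 1" for n x
      by (simp add: indicator_def)
    show "\<forall>\<^sub>F n in sequentially. 1 - indicator {- real n..real n} x = (0::complex)" for x
      using eventually_ge_at_top[of "nat \<lceil>\<bar>x\<bar>\<rceil>"] by eventually_elim (auto simp: indicator_def)
  qed
  then have "(\<lambda>n. sqrt ((norm (multiply (\<lambda>x. 1 - indicator {- real n..real n} x) F))\<^sup>2)) \<longlonglongrightarrow> sqrt 0"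
    by (rule tendsto_real_sqrt)
  moreover have "multiply (\<lambda>x. 1 - indicator {- real n..real n} x) F = F - multiply (indicator {- real n..real n}) F" for n
    using multiply_diff_left[OF admissible_const[of 1] admissible_indicator[of "{- real n..real n}"], of F]
    by (simp add: multiply_const)
  ultimately have "(\<lambda>n. norm (F - multiply (indicator {- real n..real n}) F)) \<longlonglongrightarrow> 0"
    by simp
  then have "(\<lambda>n. F - multiply (indicator {- real n..real n}) F) \<longlonglongrightarrow> 0"
    by (simp add: tendsto_norm_zero_iff)
  then have "(\<lambda>n. F - (F - multiply (indicator {- real n..real n}) F)) \<longlonglongrightarrow> F - 0"
    by (intro tendsto_intros)
  then show ?thesis
    by simp
qed

text \<open>
  Functions of bounded support become disjoint under a large translation, and they are dense.
\<close>
lemma inner_translate_tendsto_0: "((\<lambda>s. translate s F \<bullet> G) \<longlongrightarrow> 0) at_top"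
proof (rule tendstoI)
  fix e :: real assume e: "0 < e"
  let ?c = "\<lambda>n. multiply (indicator {- real n..real n})"
  have "(\<lambda>n. norm (F - ?c n F) * norm G + norm F * norm (G - ?c n G)) \<longlonglongrightarrow> norm (F - F) * norm G + norm F * norm (G - G)"
    by (intro tendsto_intros multiply_cutoff_tendsto)
  then have "\<forall>\<^sub>F n in sequentially. norm (F - ?c n F) * norm G + norm F * norm (G - ?c n G) < e"
    using e by (intro order_tendstoD(2)) auto
  then obtain n where n: "norm (F - ?c n F) * norm G + norm F * norm (G - ?c n G) < e"
    by (auto simp: eventually_sequentially)
  have a: "admissible (indicator {- real n..real n})"
    by (rule admissible_indicator) simp
  have dist: "dist (translate s F \<bullet> G) 0 < e" if s: "2 * real n < s" for s
  proof -
    have T: "translate s (A - B) = translate s A - translate s B" for A B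
      by (rule linear_diff[OF bounded_linear.linear[OF bounded_linear_translate]])
    have "translate s (?c n F) \<bullet> ?c n G = 0"
      unfolding translate_multiply[OF a]
      by (rule inner_multiply_disjoint) (use s in \<open>auto simp: indicator_def\<close>)
    then have "translate s F \<bullet> G = translate s (F - ?c n F) \<bullet> G + translate s (?c n F) \<bullet> (G - ?c n G)"
      by (simp add: T inner_diff_left inner_diff_right)
    then have "\<bar>translate s F \<bullet> G\<bar> \<le> \<bar>translate s (F - ?c n F) \<bullet> G\<bar> + \<bar>translate s (?c n F) \<bullet> (G - ?c n G)\<bar>"
      by simp
    also have "\<dots> \<le> norm (F - ?c n F) * norm G + norm (?c n F) * norm (G - ?c n G)"
      using Cauchy_Schwarz_ineq2[of "translate s (F - ?c n F)" G]
        Cauchy_Schwarz_ineq2[of "translate s (?c n F)" "G - ?c n G"]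
      by (simp add: norm_translate)
    also have "\<dots> \<le> norm (F - ?c n F) * norm G + norm F * norm (G - ?c n G)"
      using norm_multiply_le[OF a, of 1 F]
      by (intro add_left_mono mult_right_mono) (auto simp: indicator_def)
    finally show ?thesis
      using n by simp
  qed
  show "\<forall>\<^sub>F s in at_top. dist (translate s F \<bullet> G) 0 < e"
    using eventually_gt_at_top[of "2 * real n"] by eventually_elim (rule dist)
qed

lemma norm_exp_ii_diff_le:
  "cmod (exp (\<i> * of_real a) - exp (\<i> * of_real b)) \<le> \<bar>a - b\<bar>"
proof -
  have "exp (\<i> * of_real a) - exp (\<i> * of_real b) = exp (\<i> * of_real b) * (exp (\<i> * of_real (a - b)) - 1)"
    by (simp add: right_diff_distrib exp_diff)
  then have "cmod (exp (\<i> * of_real a) - exp (\<i> * of_real b)) = 2 * \<bar>sin ((a - b) / 2)\<bar>"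
    using dist_exp_i_1[of "a - b"] by (simp add: norm_mult)
  also have "\<dots> \<le> \<bar>a - b\<bar>"
    using abs_sin_x_le_abs_x[of "(a - b) / 2"] by simp
  finally show ?thesis .
qed

lemma multiply_bump: "multiply (indicator {a<..<b}) (bump a b) = bump a b"
proof transfer
  fix a b :: real
  have "admissible (indicator {a<..<b})"
    by (rule admissible_indicator) simp
  then have "(if admissible (indicator {a<..<b}) then indicator {a<..<b} x else 0) * complex_of_real (indicator {a<..<b} x / sqrt (b - a)) =
     complex_of_real (indicator {a<..<b} x / sqrt (b - a))" for x
    by (auto simp: indicator_def)
  then show "L2_rel (\<lambda>x. (if admissible (indicator {a<..<b}) then indicator {a<..<b} x else 0) * complex_of_real (indicator {a<..<b} x / sqrt (b - a)))
     (\<lambda>x. complex_of_real (indicator {a<..<b} x / sqrt (b - a)))"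
    using square_integrable_bump by (simp only: L2_rel_def) simp
qed

text \<open>
  On a short interval a character is nearly constant.
\<close>
lemma modulate_bump_approx:
  assumes ab: "a < b" and r: "\<And>x. a < x \<Longrightarrow> x < b \<Longrightarrow> \<bar>x - y\<bar> \<le> r"
  shows "norm (modulate l (bump a b) - exp (\<i> * of_real l * of_real y) *\<^sub>C bump a b) \<le> \<bar>l\<bar> * r"
proof -
  let ?\<chi> = "indicator {a<..<b} :: real \<Rightarrow> complex"
  let ?c = "exp (\<i> * of_real l * of_real y)"
  have r0: "0 \<le> r"
  proof -
    have "\<bar>(a + b) / 2 - y\<bar> \<le> r"
      using ab by (intro r) auto
    then show ?thesis
      using abs_ge_zero order_trans by blast
  qed
  have \<chi>: "admissible ?\<chi>"
    by (rule admissible_indicator) simp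
  note d = admissible_diff[OF admissible_exp[of l] admissible_const[of ?c]]
  have "modulate l (bump a b) - ?c *\<^sub>C bump a b = multiply (\<lambda>x. (exp (\<i> * of_real l * of_real x) - ?c) * ?\<chi> x) (bump a b)"
    unfolding multiply_exp[symmetric] multiply_const[symmetric]
      multiply_diff_left[OF admissible_exp admissible_const] multiply_multiply[OF d \<chi>, symmetric] multiply_bump ..
  also have "norm \<dots> \<le> \<bar>l\<bar> * r * norm (bump a b)"
  proof (rule norm_multiply_le[OF admissible_mult[OF d \<chi>]])
    fix x
    show "cmod ((exp (\<i> * of_real l * of_real x) - ?c) * ?\<chi> x) \<le> \<bar>l\<bar> * r"
    proof (cases "a < x \<and> x < b")
      case True
      have "cmod (exp (\<i> * of_real l * of_real x) - ?c) \<le> \<bar>l * x - l * y\<bar>"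
        using norm_exp_ii_diff_le[of "l * x" "l * y"] by (simp add: mult.assoc)
      also have "\<dots> = \<bar>l\<bar> * \<bar>x - y\<bar>"
        by (simp flip: right_diff_distrib abs_mult)
      also have "\<dots> \<le> \<bar>l\<bar> * r"
        using r True by (intro mult_left_mono) auto
      finally show ?thesis
        using True by simp
    qed (use r0 in auto)
  qed
  finally show ?thesis
    by (simp add: norm_bump[OF ab])
qed

lemma cinner_bump_disjoint:
  assumes "b \<le> c \<or> d \<le> a"
  shows "cinner (modulate l (bump a b)) (bump c d) = 0"
proof -
  have \<chi>: "admissible (indicator {a<..<b})" "admissible (indicator {c<..<d})" for a b c d :: real
    by (intro admissible_indicator, simp)+
  have "modulate l (bump a b) = multiply (\<lambda>x. exp (\<i> * of_real l * of_real x) * indicator {a<..<b} x) (bump a b)"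
    unfolding multiply_multiply[OF admissible_exp \<chi>(1), symmetric] multiply_bump multiply_exp ..
  moreover have "z *\<^sub>C bump c d = multiply (\<lambda>x. z * indicator {c<..<d} x) (bump c d)" for z
    unfolding multiply_multiply[OF admissible_const \<chi>(1), symmetric] multiply_bump multiply_const ..
  ultimately have "modulate l (bump a b) \<bullet> (z *\<^sub>C bump c d) = 0" for z
    using assms by (auto intro!: inner_multiply_disjoint simp: indicator_def)
  from this[of 1] this[of \<i>] show ?thesis
    by (simp add: cinner_def complex_eq_iff)
qed

section \<open>Words in the generators\<close>

lemma scale_op_eq_compose: "scale_op c T = Blinfun (\<lambda>F. c *\<^sub>C F) o\<^sub>L T"
  by (rule blinfun_eqI) (simp add: bounded_linear_Blinfun_apply bounded_linear_scaleC)

lemma scale_op_one [simp]: "scale_op 1 T = T"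
  by (rule blinfun_eqI) simp

lemma scale_op_scale_op [simp]: "scale_op a (scale_op b T) = scale_op (a * b) T"
  by (rule blinfun_eqI) simp

lemma scale_op_zero [simp]: "scale_op 0 T = 0"
  by (rule blinfun_eqI) simp

lemma scale_op_minus_one: "scale_op (- 1) T = - T"
  by (rule blinfun_eqI) (simp add: blinfun.minus_left scaleC_minus_left)

lemma scale_op_compose_left: "scale_op c S o\<^sub>L T = scale_op c (S o\<^sub>L T)"
  by (rule blinfun_eqI) simp

lemma scale_op_compose_right: "S \<in> bounded_ops \<Longrightarrow> S o\<^sub>L scale_op c T = scale_op c (S o\<^sub>L T)"
  by (rule blinfun_eqI) (simp add: bounded_ops_def)

lemma compose_add_left: "(S + T) o\<^sub>L R = (S o\<^sub>L R) + (T o\<^sub>L R)"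
  by (rule blinfun_eqI) (simp add: blinfun.add_left)

lemma compose_add_right: "R o\<^sub>L (S + T) = (R o\<^sub>L S) + (R o\<^sub>L T)"
  by (rule blinfun_eqI) (simp add: blinfun.add_left blinfun.add_right)

definition word :: "real \<Rightarrow> real \<Rightarrow> nat \<Rightarrow> (L2R \<Rightarrow>\<^sub>L L2R)" where
  "word l m n = M_op l o\<^sub>L D_op m o\<^sub>L V_op (real n)"

lemma blinfun_apply_word [simp]:
  "blinfun_apply (word l m n) F = modulate l (translate m (dilate (real n) F))"
  by (simp add: word_def)

lemma M_op_word: "M_op l = word l 0 0" and D_op_word: "D_op m = word 0 m 0"
  and V_op_word: "V_op (real n) = word 0 0 n"
  by (rule blinfun_eqI, simp)+

lemma word_one [simp]: "word 0 0 0 = id_blinfun"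
  by (rule blinfun_eqI) simp

lemma translate_modulate:
  "translate m (modulate l F) = exp (- (\<i> * of_real (l * m))) *\<^sub>C modulate l (translate m F)"
  by (simp add: modulate_translate flip: exp_add)

text \<open>
  Products of words are words up to a phase, so linear combinations of words form an algebra, which is
  dense in the algebra under study.
\<close>
lemma word_mult:
  "word l m n o\<^sub>L word l' m' n' =
    scale_op (exp (- (\<i> * of_real (exp (real n) * l' * m))))
      (word (l + exp (real n) * l') (m + exp (- real n) * m') (n + n'))"
  by (rule blinfun_eqI)
    (simp add: dilate_modulate dilate_translate translate_modulate dilate_dilate modulate_modulate
      translate_translate modulate_scaleC)

inductive_set words :: "(L2R \<Rightarrow>\<^sub>L L2R) set" where
  word: "0 \<le> l \<Longrightarrow> 0 \<le> m \<Longrightarrow> word l m n \<in> words"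
| add: "S \<in> words \<Longrightarrow> T \<in> words \<Longrightarrow> S + T \<in> words"
| scale: "T \<in> words \<Longrightarrow> scale_op c T \<in> words"

lemma word_bounded_ops: "word l m n \<in> bounded_ops"
  using generators_bounded_ops closed_subalgebra_bounded_ops
  by (simp add: word_def closed_subalgebra_def)

lemma words_bounded_ops: "T \<in> words \<Longrightarrow> T \<in> bounded_ops"
  by (induction rule: words.induct)
    (use closed_subalgebra_bounded_ops word_bounded_ops in \<open>auto simp: closed_subalgebra_def\<close>)

lemma words_mult: "S \<in> words \<Longrightarrow> T \<in> words \<Longrightarrow> S o\<^sub>L T \<in> words"
proof (induction S rule: words.induct)
  case (word l m n)
  from word(3,1,2) show ?case
  proof (induction T rule: words.induct)
    case (word l' m' n')
    then show ?case
      unfolding word_mult by (intro words.scale words.word) auto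
  next
    case (add S T)
    then show ?case by (simp add: compose_add_right words.add)
  next
    case (scale T c)
    then show ?case by (simp add: scale_op_compose_right word_bounded_ops words.scale)
  qed
next
  case (add S S')
  then show ?case by (simp add: compose_add_left words.add)
next
  case (scale S c)
  then show ?case by (simp add: scale_op_compose_left words.scale)
qed

lemma closed_subalgebra_closure_words: "closed_subalgebra (closure words)"
proof -
  have "closure words \<subseteq> bounded_ops"
    using words_bounded_ops closed_subalgebra_bounded_ops
    by (intro closure_minimal) (auto simp: closed_subalgebra_def)
  moreover have "0 \<in> closure words"
    using words.scale[OF words.word[of 0 0 0], of 0] closure_subset by auto
  moreover have "S + T \<in> closure words" if "S \<in> closure words" "T \<in> closure words" for S T
  proof -
    obtain s where s: "\<forall>k. s k \<in> words" "s \<longlonglongrightarrow> S"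
      using \<open>S \<in> closure words\<close> unfolding closure_sequential by blast
    obtain t where t: "\<forall>k. t k \<in> words" "t \<longlonglongrightarrow> T"
      using \<open>T \<in> closure words\<close> unfolding closure_sequential by blast
    have "(\<lambda>k. s k + t k) \<longlonglongrightarrow> S + T"
      by (intro tendsto_add s t)
    moreover have "\<forall>k. s k + t k \<in> words"
      using s t by (simp add: words.add)
    ultimately show ?thesis
      unfolding closure_sequential by (intro exI conjI)
  qed
  moreover have "scale_op c T \<in> closure words" if "T \<in> closure words" for c T
  proof -
    obtain t where t: "\<forall>k. t k \<in> words" "t \<longlonglongrightarrow> T"
      using \<open>T \<in> closure words\<close> unfolding closure_sequential by blast
    have "(\<lambda>k. scale_op c (t k)) \<longlonglongrightarrow> scale_op c T"
      unfolding scale_op_eq_compose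
      by (intro bounded_bilinear.tendsto[OF bounded_bilinear_blinfun_compose] tendsto_const t)
    moreover have "\<forall>k. scale_op c (t k) \<in> words"
      using t by (simp add: words.scale)
    ultimately show ?thesis
      unfolding closure_sequential by (intro exI conjI)
  qed
  moreover have "S o\<^sub>L T \<in> closure words" if "S \<in> closure words" "T \<in> closure words" for S T
  proof -
    obtain s where s: "\<forall>k. s k \<in> words" "s \<longlonglongrightarrow> S"
      using \<open>S \<in> closure words\<close> unfolding closure_sequential by blast
    obtain t where t: "\<forall>k. t k \<in> words" "t \<longlonglongrightarrow> T"
      using \<open>T \<in> closure words\<close> unfolding closure_sequential by blast
    have "(\<lambda>k. s k o\<^sub>L t k) \<longlonglongrightarrow> (S o\<^sub>L T)"
      by (intro bounded_bilinear.tendsto[OF bounded_bilinear_blinfun_compose] s t)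
    moreover have "\<forall>k. s k o\<^sub>L t k \<in> words"
      using s t by (simp add: words_mult)
    ultimately show ?thesis
      unfolding closure_sequential by (intro exI conjI)
  qed
  ultimately show ?thesis
    by (simp add: closed_subalgebra_def)
qed

lemma A_ph_Zplus_add: "S \<in> A_ph_Zplus \<Longrightarrow> T \<in> A_ph_Zplus \<Longrightarrow> S + T \<in> A_ph_Zplus"
  and A_ph_Zplus_scale: "T \<in> A_ph_Zplus \<Longrightarrow> scale_op c T \<in> A_ph_Zplus"
  and A_ph_Zplus_mult: "S \<in> A_ph_Zplus \<Longrightarrow> T \<in> A_ph_Zplus \<Longrightarrow> S o\<^sub>L T \<in> A_ph_Zplus"
  and A_ph_Zplus_bounded_ops: "T \<in> A_ph_Zplus \<Longrightarrow> T \<in> bounded_ops"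
  and closed_A_ph_Zplus: "closed A_ph_Zplus"
  using closed_subalgebra_A_ph_Zplus by (auto simp: closed_subalgebra_def)

lemma A_ph_Zplus_diff: "S \<in> A_ph_Zplus \<Longrightarrow> T \<in> A_ph_Zplus \<Longrightarrow> S - T \<in> A_ph_Zplus"
  using A_ph_Zplus_add[of S "scale_op (- 1) T"] A_ph_Zplus_scale[of T "- 1"]
  by (simp add: scale_op_minus_one)

lemma generators_A_ph_Zplus:
  shows "0 \<le> l \<Longrightarrow> M_op l \<in> A_ph_Zplus" and "0 \<le> m \<Longrightarrow> D_op m \<in> A_ph_Zplus" and "V_op (real n) \<in> A_ph_Zplus"
  unfolding A_ph_Zplus_def by (auto intro!: hull_inc)

lemma word_A_ph_Zplus: "0 \<le> l \<Longrightarrow> 0 \<le> m \<Longrightarrow> word l m n \<in> A_ph_Zplus"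
  unfolding word_def by (intro A_ph_Zplus_mult generators_A_ph_Zplus)

lemma words_A_ph_Zplus: "T \<in> words \<Longrightarrow> T \<in> A_ph_Zplus"
  by (induction rule: words.induct) (auto intro: word_A_ph_Zplus A_ph_Zplus_add A_ph_Zplus_scale)

lemma A_ph_Zplus_subset_closure_words: "A_ph_Zplus \<subseteq> closure words"
  unfolding A_ph_Zplus_def
proof (rule hull_minimal[where S = closed_subalgebra, OF _ closed_subalgebra_closure_words])
  have "M_op l \<in> words" "D_op l \<in> words" "V_op (real n) \<in> words" if "0 \<le> l" for l n
    using that unfolding M_op_word D_op_word V_op_word by (auto intro: words.word)
  then show "{M_op l |l. 0 \<le> l} \<union> {D_op m |m. 0 \<le> m} \<union> {V_op (real t) |t. True} \<subseteq> closure words"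
    using closure_subset by fast
qed

lemma A_ph_Zplus_approx:
  assumes "T \<in> A_ph_Zplus" "0 < e"
  obtains S where "S \<in> words" "norm (T - S) < e"
proof -
  have "T \<in> closure words"
    using A_ph_Zplus_subset_closure_words assms by blast
  then obtain S where "S \<in> words" "dist S T < e"
    using assms(2) unfolding closure_approachable by blast
  then show ?thesis
    by (intro that[of S]) (simp_all add: dist_norm norm_minus_commute)
qed

lemma A_ph_Zplus_induct [consumes 1, case_names word add scale limit]:
  assumes T: "T \<in> A_ph_Zplus"
    and word: "\<And>l m n. 0 \<le> l \<Longrightarrow> 0 \<le> m \<Longrightarrow> P (word l m n)"
    and add: "\<And>S T. S \<in> A_ph_Zplus \<Longrightarrow> T \<in> A_ph_Zplus \<Longrightarrow> P S \<Longrightarrow> P T \<Longrightarrow> P (S + T)"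
    and scale: "\<And>c T. T \<in> A_ph_Zplus \<Longrightarrow> P T \<Longrightarrow> P (scale_op c T)"
    and limit: "\<And>T. T \<in> A_ph_Zplus \<Longrightarrow>
      (\<And>e. 0 < e \<Longrightarrow> \<exists>S\<in>A_ph_Zplus. P S \<and> norm (T - S) < e) \<Longrightarrow> P T"
  shows "P T"
proof -
  have "P S" if "S \<in> words" for S
    using that by (induction rule: words.induct) (auto intro: word add scale words_A_ph_Zplus)
  note PW = this
  show ?thesis
  proof (rule limit[OF T])
    fix e :: real assume "0 < e"
    then obtain S where "S \<in> words" "norm (T - S) < e"
      using A_ph_Zplus_approx[OF T] by blast
    then show "\<exists>S\<in>A_ph_Zplus. P S \<and> norm (T - S) < e"
      using PW words_A_ph_Zplus by blast
  qed
qed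

section \<open>Bounded functionals on the algebra\<close>

text \<open>
  Bounded complex-linear functionals, constrained only on the algebra. Identities between entries are
  checked on words and extend to the algebra because both sides are such functionals.
\<close>
definition A_functional :: "((L2R \<Rightarrow>\<^sub>L L2R) \<Rightarrow> complex) \<Rightarrow> bool" where
  "A_functional f \<longleftrightarrow>
     (\<forall>S\<in>A_ph_Zplus. \<forall>T\<in>A_ph_Zplus. f (S + T) = f S + f T) \<and>
     (\<forall>c. \<forall>T\<in>A_ph_Zplus. f (scale_op c T) = c * f T) \<and>
     (\<exists>K. \<forall>T\<in>A_ph_Zplus. cmod (f T) \<le> K * norm T)"

lemma A_functional_diff:
  assumes "A_functional f" "S \<in> A_ph_Zplus" "T \<in> A_ph_Zplus"
  shows "f (S - T) = f S - f T"
proof -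
  have "f (S + scale_op (- 1) T) = f S + (- 1) * f T"
    using assms A_ph_Zplus_scale[OF assms(3), of "- 1"] unfolding A_functional_def by metis
  then show ?thesis
    by (simp add: scale_op_minus_one)
qed

lemma A_functional_add:
  assumes f: "A_functional f" and g: "A_functional g"
  shows "A_functional (\<lambda>T. f T + g T)"
proof -
  obtain K L where K: "\<And>T. T \<in> A_ph_Zplus \<Longrightarrow> cmod (f T) \<le> K * norm T"
      and L: "\<And>T. T \<in> A_ph_Zplus \<Longrightarrow> cmod (g T) \<le> L * norm T"
    using f g unfolding A_functional_def by metis
  have "cmod (f T + g T) \<le> (K + L) * norm T" if "T \<in> A_ph_Zplus" for T
    using norm_triangle_ineq[of "f T" "g T"] K[OF that] L[OF that] by (simp add: distrib_right)
  then have "\<exists>K. \<forall>T\<in>A_ph_Zplus. cmod (f T + g T) \<le> K * norm T"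
    by blast
  then show ?thesis
    using f g unfolding A_functional_def by (simp add: algebra_simps)
qed

lemma A_functional_cmult:
  assumes f: "A_functional f"
  shows "A_functional (\<lambda>T. a * f T)"
proof -
  obtain K where K: "\<And>T. T \<in> A_ph_Zplus \<Longrightarrow> cmod (f T) \<le> K * norm T"
    using f unfolding A_functional_def by metis
  have "cmod (a * f T) \<le> (cmod a * K) * norm T" if "T \<in> A_ph_Zplus" for T
    using mult_left_mono[OF K[OF that], of "cmod a"] by (simp add: norm_mult mult.assoc)
  then have "\<exists>K. \<forall>T\<in>A_ph_Zplus. cmod (a * f T) \<le> K * norm T"
    by blast
  then show ?thesis
    using f unfolding A_functional_def by (simp add: algebra_simps)
qed

lemma A_functional_multc: "A_functional f \<Longrightarrow> A_functional (\<lambda>T. f T * a)"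
  using A_functional_cmult[of f a] by (simp add: mult.commute)

lemma A_functional_compose_left:
  assumes f: "A_functional f" and S: "S \<in> A_ph_Zplus"
  shows "A_functional (\<lambda>T. f (S o\<^sub>L T))"
proof -
  obtain K where K: "\<And>T. T \<in> A_ph_Zplus \<Longrightarrow> cmod (f T) \<le> K * norm T"
    using f unfolding A_functional_def by metis
  have "cmod (f (S o\<^sub>L T)) \<le> (\<bar>K\<bar> * norm S) * norm T" if "T \<in> A_ph_Zplus" for T
  proof -
    have "cmod (f (S o\<^sub>L T)) \<le> K * norm (S o\<^sub>L T)"
      by (rule K[OF A_ph_Zplus_mult[OF S that]])
    also have "\<dots> \<le> \<bar>K\<bar> * (norm S * norm T)"
      by (intro mult_mono norm_blinfun_compose) auto
    finally show ?thesis by (simp add: mult.assoc)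
  qed
  then have "\<exists>K. \<forall>T\<in>A_ph_Zplus. cmod (f (S o\<^sub>L T)) \<le> K * norm T"
    by blast
  then show ?thesis
    using f S A_ph_Zplus_mult[OF S] unfolding A_functional_def
    by (simp add: compose_add_right scale_op_compose_right[OF A_ph_Zplus_bounded_ops])
qed

lemma A_functional_compose_right:
  assumes f: "A_functional f" and S: "S \<in> A_ph_Zplus"
  shows "A_functional (\<lambda>T. f (T o\<^sub>L S))"
proof -
  obtain K where K: "\<And>T. T \<in> A_ph_Zplus \<Longrightarrow> cmod (f T) \<le> K * norm T"
    using f unfolding A_functional_def by metis
  have "cmod (f (T o\<^sub>L S)) \<le> (\<bar>K\<bar> * norm S) * norm T" if "T \<in> A_ph_Zplus" for T
  proof -
    have "cmod (f (T o\<^sub>L S)) \<le> K * norm (T o\<^sub>L S)"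
      by (rule K[OF A_ph_Zplus_mult[OF that S]])
    also have "\<dots> \<le> \<bar>K\<bar> * (norm T * norm S)"
      by (intro mult_mono norm_blinfun_compose) auto
    finally show ?thesis by (simp add: mult_ac)
  qed
  then have "\<exists>K. \<forall>T\<in>A_ph_Zplus. cmod (f (T o\<^sub>L S)) \<le> K * norm T"
    by blast
  then show ?thesis
    using f S A_ph_Zplus_mult[OF _ S] unfolding A_functional_def
    by (simp add: compose_add_left scale_op_compose_left)
qed

lemma A_functional_zeroI:
  assumes f: "A_functional f" and w: "\<And>l m n. 0 \<le> l \<Longrightarrow> 0 \<le> m \<Longrightarrow> f (word l m n) = 0"
    and T: "T \<in> A_ph_Zplus"
  shows "f T = 0"
  using T
proof (induction rule: A_ph_Zplus_induct)
  case (word l m n)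
  then show ?case by (rule w)
next
  case (add S T)
  then show ?case using f by (simp add: A_functional_def)
next
  case (scale c T)
  then show ?case using f by (simp add: A_functional_def)
next
  case (limit T)
  obtain K where K: "\<And>T. T \<in> A_ph_Zplus \<Longrightarrow> cmod (f T) \<le> K * norm T"
    using f unfolding A_functional_def by metis
  have "cmod (f T) \<le> 0 + e" if e: "0 < e" for e
  proof -
    have "0 < e / (\<bar>K\<bar> + 1)" using e by simp
    then obtain S where S: "S \<in> A_ph_Zplus" "f S = 0" "norm (T - S) < e / (\<bar>K\<bar> + 1)"
      using limit by blast
    have "f T = f (T - S)"
      using A_functional_diff[OF f limit(1) S(1)] S(2) by simp
    then have "cmod (f T) \<le> K * norm (T - S)"
      using K[OF A_ph_Zplus_diff[OF limit(1) S(1)]] by simp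
    also have "\<dots> \<le> (\<bar>K\<bar> + 1) * (e / (\<bar>K\<bar> + 1))"
      using S(3) by (intro mult_mono) auto
    also have "\<dots> = e" by simp
    finally show ?thesis by simp
  qed
  then have "cmod (f T) \<le> 0"
    by (rule field_le_epsilon)
  then show ?case by simp
qed

lemma A_functional_eqI:
  assumes f: "A_functional f" and g: "A_functional g"
    and w: "\<And>l m n. 0 \<le> l \<Longrightarrow> 0 \<le> m \<Longrightarrow> f (word l m n) = g (word l m n)"
    and T: "T \<in> A_ph_Zplus"
  shows "f T = g T"
  using A_functional_zeroI[OF A_functional_add[OF f A_functional_cmult[OF g, of "- 1"]] _ T] w by simp

section \<open>Matrix entries\<close>

text \<open>
  The image of a bump near \<open>x\<close> under \<open>D_op m\<close> composed with \<open>V_op n\<close>. Up to the factor \<open>exp (- n)\<close>,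
  its support lies between \<open>\<epsilon>\<close> and \<open>2 * \<epsilon>\<close> to the right of the limit point. Probes with the same limit
  point but different \<open>n\<close> are therefore disjoint, as a dilation by \<open>exp 1 \<ge> 2\<close> about this point moves the
  interval off itself.
\<close>
definition probe :: "real \<Rightarrow> nat \<Rightarrow> real \<Rightarrow> real \<Rightarrow> L2R" where
  "probe m n x \<epsilon> = bump (m + exp (- real n) * (x + \<epsilon>)) (m + exp (- real n) * (x + 2 * \<epsilon>))"

lemma word_probe: "blinfun_apply (word l m n) (probe 0 0 x \<epsilon>) = modulate l (probe m n x \<epsilon>)"
  by (simp add: probe_def translate_bump dilate_bump)

lemma norm_probe: "0 < \<epsilon> \<Longrightarrow> norm (probe m n x \<epsilon>) = 1"
  unfolding probe_def by (rule norm_bump) simp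

lemma two_le_exp_1: "2 \<le> exp (1::real)"
  using exp_ge_add_one_self[of 1] by simp

lemma probe_orthogonal:
  assumes "(m, n) \<noteq> (m', n')"
  shows "\<forall>\<^sub>F \<epsilon> in at_right 0. cinner (modulate l (probe m n x \<epsilon>)) (probe m' n' x \<epsilon>) = 0"
proof -
  define y y' where "y = m + exp (- real n) * x" and "y' = m' + exp (- real n') * x"
  have p: "probe m n x \<epsilon> = bump (y + exp (- real n) * \<epsilon>) (y + 2 * (exp (- real n) * \<epsilon>))"
    "probe m' n' x \<epsilon> = bump (y' + exp (- real n') * \<epsilon>) (y' + 2 * (exp (- real n') * \<epsilon>))" for \<epsilon>
    by (simp_all add: probe_def y_def y'_def algebra_simps)
  have small: "exp (- real k) * \<epsilon> \<le> \<epsilon>" "0 \<le> exp (- real k) * \<epsilon>" if "0 < \<epsilon>" for k \<epsilon>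
    using that by (auto simp: mult_le_cancel_right1)
  have scale: "2 * (exp (- real k') * \<epsilon>) \<le> exp (- real k) * \<epsilon>" if "k < k'" "0 < \<epsilon>" for k k' \<epsilon>
  proof -
    have "2 * exp (- real k') \<le> exp 1 * exp (- real k')"
      by (intro mult_right_mono two_le_exp_1) simp
    also have "\<dots> = exp (1 - real k')"
      by (simp flip: exp_add)
    also have "\<dots> \<le> exp (- real k)"
      using that by simp
    finally show ?thesis
      using that by (simp add: mult_right_mono)
  qed
  have ev: "\<forall>\<^sub>F \<epsilon> in at_right 0. 0 < \<epsilon> \<and> 2 * \<epsilon> \<le> d" if "0 < d" for d :: real
    unfolding eventually_at_right_field using that by (intro exI[of _ "d / 2"]) auto
  consider "y < y'" | "y' < y" | "y = y'" "n < n'" | "y = y'" "n' < n"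
  proof -
    have "n \<noteq> n'" if "y = y'"
      using that assms by (auto simp: y_def y'_def)
    then show ?thesis
      using that by (meson linorder_less_linear)
  qed
  then show ?thesis
  proof cases
    case 1
    show ?thesis
      using ev[of "y' - y"]
    proof (rule eventually_mono)
      show "cinner (modulate l (probe m n x \<epsilon>)) (probe m' n' x \<epsilon>) = 0" if "0 < \<epsilon> \<and> 2 * \<epsilon> \<le> y' - y" for \<epsilon>
        unfolding p using that small[of \<epsilon>] by (intro cinner_bump_disjoint disjI1) (smt (verit))
    qed (use 1 in simp)
  next
    case 2
    show ?thesis
      using ev[of "y - y'"]
    proof (rule eventually_mono)
      show "cinner (modulate l (probe m n x \<epsilon>)) (probe m' n' x \<epsilon>) = 0" if "0 < \<epsilon> \<and> 2 * \<epsilon> \<le> y - y'" for \<epsilon>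
        unfolding p using that small[of \<epsilon>] by (intro cinner_bump_disjoint disjI2) (smt (verit))
    qed (use 2 in simp)
  next
    case 3
    then show ?thesis
      unfolding p using scale[OF 3(2)]
      by (intro eventually_mono[OF ev[of 1]] cinner_bump_disjoint disjI2) auto
  next
    case 4
    then show ?thesis
      unfolding p using scale[OF 4(2)]
      by (intro eventually_mono[OF ev[of 1]] cinner_bump_disjoint disjI1) auto
  qed
qed

lemma probe_modulated:
  "((\<lambda>\<epsilon>. cinner (modulate l (probe m n x \<epsilon>)) (probe m n x \<epsilon>)) \<longlongrightarrow>
     exp (\<i> * of_real l * of_real (m + exp (- real n) * x))) (at_right 0)"
proof (rule Lim_transform)
  define y where "y = m + exp (- real n) * x"
  let ?c = "exp (\<i> * of_real l * of_real y)"
  show "((\<lambda>\<epsilon>. ?c) \<longlongrightarrow> exp (\<i> * of_real l * of_real (m + exp (- real n) * x))) (at_right 0)"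
    by (simp add: y_def)
  have bound: "cmod (cinner (modulate l (probe m n x \<epsilon>)) (probe m n x \<epsilon>) - ?c) \<le> \<bar>l\<bar> * (2 * \<epsilon>)" if "0 < \<epsilon>" for \<epsilon>
  proof -
    let ?p = "probe m n x \<epsilon>"
    have "cmod (cinner (modulate l ?p) ?p - ?c) = cmod (cinner (modulate l ?p - ?c *\<^sub>C ?p) ?p)"
      by (simp add: cinner_diff_left cinner_scaleC_left cinner_self norm_probe[OF that] norm_minus_commute)
    also have "\<dots> \<le> norm (modulate l ?p - ?c *\<^sub>C ?p) * norm ?p"
      by (rule norm_cinner_le)
    also have "\<dots> = norm (modulate l ?p - ?c *\<^sub>C ?p)"
      by (simp add: norm_probe[OF that])
    also have "\<dots> \<le> \<bar>l\<bar> * (2 * \<epsilon>)"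
      unfolding probe_def
    proof (rule modulate_bump_approx)
      show "m + exp (- real n) * (x + \<epsilon>) < m + exp (- real n) * (x + 2 * \<epsilon>)"
        using that by simp
      fix z assume z: "m + exp (- real n) * (x + \<epsilon>) < z" "z < m + exp (- real n) * (x + 2 * \<epsilon>)"
      have "0 \<le> exp (- real n) * \<epsilon>" "exp (- real n) * \<epsilon> \<le> \<epsilon>"
        using that by (auto simp: mult_le_cancel_right1)
      then show "\<bar>z - y\<bar> \<le> 2 * \<epsilon>"
        using z by (simp add: y_def algebra_simps)
    qed
    finally show ?thesis .
  qed
  have "((\<lambda>\<epsilon>. \<bar>l\<bar> * (2 * \<epsilon>)) \<longlongrightarrow> \<bar>l\<bar> * (2 * 0)) (at_right 0)"
    by (intro tendsto_intros)
  then have "((\<lambda>\<epsilon>. \<bar>l\<bar> * (2 * \<epsilon>)) \<longlongrightarrow> 0) (at_right 0)"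
    by simp
  then show "((\<lambda>\<epsilon>. cinner (modulate l (probe m n x \<epsilon>)) (probe m n x \<epsilon>) - ?c) \<longlongrightarrow> 0) (at_right 0)"
    by (rule Lim_null_comparison[rotated]) (rule eventually_mono[OF eventually_at_right_less bound])
qed

text \<open>
  The coefficient function of \<open>D_op m\<close> composed with \<open>V_op n\<close>. The word sends mass near
  \<open>exp n * (y - m)\<close> to mass near \<open>y\<close>, and the inner product with the expected image isolates this word
  from all others.
\<close>
definition entry :: "(L2R \<Rightarrow>\<^sub>L L2R) \<Rightarrow> real \<Rightarrow> nat \<Rightarrow> real \<Rightarrow> complex" where
  "entry T m n y = Lim (at_right 0)
     (\<lambda>\<epsilon>. cinner (blinfun_apply T (probe 0 0 (exp (real n) * (y - m)) \<epsilon>)) (probe m n (exp (real n) * (y - m)) \<epsilon>))"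

text \<open>
  Completeness: limits exist for uniform limits of functions that have limits, here along an arbitrary
  filter. This carries the existence of entries from words to the closure.
\<close>
lemma uniformly_approximated_limit:
  fixes g :: "'a \<Rightarrow> complex"
  assumes F: "F \<noteq> bot"
    and approx: "\<And>e. 0 < e \<Longrightarrow> \<exists>h c. (h \<longlongrightarrow> c) F \<and> (\<forall>\<^sub>F t in F. cmod (g t - h t) \<le> e)"
  shows "\<exists>c. (g \<longlongrightarrow> c) F"
proof -
  have "\<forall>k. \<exists>h c. (h \<longlongrightarrow> c) F \<and> (\<forall>\<^sub>F t in F. cmod (g t - h t) \<le> inverse (real (Suc k)))"
    using approx by simp
  then obtain h c where h: "\<And>k. (h k \<longlongrightarrow> c k) F"
      and gh: "\<And>k. \<forall>\<^sub>F t in F. cmod (g t - h k t) \<le> inverse (real (Suc k))"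
    by metis
  have cc: "cmod (c j - c k) \<le> inverse (real (Suc j)) + inverse (real (Suc k))" for j k
  proof (rule tendsto_upperbound[OF _ _ F])
    show "((\<lambda>t. cmod (h j t - h k t)) \<longlongrightarrow> cmod (c j - c k)) F"
      by (intro tendsto_intros h)
    show "\<forall>\<^sub>F t in F. cmod (h j t - h k t) \<le> inverse (real (Suc j)) + inverse (real (Suc k))"
      using gh[of j] gh[of k]
    proof eventually_elim
      case (elim t)
      then show ?case
        using norm_triangle_ineq4[of "g t - h k t" "g t - h j t"] by simp
    qed
  qed
  have small: "\<exists>N. \<forall>n\<ge>N. inverse (real (Suc n)) < e" if "0 < e" for e :: real
    using order_tendstoD(2)[OF LIMSEQ_inverse_real_of_nat that] by (simp add: eventually_sequentially)
  have "Cauchy c"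
  proof (rule metric_CauchyI)
    fix e :: real assume "0 < e"
    then obtain N where N: "\<And>n. n \<ge> N \<Longrightarrow> inverse (real (Suc n)) < e / 2"
      using small[of "e / 2"] by auto
    have "dist (c j) (c k) < e" if "j \<ge> N" "k \<ge> N" for j k
      using cc[of j k] N[OF that(1)] N[OF that(2)] unfolding dist_norm by linarith
    then show "\<exists>M. \<forall>m\<ge>M. \<forall>n\<ge>M. dist (c m) (c n) < e"
      by blast
  qed
  then obtain C where C: "c \<longlonglongrightarrow> C"
    using Cauchy_convergent_iff convergent_def by blast
  have "(g \<longlongrightarrow> C) F"
  proof (rule tendstoI)
    fix e :: real assume e: "0 < e"
    obtain N where N: "\<And>n. n \<ge> N \<Longrightarrow> inverse (real (Suc n)) < e / 3"
      using small[of "e / 3"] e by auto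
    have "\<forall>\<^sub>F k in sequentially. dist (c k) C < e / 3"
      using C e by (intro tendstoD) auto
    then obtain M where M: "\<And>k. k \<ge> M \<Longrightarrow> dist (c k) C < e / 3"
      by (auto simp: eventually_sequentially)
    define k where "k = max M N"
    have "\<forall>\<^sub>F t in F. dist (h k t) (c k) < e / 3"
      using h e by (intro tendstoD) auto
    with gh[of k] show "\<forall>\<^sub>F t in F. dist (g t) C < e"
    proof eventually_elim
      case (elim t)
      have "dist (g t) C \<le> dist (g t) (h k t) + dist (h k t) (c k) + dist (c k) C"
        using dist_triangle[of "g t" C "h k t"] dist_triangle[of "h k t" C "c k"] by linarith
      moreover have "dist (g t) (h k t) < e / 3"
        using elim(1) N[of k] by (simp add: dist_norm k_def)
      ultimately show ?case
        using elim(2) M[of k] by (simp add: k_def)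
    qed
  qed
  then show ?thesis by blast
qed

lemma word_has_entry:
  "((\<lambda>\<epsilon>. cinner (blinfun_apply (word l m' n') (probe 0 0 (exp (real n) * (y - m)) \<epsilon>))
      (probe m n (exp (real n) * (y - m)) \<epsilon>)) \<longlongrightarrow>
     (if m' = m \<and> n' = n then exp (\<i> * of_real l * of_real y) else 0)) (at_right 0)"
proof (cases "m' = m \<and> n' = n")
  case True
  have "m + exp (- real n) * (exp (real n) * (y - m)) = y"
    by (simp add: mult.assoc[symmetric] flip: exp_add)
  then show ?thesis
    using True probe_modulated[of l m n "exp (real n) * (y - m)"] by (simp only: word_probe simp_thms if_True)
next
  case False
  then show ?thesis
    unfolding word_probe if_not_P[OF False]
    by (intro tendsto_eventually probe_orthogonal) auto
qed

lemma A_ph_Zplus_has_entry: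
  assumes "T \<in> A_ph_Zplus"
  shows "\<exists>c. ((\<lambda>\<epsilon>. cinner (blinfun_apply T (probe 0 0 x \<epsilon>)) (probe m n x \<epsilon>)) \<longlongrightarrow> c) (at_right 0)"
  using assms
proof (induction rule: A_ph_Zplus_induct)
  case (word l m' n')
  have "exp (real n) * (m + exp (- real n) * x - m) = x"
    by (simp add: mult.assoc[symmetric] flip: exp_add)
  then show ?case
    using word_has_entry[of l m' n' n "m + exp (- real n) * x" m] by (metis (no_types))
next
  case (add S T)
  then obtain c d where "((\<lambda>\<epsilon>. cinner (blinfun_apply S (probe 0 0 x \<epsilon>)) (probe m n x \<epsilon>)) \<longlongrightarrow> c) (at_right 0)"
      "((\<lambda>\<epsilon>. cinner (blinfun_apply T (probe 0 0 x \<epsilon>)) (probe m n x \<epsilon>)) \<longlongrightarrow> d) (at_right 0)"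
    by blast
  then have "((\<lambda>\<epsilon>. cinner (blinfun_apply (S + T) (probe 0 0 x \<epsilon>)) (probe m n x \<epsilon>)) \<longlongrightarrow> c + d) (at_right 0)"
    unfolding blinfun.add_left cinner_add_left by (rule tendsto_add)
  then show ?case by blast
next
  case (scale a T)
  then obtain c where "((\<lambda>\<epsilon>. cinner (blinfun_apply T (probe 0 0 x \<epsilon>)) (probe m n x \<epsilon>)) \<longlongrightarrow> c) (at_right 0)"
    by blast
  then have "((\<lambda>\<epsilon>. cinner (blinfun_apply (scale_op a T) (probe 0 0 x \<epsilon>)) (probe m n x \<epsilon>)) \<longlongrightarrow> a * c) (at_right 0)"
    unfolding blinfun_apply_scale_op cinner_scaleC_left by (rule tendsto_mult_left)
  then show ?case by blast
next
  case (limit T)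
  show ?case
  proof (rule uniformly_approximated_limit)
    fix e :: real assume "0 < e"
    then obtain S c where S: "((\<lambda>\<epsilon>. cinner (blinfun_apply S (probe 0 0 x \<epsilon>)) (probe m n x \<epsilon>)) \<longlongrightarrow> c) (at_right 0)"
        "norm (T - S) < e"
      using limit(2) by blast
    have "cmod (cinner (blinfun_apply T (probe 0 0 x \<epsilon>)) (probe m n x \<epsilon>) -
        cinner (blinfun_apply S (probe 0 0 x \<epsilon>)) (probe m n x \<epsilon>)) \<le> e" if "0 < \<epsilon>" for \<epsilon>
      using norm_cinner_le[of "blinfun_apply (T - S) (probe 0 0 x \<epsilon>)" "probe m n x \<epsilon>"]
        norm_blinfun[of "T - S" "probe 0 0 x \<epsilon>"] S(2) norm_probe[OF that]
      by (simp add: blinfun.diff_left cinner_diff_left)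
    then have "\<forall>\<^sub>F \<epsilon> in at_right 0. cmod (cinner (blinfun_apply T (probe 0 0 x \<epsilon>)) (probe m n x \<epsilon>) -
        cinner (blinfun_apply S (probe 0 0 x \<epsilon>)) (probe m n x \<epsilon>)) \<le> e"
      by (rule eventually_mono[OF eventually_at_right_less])
    with S(1) show "\<exists>h c. (h \<longlongrightarrow> c) (at_right 0) \<and> (\<forall>\<^sub>F \<epsilon> in at_right 0.
        cmod (cinner (blinfun_apply T (probe 0 0 x \<epsilon>)) (probe m n x \<epsilon>) - h \<epsilon>) \<le> e)"
      by blast
  qed simp
qed

lemma entry_tendsto:
  assumes "T \<in> A_ph_Zplus"
  shows "((\<lambda>\<epsilon>. cinner (blinfun_apply T (probe 0 0 x \<epsilon>)) (probe m n x \<epsilon>)) \<longlongrightarrow>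
    entry T m n (m + exp (- real n) * x)) (at_right 0)"
proof -
  have x: "exp (real n) * (m + exp (- real n) * x - m) = x"
    by (simp add: mult.assoc[symmetric] flip: exp_add)
  show ?thesis
    using A_ph_Zplus_has_entry[OF assms, of x m n] unfolding entry_def x
    by (auto simp: tendsto_Lim)
qed

lemma entry_tendsto':
  assumes "T \<in> A_ph_Zplus"
  shows "((\<lambda>\<epsilon>. cinner (blinfun_apply T (probe 0 0 (exp (real n) * (y - m)) \<epsilon>))
    (probe m n (exp (real n) * (y - m)) \<epsilon>)) \<longlongrightarrow> entry T m n y) (at_right 0)"
  using entry_tendsto[OF assms, of "exp (real n) * (y - m)" m n]
  by (simp add: mult.assoc[symmetric] flip: exp_add)

lemma entry_word:
  "entry (word l m' n') m n y = (if m' = m \<and> n' = n then exp (\<i> * of_real l * of_real y) else 0)"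
  unfolding entry_def by (rule tendsto_Lim[OF _ word_has_entry]) simp

lemma entry_one: "entry id_blinfun m n y = (if m = 0 \<and> n = 0 then 1 else 0)"
  using entry_word[of 0 0 0 m n y] by auto

lemma norm_entry_le:
  assumes "T \<in> A_ph_Zplus"
  shows "cmod (entry T m n y) \<le> norm T"
proof (rule tendsto_upperbound[OF tendsto_norm[OF entry_tendsto'[OF assms]]])
  have "cmod (cinner (blinfun_apply T (probe 0 0 x \<epsilon>)) (probe m n x \<epsilon>)) \<le> norm T" if "0 < \<epsilon>" for x \<epsilon>
    using norm_cinner_le[of "blinfun_apply T (probe 0 0 x \<epsilon>)" "probe m n x \<epsilon>"]
      norm_blinfun[of T "probe 0 0 x \<epsilon>"] norm_probe[OF that] by simp
  then show "\<forall>\<^sub>F \<epsilon> in at_right 0. cmod (cinner (blinfun_apply T (probe 0 0 (exp (real n) * (y - m)) \<epsilon>))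
      (probe m n (exp (real n) * (y - m)) \<epsilon>)) \<le> norm T"
    by (rule eventually_mono[OF eventually_at_right_less])
qed simp

lemma A_functional_entry: "A_functional (\<lambda>T. entry T m n y)"
  unfolding A_functional_def
proof (intro conjI ballI allI)
  fix S T assume "S \<in> A_ph_Zplus" "T \<in> A_ph_Zplus"
  then show "entry (S + T) m n y = entry S m n y + entry T m n y"
    using tendsto_add[OF entry_tendsto'[of S n y m] entry_tendsto'[of T n y m]] entry_tendsto'[of "S + T" n y m]
    by (intro tendsto_unique[of "at_right (0::real)"])
      (auto simp: A_ph_Zplus_add blinfun.add_left cinner_add_left)
next
  fix c T assume "T \<in> A_ph_Zplus"
  then show "entry (scale_op c T) m n y = c * entry T m n y"
    using tendsto_mult_left[OF entry_tendsto'[of T n y m], of c] entry_tendsto'[of "scale_op c T" n y m]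
    by (intro tendsto_unique[of "at_right (0::real)"])
      (auto simp: A_ph_Zplus_scale cinner_scaleC_left)
next
  show "\<exists>K. \<forall>T\<in>A_ph_Zplus. cmod (entry T m n y) \<le> K * norm T"
    using norm_entry_le by (intro exI[of _ 1]) simp
qed

lemma entry_add:
  "S \<in> A_ph_Zplus \<Longrightarrow> T \<in> A_ph_Zplus \<Longrightarrow> entry (S + T) m n y = entry S m n y + entry T m n y"
  and entry_scale: "T \<in> A_ph_Zplus \<Longrightarrow> entry (scale_op c T) m n y = c * entry T m n y"
  using A_functional_entry[of m n y] by (auto simp: A_functional_def)

lemma entry_diff:
  "S \<in> A_ph_Zplus \<Longrightarrow> T \<in> A_ph_Zplus \<Longrightarrow> entry (S - T) m n y = entry S m n y - entry T m n y"
  by (rule A_functional_diff[OF A_functional_entry])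

text \<open>
  The probes with a common base point \<open>x\<close> are eventually orthonormal, so this is the limit of the
  Bessel inequality for the image of one unit vector. The entries are evaluated at the points to which
  the words move \<open>x\<close>.
\<close>
lemma entry_bessel:
  assumes T: "T \<in> A_ph_Zplus" and G: "finite G"
  shows "(\<Sum>(m, n)\<in>G. (cmod (entry T m n (m + exp (- real n) * x)))\<^sup>2) \<le> (norm T)\<^sup>2"
proof (rule tendsto_upperbound)
  show "((\<lambda>\<epsilon>. \<Sum>(m, n)\<in>G. (cmod (cinner (blinfun_apply T (probe 0 0 x \<epsilon>)) (probe m n x \<epsilon>)))\<^sup>2) \<longlongrightarrow>
      (\<Sum>(m, n)\<in>G. (cmod (entry T m n (m + exp (- real n) * x)))\<^sup>2)) (at_right 0)"
    unfolding case_prod_beta by (intro tendsto_intros entry_tendsto T)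
  have "\<forall>\<^sub>F \<epsilon> in at_right 0. \<forall>p\<in>G. \<forall>q\<in>G. p \<noteq> q \<longrightarrow>
      cinner (probe (fst p) (snd p) x \<epsilon>) (probe (fst q) (snd q) x \<epsilon>) = 0"
  proof (intro eventually_ball_finite G ballI)
    fix p q :: "real \<times> nat"
    show "\<forall>\<^sub>F \<epsilon> in at_right 0. p \<noteq> q \<longrightarrow> cinner (probe (fst p) (snd p) x \<epsilon>) (probe (fst q) (snd q) x \<epsilon>) = 0"
    proof (cases "p = q")
      case False
      then show ?thesis
        using probe_orthogonal[of "fst p" "snd p" "fst q" "snd q" 0 x] by simp
    qed simp
  qed
  moreover have "\<forall>\<^sub>F \<epsilon> in at_right 0. (0::real) < \<epsilon>"
    by (simp add: eventually_at_right_less)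
  ultimately show "\<forall>\<^sub>F \<epsilon> in at_right 0.
      (\<Sum>(m, n)\<in>G. (cmod (cinner (blinfun_apply T (probe 0 0 x \<epsilon>)) (probe m n x \<epsilon>)))\<^sup>2) \<le> (norm T)\<^sup>2"
  proof eventually_elim
    case (elim \<epsilon>)
    have "(\<Sum>p\<in>G. (cmod (cinner (blinfun_apply T (probe 0 0 x \<epsilon>)) (probe (fst p) (snd p) x \<epsilon>)))\<^sup>2)
        \<le> (norm (blinfun_apply T (probe 0 0 x \<epsilon>)))\<^sup>2"
      using elim by (intro bessel_inequality G) (auto simp: norm_probe)
    also have "\<dots> \<le> (norm T)\<^sup>2"
      using norm_blinfun[of T "probe 0 0 x \<epsilon>"] norm_probe[OF elim(2)] by (intro power_mono) auto
    finally show ?case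
      by (simp add: case_prod_beta)
  qed
qed simp

lemma analytic_ap_entry:
  assumes "T \<in> A_ph_Zplus"
  shows "analytic_ap (entry T m n)"
  using assms
proof (induction rule: A_ph_Zplus_induct)
  case (word l m' n')
  have "entry (word l m' n') m n = (\<lambda>y. (if m' = m \<and> n' = n then 1 else 0) * exp (\<i> * of_real l * of_real y))"
    by (auto simp: fun_eq_iff entry_word)
  then show ?case
    using analytic_ap_cmult[OF analytic_ap_exp[OF word(1)]] by simp
next
  case (add S T)
  have "entry (S + T) m n = (\<lambda>y. entry S m n y + entry T m n y)"
    using add by (simp add: fun_eq_iff entry_add)
  then show ?case
    using add analytic_ap_add by simp
next
  case (scale c T)
  have "entry (scale_op c T) m n = (\<lambda>y. c * entry T m n y)"
    using scale by (simp add: fun_eq_iff entry_scale)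
  then show ?case
    using scale analytic_ap_cmult by simp
next
  case (limit T)
  show ?case
  proof (rule analytic_ap_limit)
    fix e :: real assume "0 < e"
    then obtain S where S: "S \<in> A_ph_Zplus" "analytic_ap (entry S m n)" "norm (T - S) < e"
      using limit(2) by blast
    have "cmod (entry T m n x - entry S m n x) \<le> e" for x
      using norm_entry_le[OF A_ph_Zplus_diff[OF limit(1) S(1)], of m n x] S(3)
        entry_diff[OF limit(1) S(1), of m n x] by simp
    with S show "\<exists>g. analytic_ap g \<and> (\<forall>x. cmod (entry T m n x - g x) \<le> e)"
      by blast
  qed
qed

section \<open>Entries of products\<close>

text \<open>
  Translations and degrees of words are nonnegative and those of a product are a positive
  combination, so the trivial pair arises only from trivial factors.
\<close>
lemma entry_mult_00:
  assumes S: "S \<in> A_ph_Zplus" and T: "T \<in> A_ph_Zplus"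
  shows "entry (S o\<^sub>L T) 0 0 y = entry S 0 0 y * entry T 0 0 y"
proof (rule A_functional_eqI[OF _ _ _ T])
  show "A_functional (\<lambda>T. entry (S o\<^sub>L T) 0 0 y)"
    by (rule A_functional_compose_left[OF A_functional_entry S])
  show "A_functional (\<lambda>T. entry S 0 0 y * entry T 0 0 y)"
    by (rule A_functional_cmult[OF A_functional_entry])
  fix l' m' :: real and n' :: nat assume w': "0 \<le> l'" "0 \<le> m'"
  show "entry (S o\<^sub>L word l' m' n') 0 0 y = entry S 0 0 y * entry (word l' m' n') 0 0 y"
  proof (rule A_functional_eqI[OF _ _ _ S])
    show "A_functional (\<lambda>S. entry (S o\<^sub>L word l' m' n') 0 0 y)"
      by (rule A_functional_compose_right[OF A_functional_entry word_A_ph_Zplus[OF w']])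
    show "A_functional (\<lambda>S. entry S 0 0 y * entry (word l' m' n') 0 0 y)"
      by (rule A_functional_multc[OF A_functional_entry])
    fix l m :: real and n :: nat assume w: "0 \<le> l" "0 \<le> m"
    have *: "m + exp (- real n) * m' = 0 \<longleftrightarrow> m = 0 \<and> m' = 0"
      using w w' by (simp add: add_nonneg_eq_0_iff)
    show "entry (word l m n o\<^sub>L word l' m' n') 0 0 y = entry (word l m n) 0 0 y * entry (word l' m' n') 0 0 y"
      using w w' by (auto simp: word_mult entry_scale word_A_ph_Zplus entry_word * algebra_simps simp flip: exp_add)
  qed
qed

text \<open>
  A word of degree one without translation arises only as a product of a word of this kind and a word
  of degree zero without translation. If the former stands on the left, it evaluates the other
  coefficient at the dilated point.
\<close>
lemma entry_mult_01:
  assumes S: "S \<in> A_ph_Zplus" and T: "T \<in> A_ph_Zplus"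
  shows "entry (S o\<^sub>L T) 0 1 y = entry S 0 0 y * entry T 0 1 y + entry S 0 1 y * entry T 0 0 (exp 1 * y)"
proof (rule A_functional_eqI[OF _ _ _ T])
  show "A_functional (\<lambda>T. entry (S o\<^sub>L T) 0 1 y)"
    by (rule A_functional_compose_left[OF A_functional_entry S])
  show "A_functional (\<lambda>T. entry S 0 0 y * entry T 0 1 y + entry S 0 1 y * entry T 0 0 (exp 1 * y))"
    by (intro A_functional_add A_functional_cmult A_functional_entry)
  fix l' m' :: real and n' :: nat assume w': "0 \<le> l'" "0 \<le> m'"
  show "entry (S o\<^sub>L word l' m' n') 0 1 y =
      entry S 0 0 y * entry (word l' m' n') 0 1 y + entry S 0 1 y * entry (word l' m' n') 0 0 (exp 1 * y)"
  proof (rule A_functional_eqI[OF _ _ _ S])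
    show "A_functional (\<lambda>S. entry (S o\<^sub>L word l' m' n') 0 1 y)"
      by (rule A_functional_compose_right[OF A_functional_entry word_A_ph_Zplus[OF w']])
    show "A_functional (\<lambda>S. entry S 0 0 y * entry (word l' m' n') 0 1 y + entry S 0 1 y * entry (word l' m' n') 0 0 (exp 1 * y))"
      by (intro A_functional_add A_functional_multc A_functional_entry)
    fix l m :: real and n :: nat assume w: "0 \<le> l" "0 \<le> m"
    have *: "m + exp (- real n) * m' = 0 \<longleftrightarrow> m = 0 \<and> m' = 0"
      using w w' by (simp add: add_nonneg_eq_0_iff)
    have **: "n + n' = 1 \<longleftrightarrow> (n = 0 \<and> n' = 1) \<or> (n = 1 \<and> n' = 0)"
      by auto
    show "entry (word l m n o\<^sub>L word l' m' n') 0 1 y =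
        entry (word l m n) 0 0 y * entry (word l' m' n') 0 1 y +
        entry (word l m n) 0 1 y * entry (word l' m' n') 0 0 (exp 1 * y)"
      using w w' by (simp add: word_mult entry_scale word_A_ph_Zplus entry_word *)
        (auto simp: ** algebra_simps simp flip: exp_add)
  qed
qed

lemma entry_M_mult:
  assumes l: "0 \<le> l" and T: "T \<in> A_ph_Zplus"
  shows "entry (M_op l o\<^sub>L T) m n y = exp (\<i> * of_real l * of_real y) * entry T m n y"
proof (rule A_functional_eqI[OF _ _ _ T])
  show "A_functional (\<lambda>T. entry (M_op l o\<^sub>L T) m n y)"
    by (rule A_functional_compose_left[OF A_functional_entry generators_A_ph_Zplus(1)[OF l]])
  show "A_functional (\<lambda>T. exp (\<i> * of_real l * of_real y) * entry T m n y)"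
    by (rule A_functional_cmult[OF A_functional_entry])
  fix l' m' :: real and n' :: nat assume w': "0 \<le> l'" "0 \<le> m'"
  show "entry (M_op l o\<^sub>L word l' m' n') m n y = exp (\<i> * of_real l * of_real y) * entry (word l' m' n') m n y"
    unfolding M_op_word using l w'
    by (auto simp: word_mult entry_scale word_A_ph_Zplus entry_word algebra_simps simp flip: exp_add)
qed

lemma entry_mult_M:
  assumes l: "0 \<le> l" and T: "T \<in> A_ph_Zplus"
  shows "entry (T o\<^sub>L M_op l) m n y = entry T m n y * exp (\<i> * of_real l * of_real (exp (real n) * (y - m)))"
proof (rule A_functional_eqI[OF _ _ _ T])
  show "A_functional (\<lambda>T. entry (T o\<^sub>L M_op l) m n y)"
    by (rule A_functional_compose_right[OF A_functional_entry generators_A_ph_Zplus(1)[OF l]])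
  show "A_functional (\<lambda>T. entry T m n y * exp (\<i> * of_real l * of_real (exp (real n) * (y - m))))"
    by (rule A_functional_multc[OF A_functional_entry])
  fix l' m' :: real and n' :: nat assume w': "0 \<le> l'" "0 \<le> m'"
  show "entry (word l' m' n' o\<^sub>L M_op l) m n y =
      entry (word l' m' n') m n y * exp (\<i> * of_real l * of_real (exp (real n) * (y - m)))"
    unfolding M_op_word using l w'
    by (auto simp: word_mult entry_scale word_A_ph_Zplus entry_word algebra_simps simp flip: exp_add)
qed

definition mult_op :: "(real \<Rightarrow> complex) \<Rightarrow> (L2R \<Rightarrow>\<^sub>L L2R)" where
  "mult_op \<phi> = Blinfun (multiply \<phi>)"

lemma bounded_linear_multiply:
  assumes "admissible \<phi>"
  shows "bounded_linear (multiply \<phi>)"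
proof -
  obtain B where B: "\<And>x. cmod (\<phi> x) \<le> B"
    using assms by (auto simp: admissible_def bounded_iff)
  show ?thesis
  proof (rule bounded_linear_intro[where K = B])
    show "multiply \<phi> (F + G) = multiply \<phi> F + multiply \<phi> G" for F G
      by (rule multiply_add)
    show "multiply \<phi> (r *\<^sub>R F) = r *\<^sub>R multiply \<phi> F" for r F
      using multiply_scaleC[of \<phi> "of_real r" F] by (simp add: scaleC_of_real)
    show "norm (multiply \<phi> F) \<le> norm F * B" for F
      using norm_multiply_le[OF assms B, of F] by (simp add: mult.commute)
  qed
qed

lemma blinfun_apply_mult_op [simp]: "admissible \<phi> \<Longrightarrow> blinfun_apply (mult_op \<phi>) = multiply \<phi>"
  by (simp add: mult_op_def bounded_linear_Blinfun_apply bounded_linear_multiply)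

lemma norm_mult_op_le:
  assumes "admissible \<phi>" "\<And>x. cmod (\<phi> x) \<le> B"
  shows "norm (mult_op \<phi>) \<le> B"
proof (rule norm_blinfun_bound)
  show "0 \<le> B" using assms(2)[of 0] norm_ge_zero order_trans by blast
  show "norm (blinfun_apply (mult_op \<phi>) F) \<le> B * norm F" for F
    using norm_multiply_le[OF assms] assms(1) by simp
qed

lemma mult_op_diff:
  assumes "admissible \<phi>" "admissible \<psi>"
  shows "mult_op \<phi> - mult_op \<psi> = mult_op (\<lambda>x. \<phi> x - \<psi> x)"
  by (rule blinfun_eqI) (simp add: assms admissible_diff blinfun.diff_left multiply_diff_left)

lemma admissible_exp_term: "admissible (\<lambda>x. c * exp (\<i> * of_real l * of_real x))"
  by (intro admissible_mult admissible_const admissible_exp)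

lemma admissible_exp_sum:
  assumes "finite I"
  shows "admissible (exp_sum I c)"
  using multiply_sum[of I "\<lambda>l x. c l * exp (\<i> * of_real l * of_real x)", OF assms admissible_exp_term]
  unfolding exp_sum_def by (rule conjunct1)

lemma mult_op_exp_sum:
  assumes "finite I"
  shows "mult_op (exp_sum I c) = (\<Sum>l\<in>I. scale_op (c l) (M_op l))"
proof (rule blinfun_eqI)
  fix F
  have "multiply (exp_sum I c) F = (\<Sum>l\<in>I. multiply (\<lambda>x. c l * exp (\<i> * of_real l * of_real x)) F)"
    using multiply_sum[of I "\<lambda>l x. c l * exp (\<i> * of_real l * of_real x)", OF assms admissible_exp_term]
    unfolding exp_sum_def by (rule conjunct2)
  also have "\<dots> = (\<Sum>l\<in>I. c l *\<^sub>C modulate l F)"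
    unfolding multiply_multiply[OF admissible_const admissible_exp, symmetric] multiply_exp multiply_const ..
  finally show "blinfun_apply (mult_op (exp_sum I c)) F = blinfun_apply (\<Sum>l\<in>I. scale_op (c l) (M_op l)) F"
    using assms by (simp add: admissible_exp_sum blinfun.sum_left)
qed

lemma A_ph_Zplus_zero: "0 \<in> A_ph_Zplus"
  using A_ph_Zplus_scale[OF word_A_ph_Zplus[of 0 0 0], of 0] by simp

lemma A_ph_Zplus_sum: "(\<And>i. i \<in> I \<Longrightarrow> T i \<in> A_ph_Zplus) \<Longrightarrow> (\<Sum>i\<in>I. T i) \<in> A_ph_Zplus"
  by (induction I rule: infinite_finite_induct) (auto intro: A_ph_Zplus_add A_ph_Zplus_zero)

lemma mult_op_exp_sum_A: "finite I \<Longrightarrow> I \<subseteq> {0..} \<Longrightarrow> mult_op (exp_sum I c) \<in> A_ph_Zplus"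
  unfolding mult_op_exp_sum by (intro A_ph_Zplus_sum A_ph_Zplus_scale generators_A_ph_Zplus) auto

lemma mult_op_approx:
  assumes "analytic_ap \<phi>" "0 < e"
  shows "\<exists>I c. finite I \<and> I \<subseteq> {0..} \<and> (\<forall>x. cmod (\<phi> x - exp_sum I c x) \<le> e) \<and>
    norm (mult_op \<phi> - mult_op (exp_sum I c)) \<le> e"
proof -
  obtain I c where I: "finite I" "I \<subseteq> {0..}" "\<And>x. cmod (\<phi> x - exp_sum I c x) \<le> e"
    using analytic_apE[OF assms] by blast
  have a: "admissible \<phi>" "admissible (exp_sum I c)"
    using analytic_ap_admissible[OF assms(1)] admissible_exp_sum[OF I(1)] by auto
  have "norm (mult_op \<phi> - mult_op (exp_sum I c)) \<le> e"
    unfolding mult_op_diff[OF a] by (rule norm_mult_op_le[OF admissible_diff[OF a] I(3)])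
  with I show ?thesis
    by (intro exI[of _ I] exI[of _ c]) simp
qed

lemma mult_op_A_ph_Zplus:
  assumes "analytic_ap \<phi>"
  shows "mult_op \<phi> \<in> A_ph_Zplus"
proof -
  have "\<exists>S\<in>A_ph_Zplus. dist S (mult_op \<phi>) < e" if "0 < e" for e
  proof -
    have "0 < e / 2" using that by simp
    from mult_op_approx[OF assms this] obtain I c where I: "finite I" "I \<subseteq> {0..}"
        "norm (mult_op \<phi> - mult_op (exp_sum I c)) \<le> e / 2"
      by blast
    then show ?thesis
      using that mult_op_exp_sum_A[OF I(1,2)]
      by (intro bexI[of _ "mult_op (exp_sum I c)"]) (auto simp: dist_norm norm_minus_commute)
  qed
  then have "mult_op \<phi> \<in> closure A_ph_Zplus"
    by (simp add: closure_approachable)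
  then show ?thesis
    using closed_A_ph_Zplus by (simp add: closure_closed)
qed

text \<open>
  A functional that acts on the modulations as evaluation of characters at \<open>z\<close> acts on all
  multiplication operators in the algebra as evaluation at \<open>z\<close>.
\<close>
lemma A_functional_mult_op:
  assumes f: "A_functional f" and gen: "\<And>l. 0 \<le> l \<Longrightarrow> f (M_op l) = exp (\<i> * of_real l * of_real z) * C"
    and \<phi>: "analytic_ap \<phi>"
  shows "f (mult_op \<phi>) = \<phi> z * C"
proof -
  have sums: "f (mult_op (exp_sum I c)) = exp_sum I c z * C" if "finite I" "I \<subseteq> {0..}" for I c
    using that
  proof (induction I rule: finite_induct)
    case empty
    have "f (scale_op 0 0) = 0 * f 0"
      using f A_ph_Zplus_zero unfolding A_functional_def by blast
    then show ?case
      by (simp add: mult_op_exp_sum) (simp add: exp_sum_def)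
  next
    case (insert l I)
    then have A: "scale_op (c l) (M_op l) \<in> A_ph_Zplus" "mult_op (exp_sum I c) \<in> A_ph_Zplus"
      by (auto intro!: A_ph_Zplus_scale generators_A_ph_Zplus mult_op_exp_sum_A)
    have "mult_op (exp_sum (insert l I) c) = scale_op (c l) (M_op l) + mult_op (exp_sum I c)"
      using insert by (simp add: mult_op_exp_sum)
    then have "f (mult_op (exp_sum (insert l I) c)) = f (scale_op (c l) (M_op l)) + f (mult_op (exp_sum I c))"
      using f A unfolding A_functional_def by metis
    also have "f (scale_op (c l) (M_op l)) = c l * f (M_op l)"
      using f insert generators_A_ph_Zplus(1)[of l] unfolding A_functional_def by blast
    also have "f (M_op l) = exp (\<i> * of_real l * of_real z) * C"
      using insert by (intro gen) simp
    also have "f (mult_op (exp_sum I c)) = exp_sum I c z * C"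
      using insert by simp
    finally show ?case
      using insert by (simp add: exp_sum_def distrib_right mult.assoc)
  qed
  obtain K where K: "\<And>T. T \<in> A_ph_Zplus \<Longrightarrow> cmod (f T) \<le> K * norm T"
    using f unfolding A_functional_def by metis
  have "cmod (f (mult_op \<phi>) - \<phi> z * C) \<le> 0 + e" if e: "0 < e" for e
  proof -
    define N where "N = \<bar>K\<bar> + cmod C + 1"
    have N: "0 < N"
      by (simp add: N_def add_nonneg_pos)
    then have "0 < e / N"
      using e by simp
    from mult_op_approx[OF \<phi> this] obtain I c where I: "finite I" "I \<subseteq> {0..}"
        "\<And>x. cmod (\<phi> x - exp_sum I c x) \<le> e / N" "norm (mult_op \<phi> - mult_op (exp_sum I c)) \<le> e / N"
      by blast
    let ?p = "exp_sum I c"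
    have A: "mult_op \<phi> \<in> A_ph_Zplus" "mult_op ?p \<in> A_ph_Zplus"
      using mult_op_A_ph_Zplus[OF \<phi>] mult_op_exp_sum_A[OF I(1,2)] by auto
    have "cmod (f (mult_op \<phi>) - f (mult_op ?p)) \<le> K * norm (mult_op \<phi> - mult_op ?p)"
      using K[OF A_ph_Zplus_diff[OF A]] A_functional_diff[OF f A] by simp
    also have "\<dots> \<le> \<bar>K\<bar> * (e / N)"
      using I(4) by (intro mult_mono) auto
    finally have 1: "cmod (f (mult_op \<phi>) - ?p z * C) \<le> \<bar>K\<bar> * (e / N)"
      using sums[OF I(1,2)] by simp
    have "cmod (?p z * C - \<phi> z * C) = cmod (\<phi> z - ?p z) * cmod C"
      by (simp add: norm_mult[symmetric] left_diff_distrib norm_minus_commute)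
    also have "\<dots> \<le> e / N * cmod C"
      by (intro mult_right_mono I) simp
    finally have "cmod (f (mult_op \<phi>) - \<phi> z * C) \<le> \<bar>K\<bar> * (e / N) + e / N * cmod C"
      using 1 norm_triangle_ineq[of "f (mult_op \<phi>) - ?p z * C" "?p z * C - \<phi> z * C"] by simp
    also have "\<dots> = (\<bar>K\<bar> + cmod C) * (e / N)"
      by (simp only: distrib_right mult.commute[of "e / N"])
    also have "\<dots> \<le> N * (e / N)"
      by (rule mult_right_mono) (simp add: N_def, rule less_imp_le[OF \<open>0 < e / N\<close>])
    also have "\<dots> = e"
      using N by simp
    finally show ?thesis by simp
  qed
  then have "cmod (f (mult_op \<phi>) - \<phi> z * C) \<le> 0"
    by (rule field_le_epsilon)
  then show ?thesis by simp
qed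

lemma entry_mult_op:
  assumes \<phi>: "analytic_ap \<phi>" and T: "T \<in> A_ph_Zplus"
  shows "entry (mult_op \<phi> o\<^sub>L T) m n y = \<phi> y * entry T m n y"
  by (rule A_functional_mult_op[OF A_functional_compose_right[OF A_functional_entry T] entry_M_mult[OF _ T] \<phi>])

lemma entry_negative:
  assumes "T \<in> A_ph_Zplus" "m < 0"
  shows "entry T m n y = 0"
  by (rule A_functional_zeroI[OF A_functional_entry _ assms(1)]) (use assms(2) in \<open>simp add: entry_word\<close>)

section \<open>Recurrence and means of phases\<close>

text \<open>
  If the frequencies differ, at \<open>l = pi / (b - a)\<close> the two sides differ by a sign.
\<close>
lemma exp_phase_eq:
  assumes "\<And>l. 0 < l \<Longrightarrow> exp (\<i> * of_real (l * a)) = exp (\<i> * of_real (l * b))"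
  shows "a = b"
proof -
  have False if uv: "u < v" and eq: "\<And>l. 0 < l \<Longrightarrow> exp (\<i> * of_real (l * u)) = exp (\<i> * of_real (l * v))"
    for u v :: real
  proof -
    define l where "l = pi / (v - u)"
    have l: "0 < l" "l * (v - u) = pi"
      using uv by (simp_all add: l_def)
    have "exp (\<i> * of_real (l * (v - u))) = 1"
      using eq[OF l(1)] by (simp add: right_diff_distrib exp_diff)
    then show False
      unfolding l(2) by (simp add: mult.commute[of \<i>])
  qed
  from this[of a b] this[of b a] show ?thesis
    using assms by (metis linorder_less_linear)
qed

lemma exp_phase_eq_all:
  assumes "\<And>x. \<alpha> * exp (\<i> * of_real a * of_real x) = \<beta> * exp (\<i> * of_real b * of_real x)" "\<alpha> \<noteq> 0"
  shows "\<alpha> = \<beta> \<and> a = b"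
proof -
  have "\<alpha> = \<beta>"
    using assms(1)[of 0] by simp
  moreover have "a = b"
    by (rule exp_phase_eq) (use assms \<open>\<alpha> = \<beta>\<close> in \<open>simp add: mult_ac\<close>)
  ultimately show ?thesis ..
qed

lemma exp_phase_balance:
  assumes "a * exp (\<i> * of_real u) = b * exp (\<i> * of_real v)"
  shows "exp (\<i> * of_real (u - v)) * a = b"
proof -
  have "exp (\<i> * of_real (u - v)) * a = (a * exp (\<i> * of_real u)) * exp (- (\<i> * of_real v))"
    by (simp add: right_diff_distrib mult.commute mult.left_commute flip: exp_add)
  also have "\<dots> = b"
    unfolding assms by (simp add: mult.assoc flip: exp_add)
  finally show ?thesis .
qed

text \<open>
  A quantitative Kronecker recurrence by the pigeonhole principle: the residues of the phases fall
  into finitely many boxes, and differences of two times in the same box are return times. The point is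
  that the density bound \<open>1 / B\<close> is independent of the step \<open>\<tau>\<close>.
\<close>
lemma phase_recurrence_density:
  fixes A :: "real set"
  assumes A: "finite A" and \<eta>: "0 < \<eta>"
  shows "\<exists>B>0. \<forall>\<tau> L. real L \<le> B * real (card {k\<in>{..<L}. \<forall>a\<in>A. cmod (exp (\<i> * of_real (a * \<tau> * real k)) - 1) \<le> \<eta>})"
proof -
  obtain M :: nat where M: "2 * pi / \<eta> < real M"
    using reals_Archimedean2 by blast
  then have M0: "0 < M"
    using \<eta> by (metis divide_pos_pos gr0I less_irrefl mult_pos_pos of_nat_0 order_less_trans pi_gt_zero zero_less_numeral)
  have M1: "2 * pi / real M \<le> \<eta>"
    using M M0 \<eta> by (simp add: field_simps)
  define X where "X = PiE A (\<lambda>_. {..<M})"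
  have finX: "finite X"
    using A by (auto simp: X_def intro: finite_PiE)
  \<comment> \<open>\<open>B\<close> is the number of boxes of side \<open>1 / M\<close> in the torus indexed by \<open>A\<close>.\<close>
  define B where "B = card X"
  have B: "0 < B"
    using A M0 by (simp add: B_def X_def card_PiE)
  have "real L \<le> real B * real (card {k\<in>{..<L}. \<forall>a\<in>A. cmod (exp (\<i> * of_real (a * \<tau> * real k)) - 1) \<le> \<eta>})" for \<tau> L
  proof -
    define G where "G = {k\<in>{..<L}. \<forall>a\<in>A. cmod (exp (\<i> * of_real (a * \<tau> * real k)) - 1) \<le> \<eta>}"
    have finG: "finite G"
      by (simp add: G_def)
    define u where "u = (\<lambda>a k. frac (a * \<tau> * real k / (2 * pi)))"
    define f where "f = (\<lambda>k. restrict (\<lambda>a. nat \<lfloor>real M * u a k\<rfloor>) A)"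
    have fX: "f k \<in> X" for k
      unfolding f_def X_def
    proof (rule restrict_PiE_iff[THEN iffD2], intro ballI)
      fix a
      have "0 \<le> u a k" "u a k < 1"
        by (auto simp: u_def frac_lt_1)
      then have "0 \<le> real M * u a k" "real M * u a k < real M"
        using M0 by auto
      then show "nat \<lfloor>real M * u a k\<rfloor> \<in> {..<M}"
        by (simp add: nat_less_iff floor_less_iff)
    qed
    \<comment> \<open>Two times with residues in the same box differ by a return time.\<close>
    have good: "k - k0 \<in> G" if "f k = f k0" "k0 \<le> k" "k < L" for k k0
      unfolding G_def
    proof (intro CollectI conjI ballI)
      show "k - k0 \<in> {..<L}"
        using that by simp
      fix a assume a: "a \<in> A"
      have "nat \<lfloor>real M * u a k\<rfloor> = nat \<lfloor>real M * u a k0\<rfloor>"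
        using that(1) a by (metis f_def restrict_apply')
      moreover have "0 \<le> real M * u a k" "0 \<le> real M * u a k0"
        by (auto simp: u_def)
      ultimately have "\<lfloor>real M * u a k\<rfloor> = \<lfloor>real M * u a k0\<rfloor>"
        by (simp add: nat_eq_iff)
      then have "\<bar>real M * u a k - real M * u a k0\<bar> < 1"
        by linarith
      then have "real M * \<bar>u a k - u a k0\<bar> < 1"
        by (simp add: abs_mult flip: right_diff_distrib)
      then have uu: "\<bar>u a k - u a k0\<bar> \<le> 1 / real M"
        using M0 by (simp add: field_simps)
      define j where "j = \<lfloor>a * \<tau> * real k / (2 * pi)\<rfloor> - \<lfloor>a * \<tau> * real k0 / (2 * pi)\<rfloor>"
      have "a * \<tau> * real (k - k0) = 2 * pi * (a * \<tau> * real k / (2 * pi)) - 2 * pi * (a * \<tau> * real k0 / (2 * pi))"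
        using that(2) by (simp add: of_nat_diff right_diff_distrib)
      also have "\<dots> = 2 * pi * (u a k - u a k0) + 2 * pi * of_int j"
        by (simp add: u_def frac_def j_def right_diff_distrib)
      finally have eq: "a * \<tau> * real (k - k0) = 2 * pi * (u a k - u a k0) + 2 * pi * of_int j" .
      have "exp (\<i> * of_real (a * \<tau> * real (k - k0))) =
          exp (\<i> * of_real (2 * pi * (u a k - u a k0))) * exp (2 * of_int j * of_real pi * \<i>)"
        unfolding eq of_real_add distrib_left exp_add by (simp add: mult_ac)
      also have "exp (2 * of_int j * of_real pi * \<i>) = 1"
        using cis_multiple_2pi[of "of_int j"] by (simp add: cis_conv_exp mult_ac)
      finally have "cmod (exp (\<i> * of_real (a * \<tau> * real (k - k0))) - 1) =
          cmod (exp (\<i> * of_real (2 * pi * (u a k - u a k0))) - exp (\<i> * of_real 0))"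
        by simp
      also have "\<dots> \<le> \<bar>2 * pi * (u a k - u a k0) - 0\<bar>"
        by (rule norm_exp_ii_diff_le)
      also have "\<dots> = 2 * pi * \<bar>u a k - u a k0\<bar>"
        by (simp add: abs_mult)
      also have "\<dots> \<le> 2 * pi * (1 / real M)"
        using uu by (intro mult_left_mono) auto
      also have "\<dots> \<le> \<eta>"
        using M1 by simp
      finally show "cmod (exp (\<i> * of_real (a * \<tau> * real (k - k0))) - 1) \<le> \<eta>" .
    qed
    have fibre: "card {k\<in>{..<L}. f k = v} \<le> card G" for v
    proof (cases "{k\<in>{..<L}. f k = v} = {}")
      case False
      define S where "S = {k\<in>{..<L}. f k = v}"
      define k0 where "k0 = Min S"
      have S: "finite S" "S \<noteq> {}"
        using False by (auto simp: S_def)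
      have k0: "k0 \<in> S" "\<And>k. k \<in> S \<Longrightarrow> k0 \<le> k"
        using S by (auto simp: k0_def)
      have "inj_on (\<lambda>k. k - k0) S"
        using k0(2) by (auto simp: inj_on_def) (metis eq_diff_iff)
      moreover have "(\<lambda>k. k - k0) ` S \<subseteq> G"
        using k0 good by (auto simp: S_def)
      ultimately show ?thesis
        unfolding S_def[symmetric] using finG by (rule card_inj_on_le)
    next
      case True
      then show ?thesis
        by (simp only: card.empty le0)
    qed
    have "{..<L} = (\<Union>v\<in>X. {k\<in>{..<L}. f k = v})"
      using fX by auto
    then have "L = card (\<Union>v\<in>X. {k\<in>{..<L}. f k = v})"
      by (metis card_lessThan)
    also have "\<dots> \<le> (\<Sum>v\<in>X. card {k\<in>{..<L}. f k = v})"
      by (rule card_UN_le[OF finX])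
    also have "\<dots> \<le> (\<Sum>v\<in>X. card G)"
      by (intro sum_mono fibre)
    also have "\<dots> = B * card G"
      by (simp add: B_def)
    finally have "real L \<le> real (B * card G)"
      by (rule of_nat_mono)
    then show ?thesis
      by (simp add: G_def)
  qed
  then show ?thesis
    using B by (intro exI[of _ "real B"]) auto
qed

lemma phase_recurrence:
  fixes A :: "real set"
  assumes A: "finite A"
  shows "\<exists>r::nat \<Rightarrow> real. filterlim r at_top sequentially \<and>
    (\<forall>a\<in>A. (\<lambda>k. exp (\<i> * of_real (a * r k))) \<longlonglongrightarrow> 1)"
proof -
  have ex: "\<exists>j\<ge>k. \<forall>a\<in>A. cmod (exp (\<i> * of_real (a * real j)) - 1) \<le> inverse (real (Suc k))" for k
  proof (rule ccontr)
    assume no: "\<not> ?thesis"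
    obtain B where B: "\<And>\<tau> L. real L \<le> B * real (card {j\<in>{..<L}. \<forall>a\<in>A. cmod (exp (\<i> * of_real (a * \<tau> * real j)) - 1) \<le> inverse (real (Suc k))})"
        "0 < B"
      using phase_recurrence_density[OF A, of "inverse (real (Suc k))"] by auto
    have "real L \<le> B * real k" for L
    proof -
      have sub: "{j\<in>{..<L}. \<forall>a\<in>A. cmod (exp (\<i> * of_real (a * 1 * real j)) - 1) \<le> inverse (real (Suc k))} \<subseteq> {..<k}"
        using no by (auto simp: not_le[symmetric])
      have "card {j\<in>{..<L}. \<forall>a\<in>A. cmod (exp (\<i> * of_real (a * 1 * real j)) - 1) \<le> inverse (real (Suc k))} \<le> k"
        using card_mono[OF _ sub] by simp
      then show ?thesis
        using B(1)[of L 1] B(2) by (meson mult_left_mono of_nat_mono less_imp_le order_trans)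
    qed
    then show False
      using reals_Archimedean2[of "B * real k"] by (meson not_less)
  qed
  then obtain j where j: "\<And>k. k \<le> j k"
      "\<And>k a. a \<in> A \<Longrightarrow> cmod (exp (\<i> * of_real (a * real (j k))) - 1) \<le> inverse (real (Suc k))"
    by metis
  have "filterlim (\<lambda>k. real (j k)) at_top sequentially"
    by (rule filterlim_at_top_mono[OF filterlim_real_sequentially]) (simp add: j)
  moreover have "(\<lambda>k. exp (\<i> * of_real (a * real (j k)))) \<longlonglongrightarrow> 1" if "a \<in> A" for a
  proof -
    have "(\<lambda>k. exp (\<i> * of_real (a * real (j k))) - 1) \<longlonglongrightarrow> 0"
      by (rule Lim_null_comparison[OF always_eventually LIMSEQ_inverse_real_of_nat]) (use j that in blast)
    then show ?thesis
      by (simp add: LIM_zero_iff)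
  qed
  ultimately show ?thesis
    by (intro exI[of _ "\<lambda>k. real (j k)"]) auto
qed

section \<open>Windows of degrees\<close>

lemma translate_diff: "translate s (F - G) = translate s F - translate s G"
  by (rule linear_diff[OF bounded_linear.linear[OF bounded_linear_translate]])

lemma translate_add: "translate s (F + G) = translate s F + translate s G"
  by (rule linear_add[OF bounded_linear.linear[OF bounded_linear_translate]])

lemma translate_sum: "translate s (\<Sum>i\<in>I. F i) = (\<Sum>i\<in>I. translate s (F i))"
  by (rule linear_sum[OF bounded_linear.linear[OF bounded_linear_translate]])

lemma inner_translate: "translate s F \<bullet> translate s G = F \<bullet> G"
proof -
  have "(norm (translate s F + translate s G))\<^sup>2 = (norm (F + G))\<^sup>2"
    by (simp add: norm_translate flip: translate_add)
  moreover have "(norm (translate s F))\<^sup>2 = (norm F)\<^sup>2" "(norm (translate s G))\<^sup>2 = (norm G)\<^sup>2"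
    by (simp_all add: norm_translate)
  ultimately show ?thesis
    by (simp add: power2_norm_eq_inner inner_add_left inner_add_right inner_commute)
qed

lemma inner_translate_limit:
  assumes F: "F \<longlonglongrightarrow> F0" and G: "G \<longlonglongrightarrow> G0" and s: "filterlim s at_top sequentially"
  shows "(\<lambda>k. translate (s k) (F k) \<bullet> G k) \<longlonglongrightarrow> 0"
proof (rule Lim_null_comparison)
  have "(\<lambda>k. \<bar>translate (s k) F0 \<bullet> G0\<bar> + norm (F k - F0) * norm (G k) + norm F0 * norm (G k - G0))
      \<longlonglongrightarrow> \<bar>0\<bar> + norm (F0 - F0) * norm G0 + norm F0 * norm (G0 - G0)"
    by (intro tendsto_intros F G filterlim_compose[OF inner_translate_tendsto_0 s])
  then show "(\<lambda>k. \<bar>translate (s k) F0 \<bullet> G0\<bar> + norm (F k - F0) * norm (G k) + norm F0 * norm (G k - G0)) \<longlonglongrightarrow> 0"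
    by simp
  have "norm (translate (s k) (F k) \<bullet> G k) \<le> \<bar>translate (s k) F0 \<bullet> G0\<bar> + norm (F k - F0) * norm (G k) + norm F0 * norm (G k - G0)" for k
  proof -
    have "translate (s k) (F k) \<bullet> G k = translate (s k) F0 \<bullet> G0 + translate (s k) (F k - F0) \<bullet> G k + translate (s k) F0 \<bullet> (G k - G0)"
      by (simp add: translate_diff inner_diff_left inner_diff_right)
    moreover have "\<bar>translate (s k) (F k - F0) \<bullet> G k\<bar> \<le> norm (F k - F0) * norm (G k)"
      using Cauchy_Schwarz_ineq2[of "translate (s k) (F k - F0)" "G k"] by (simp add: norm_translate)
    moreover have "\<bar>translate (s k) F0 \<bullet> (G k - G0)\<bar> \<le> norm F0 * norm (G k - G0)"
      using Cauchy_Schwarz_ineq2[of "translate (s k) F0" "G k - G0"] by (simp add: norm_translate)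
    ultimately show ?thesis
      by simp
  qed
  then show "\<forall>\<^sub>F k in sequentially. norm (translate (s k) (F k) \<bullet> G k) \<le>
      \<bar>translate (s k) F0 \<bullet> G0\<bar> + norm (F k - F0) * norm (G k) + norm F0 * norm (G k - G0)"
    by simp
qed

text \<open>
  The distances between the translation parameters \<open>r k * exp (- i)\<close> tend to infinity, so
  the translated vectors become orthogonal.
\<close>
lemma separated_translates_orthogonal:
  assumes G: "\<And>i. i < L \<Longrightarrow> G i \<longlonglongrightarrow> G0 i" and r: "filterlim r at_top sequentially"
  shows "(\<lambda>k. (norm (\<Sum>i<L. translate (r k * exp (- real i)) (G i k)))\<^sup>2) \<longlonglongrightarrow> (\<Sum>i<L. (norm (G0 i))\<^sup>2)"
proof -
  let ?t = "\<lambda>i k. translate (r k * exp (- real i)) (G i k)"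
  have shift: "translate a F \<bullet> translate b H = translate (a - b) F \<bullet> H" for a b F H
    using inner_translate[of b "translate (a - b) F" H] by (simp add: translate_translate)
  have far: "(\<lambda>k. ?t i k \<bullet> ?t j k) \<longlonglongrightarrow> 0" if ij: "i < j" "j < L" for i j
  proof -
    have pos: "0 < exp (- real i) - exp (- real j)"
      using ij by simp
    have "filterlim (\<lambda>k. r k * (exp (- real i) - exp (- real j))) at_top sequentially"
      by (rule filterlim_at_top_mult_tendsto_pos[OF tendsto_const pos r])
    then have "(\<lambda>k. translate (r k * (exp (- real i) - exp (- real j))) (G i k) \<bullet> G j k) \<longlonglongrightarrow> 0"
      using ij by (intro inner_translate_limit[OF G G]) auto
    then show ?thesis
      unfolding shift by (simp add: right_diff_distrib)
  qed
  have pair: "(\<lambda>k. ?t i k \<bullet> ?t j k) \<longlonglongrightarrow> (if i = j then (norm (G0 i))\<^sup>2 else 0)" if ij: "i < L" "j < L" for i j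
  proof -
    consider "i = j" | "i < j" | "j < i" by linarith
    then show ?thesis
    proof cases
      case 1
      then show ?thesis
        using G[OF ij(1)] by (auto simp: inner_translate power2_norm_eq_inner intro!: tendsto_intros)
    next
      case 2
      then show ?thesis using far ij by simp
    next
      case 3
      then show ?thesis using far[of j i] ij by (simp add: inner_commute)
    qed
  qed
  have "(\<lambda>k. \<Sum>i<L. \<Sum>j<L. ?t i k \<bullet> ?t j k) \<longlonglongrightarrow> (\<Sum>i<L. \<Sum>j<L. if i = j then (norm (G0 i))\<^sup>2 else 0)"
    by (intro tendsto_sum pair) auto
  moreover have "(norm (\<Sum>i<L. ?t i k))\<^sup>2 = (\<Sum>i<L. \<Sum>j<L. ?t i k \<bullet> ?t j k)" for k
    by (simp add: power2_norm_eq_inner inner_sum_left inner_sum_right) (rule sum.swap)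
  moreover have "(\<Sum>i<L. \<Sum>j<L. if i = j then (norm (G0 i))\<^sup>2 else 0) = (\<Sum>i<L. (norm (G0 i))\<^sup>2)"
    by simp
  ultimately show ?thesis
    by simp
qed

definition word3 :: "real \<times> real \<times> nat \<Rightarrow> (L2R \<Rightarrow>\<^sub>L L2R)" where
  "word3 w = word (fst w) (fst (snd w)) (snd (snd w))"

definition finitely_supported :: "(real \<times> real \<times> nat \<Rightarrow> complex) \<Rightarrow> bool" where
  "finitely_supported c \<longleftrightarrow> finite {w. c w \<noteq> 0} \<and> (\<forall>w. c w \<noteq> 0 \<longrightarrow> 0 \<le> fst w \<and> 0 \<le> fst (snd w))"

definition word_sum :: "(real \<times> real \<times> nat \<Rightarrow> complex) \<Rightarrow> (L2R \<Rightarrow>\<^sub>L L2R)" where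
  "word_sum c = (\<Sum>w | c w \<noteq> 0. scale_op (c w) (word3 w))"

text \<open>
  The degree of a word is its number of dilations.
\<close>
definition degree_part :: "nat set \<Rightarrow> (real \<times> real \<times> nat \<Rightarrow> complex) \<Rightarrow> (real \<times> real \<times> nat \<Rightarrow> complex)" where
  "degree_part D c w = (if snd (snd w) \<in> D then c w else 0)"

lemma word_sum_superset:
  assumes "finite J" "\<And>w. c w \<noteq> 0 \<Longrightarrow> w \<in> J"
  shows "word_sum c = (\<Sum>w\<in>J. scale_op (c w) (word3 w))"
  unfolding word_sum_def using assms by (intro sum.mono_neutral_left) auto

lemma scale_op_add_left: "scale_op (a + b) T = scale_op a T + scale_op b T"
  by (rule blinfun_eqI) (simp add: blinfun.add_left scaleC_add_left)

lemma scale_op_diff_left: "scale_op (a - b) T = scale_op a T - scale_op b T"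
  by (rule blinfun_eqI) (simp add: blinfun.diff_left scaleC_diff_left)

lemma scale_op_sum: "scale_op a (\<Sum>i\<in>I. T i) = (\<Sum>i\<in>I. scale_op a (T i))"
  by (rule blinfun_eqI) (simp add: blinfun.sum_left scaleC_sum)

lemma finitely_supported_add:
  assumes "finitely_supported c" "finitely_supported d"
  shows "finitely_supported (\<lambda>w. c w + d w)"
proof -
  have "{w. c w + d w \<noteq> 0} \<subseteq> {w. c w \<noteq> 0} \<union> {w. d w \<noteq> 0}"
    by auto
  then have "finite {w. c w + d w \<noteq> 0}"
    by (rule finite_subset) (use assms in \<open>auto simp: finitely_supported_def\<close>)
  moreover have "c w \<noteq> 0 \<or> d w \<noteq> 0" if "c w + d w \<noteq> 0" for w
    using that by auto
  ultimately show ?thesis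
    using assms unfolding finitely_supported_def by blast
qed

lemma finitely_supported_cmult:
  assumes "finitely_supported c"
  shows "finitely_supported (\<lambda>w. a * c w)"
  using assms unfolding finitely_supported_def by (auto elim!: finite_subset[rotated])

lemma finitely_supported_diff:
  "finitely_supported c \<Longrightarrow> finitely_supported d \<Longrightarrow> finitely_supported (\<lambda>w. c w - d w)"
  using finitely_supported_add[of c "\<lambda>w. - 1 * d w"] finitely_supported_cmult[of d "- 1"] by simp

lemma finitely_supported_degree_part:
  assumes "finitely_supported c"
  shows "finitely_supported (degree_part D c)"
proof -
  have "{w. degree_part D c w \<noteq> 0} \<subseteq> {w. c w \<noteq> 0}"
    by (auto simp: degree_part_def)
  then show ?thesis
    using assms by (auto simp: finitely_supported_def degree_part_def intro: finite_subset)
qed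

lemma word_sum_add:
  assumes "finitely_supported c" "finitely_supported d"
  shows "word_sum (\<lambda>w. c w + d w) = word_sum c + word_sum d"
proof -
  let ?J = "{w. c w \<noteq> 0} \<union> {w. d w \<noteq> 0}"
  have J: "finite ?J"
    using assms by (simp add: finitely_supported_def)
  show ?thesis
    by (subst (1 2 3) word_sum_superset[OF J]) (auto simp: scale_op_add_left sum.distrib)
qed

lemma word_sum_diff:
  assumes "finitely_supported c" "finitely_supported d"
  shows "word_sum (\<lambda>w. c w - d w) = word_sum c - word_sum d"
proof -
  let ?J = "{w. c w \<noteq> 0} \<union> {w. d w \<noteq> 0}"
  have J: "finite ?J"
    using assms by (simp add: finitely_supported_def)
  show ?thesis
    by (subst (1 2 3) word_sum_superset[OF J]) (auto simp: scale_op_diff_left sum_subtractf)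
qed

lemma words_word_sum:
  assumes "T \<in> words"
  shows "\<exists>c. finitely_supported c \<and> T = word_sum c"
  using assms
proof (induction rule: words.induct)
  case (word l m n)
  let ?c = "\<lambda>w. if w = (l, m, n) then 1 else (0::complex)"
  have "finitely_supported ?c"
    using word by (auto simp: finitely_supported_def)
  moreover have "word l m n = word_sum ?c"
    by (subst word_sum_superset[of "{(l, m, n)}"]) (auto simp: word3_def split: if_splits)
  ultimately show ?case by blast
next
  case (add S T)
  then show ?case
    using finitely_supported_add word_sum_add by metis
next
  case (scale T a)
  then obtain c where c: "finitely_supported c" "T = word_sum c" by blast
  have "word_sum (\<lambda>w. a * c w) = scale_op a (word_sum c)"
    using c(1) by (subst (1 2) word_sum_superset[of "{w. c w \<noteq> 0}"]) (auto simp: finitely_supported_def scale_op_sum)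
  then show ?case
    using c finitely_supported_cmult by metis
qed

lemma word_sum_A_ph_Zplus:
  assumes "finitely_supported c"
  shows "word_sum c \<in> A_ph_Zplus"
  unfolding word_sum_def
proof (intro A_ph_Zplus_sum A_ph_Zplus_scale)
  fix w assume "w \<in> {w. c w \<noteq> 0}"
  then have "0 \<le> fst w" "0 \<le> fst (snd w)"
    using assms unfolding finitely_supported_def by blast+
  then show "word3 w \<in> A_ph_Zplus"
    unfolding word3_def by (rule word_A_ph_Zplus)
qed

text \<open>
  A word of degree \<open>n\<close> moves a translation by \<open>s\<close> to one by \<open>s * exp (- n)\<close>; the phase depends only on
  \<open>s\<close> and on the frequency of the word.
\<close>
lemma word3_translate:
  "blinfun_apply (word3 w) (translate s F) =
     exp (\<i> * of_real (fst w * (s * exp (- real (snd (snd w)))))) *\<^sub>C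
       translate (s * exp (- real (snd (snd w)))) (blinfun_apply (word3 w) F)"
proof -
  let ?s = "s * exp (- real (snd (snd w)))"
  have "blinfun_apply (word3 w) (translate s F) =
      modulate (fst w) (translate ?s (translate (fst (snd w)) (dilate (real (snd (snd w))) F)))"
    by (simp add: word3_def dilate_translate translate_translate add.commute mult.commute)
  then show ?thesis
    by (simp add: modulate_translate word3_def mult.commute)
qed

text \<open>
  Apply the operator to the sum of translates of \<open>F\<close> by \<open>r * exp (- j)\<close> for \<open>j < N\<close>. A word of degree \<open>n\<close>
  moves the translate with index \<open>j\<close> to the index \<open>n + j\<close>, so the terms that arrive at the index \<open>i\<close> are
  those of degrees \<open>i - N < n \<le> i\<close>. For large \<open>r\<close> different indices are orthogonal, and \<open>r\<close> can be chosen
  such that all phases are close to one. The input has squared norm close to \<open>N\<close> times that of \<open>F\<close>.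
\<close>
lemma degree_window_bound:
  assumes c: "finitely_supported c" and L: "\<And>w. c w \<noteq> 0 \<Longrightarrow> snd (snd w) + N \<le> L"
  shows "(\<Sum>i<L. (norm (blinfun_apply (word_sum (degree_part {n. n \<le> i \<and> i < n + N} c)) F))\<^sup>2)
    \<le> real N * (norm (word_sum c))\<^sup>2 * (norm F)\<^sup>2"
proof -
  define W where "W = {w. c w \<noteq> 0}"
  have W: "finite W"
    using c by (simp add: W_def finitely_supported_def)
  define deg where "deg = (\<lambda>w::real \<times> real \<times> nat. snd (snd w))"
  define g where "g = (\<lambda>w. blinfun_apply (word3 w) F)"
  \<comment> \<open>The frequencies of all phases that occur; recurrence makes them tend to one simultaneously.\<close>
  define A where "A = (\<lambda>(w, i). fst w * exp (- real i)) ` (W \<times> {..<L})"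
  have "finite A"
    using W by (simp add: A_def)
  then obtain r where r: "filterlim r at_top sequentially" "\<And>a. a \<in> A \<Longrightarrow> (\<lambda>k. exp (\<i> * of_real (a * r k))) \<longlonglongrightarrow> 1"
    using phase_recurrence by blast
  define ph where "ph = (\<lambda>k (w::real \<times> real \<times> nat) i. exp (\<i> * of_real (fst w * exp (- real i) * r k)))"
  have ph: "(\<lambda>k. ph k w i) \<longlonglongrightarrow> 1" if "w \<in> W" "i < L" for w :: "real \<times> real \<times> nat" and i
    unfolding ph_def using that by (intro r(2)) (auto simp: A_def)
  define H where "H = (\<lambda>i k. \<Sum>w\<in>W. if deg w \<le> i \<and> i < deg w + N then (c w * ph k w i) *\<^sub>C g w else 0)"
  define H0 where "H0 = (\<lambda>i. \<Sum>w\<in>W. if deg w \<le> i \<and> i < deg w + N then c w *\<^sub>C g w else 0)"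
  have H0: "H0 i = blinfun_apply (word_sum (degree_part {n. n \<le> i \<and> i < n + N} c)) F" for i
  proof -
    have "word_sum (degree_part {n. n \<le> i \<and> i < n + N} c) =
        (\<Sum>w\<in>W. scale_op (degree_part {n. n \<le> i \<and> i < n + N} c w) (word3 w))"
      by (rule word_sum_superset[OF W]) (auto simp: W_def degree_part_def split: if_splits)
    then show ?thesis
      by (simp add: H0_def blinfun.sum_left degree_part_def deg_def g_def if_distrib if_distribR cong: if_cong)
  qed
  have HH0: "H i \<longlonglongrightarrow> H0 i" if "i < L" for i
    unfolding H_def H0_def
  proof (intro tendsto_sum)
    fix w assume w: "w \<in> W"
    have "(\<lambda>k. (c w * ph k w i) *\<^sub>C g w) \<longlonglongrightarrow> c w *\<^sub>C g w"
    proof (rule Lim_transform)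
      have "(\<lambda>k. cmod (c w) * cmod (ph k w i - 1) * norm (g w)) \<longlonglongrightarrow> cmod (c w) * cmod (1 - 1) * norm (g w)"
        by (intro tendsto_intros ph w that)
      then have "(\<lambda>k. cmod (c w) * cmod (ph k w i - 1) * norm (g w)) \<longlonglongrightarrow> 0"
        by simp
      moreover have "norm ((c w * ph k w i) *\<^sub>C g w - c w *\<^sub>C g w) = cmod (c w) * cmod (ph k w i - 1) * norm (g w)" for k
        by (simp add: norm_scaleC norm_mult flip: scaleC_diff_left right_diff_distrib[of "c w" _ 1, simplified])
      ultimately show "(\<lambda>k. (c w * ph k w i) *\<^sub>C g w - c w *\<^sub>C g w) \<longlonglongrightarrow> 0"
        by (simp add: tendsto_norm_zero_iff[symmetric, of "\<lambda>k. (c w * ph k w i) *\<^sub>C g w - c w *\<^sub>C g w"])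
    qed (rule tendsto_const)
    then show "(\<lambda>k. if deg w \<le> i \<and> i < deg w + N then (c w * ph k w i) *\<^sub>C g w else 0) \<longlonglongrightarrow>
        (if deg w \<le> i \<and> i < deg w + N then c w *\<^sub>C g w else 0)"
      by (cases "deg w \<le> i \<and> i < deg w + N") (simp_all only: if_True if_False simp_thms tendsto_const)
  qed
  let ?X = "\<lambda>k. \<Sum>j<N. translate (r k * exp (- real j)) F"
  have TX: "blinfun_apply (word_sum c) (?X k) = (\<Sum>i<L. translate (r k * exp (- real i)) (H i k))" for k
  proof -
    define t where "t = (\<lambda>w i. (c w * ph k w i) *\<^sub>C translate (r k * exp (- real i)) (g w))"
    have summand: "c w *\<^sub>C blinfun_apply (word3 w) (translate (r k * exp (- real j)) F) = t w (j + deg w)" for w j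
    proof -
      have e: "exp (- real j) * exp (- real (snd (snd w))) = exp (- real (j + deg w))"
        by (simp add: deg_def flip: exp_add)
      show ?thesis
        unfolding word3_translate mult.assoc e t_def ph_def g_def
        by (simp only: scaleC_scaleC mult.commute[of "exp (- real (j + deg w))" "r k"])
    qed
    have shift: "(\<Sum>j<N. t w (j + deg w)) = (\<Sum>i<L. if deg w \<le> i \<and> i < deg w + N then t w i else 0)" if "w \<in> W" for w
    proof -
      have "(\<Sum>j<N. t w (j + deg w)) = (\<Sum>i\<in>{deg w..<deg w + N}. t w i)"
        by (rule sum.reindex_bij_witness[of _ "\<lambda>i. i - deg w" "\<lambda>j. j + deg w"]) auto
      also have "\<dots> = (\<Sum>i\<in>{i\<in>{..<L}. deg w \<le> i \<and> i < deg w + N}. t w i)"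
        using L[of w] that by (intro sum.cong) (auto simp: W_def deg_def)
      also have "\<dots> = (\<Sum>i<L. if deg w \<le> i \<and> i < deg w + N then t w i else 0)"
        by (rule sum.inter_filter) simp
      finally show ?thesis .
    qed
    have "blinfun_apply (word_sum c) (?X k) = (\<Sum>w\<in>W. \<Sum>j<N. t w (j + deg w))"
      by (simp add: word_sum_def W_def[symmetric] blinfun.sum_left blinfun.sum_right scaleC_sum summand) (rule sum.swap)
    also have "\<dots> = (\<Sum>w\<in>W. \<Sum>i<L. if deg w \<le> i \<and> i < deg w + N then t w i else 0)"
      by (intro sum.cong refl shift)
    also have "\<dots> = (\<Sum>i<L. \<Sum>w\<in>W. if deg w \<le> i \<and> i < deg w + N then t w i else 0)"
      by (rule sum.swap)
    also have "\<dots> = (\<Sum>i<L. translate (r k * exp (- real i)) (H i k))"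
    proof (intro sum.cong refl)
      fix i
      have tr: "translate s (if P then F' else 0) = (if P then translate s F' else 0)" for s P F'
        using linear_0[OF bounded_linear.linear[OF bounded_linear_translate]] by simp
      show "(\<Sum>w\<in>W. if deg w \<le> i \<and> i < deg w + N then t w i else 0) = translate (r k * exp (- real i)) (H i k)"
        unfolding H_def t_def translate_sum tr translate_scaleC ..
    qed
    finally show ?thesis .
  qed
  have lim1: "(\<lambda>k. (norm (blinfun_apply (word_sum c) (?X k)))\<^sup>2) \<longlonglongrightarrow> (\<Sum>i<L. (norm (H0 i))\<^sup>2)"
    unfolding TX by (rule separated_translates_orthogonal[OF HH0 r(1)])
  have "(\<lambda>k. (norm (?X k))\<^sup>2) \<longlonglongrightarrow> (\<Sum>j<N. (norm F)\<^sup>2)"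
    by (rule separated_translates_orthogonal[OF tendsto_const r(1)])
  then have lim2: "(\<lambda>k. (norm (word_sum c))\<^sup>2 * (norm (?X k))\<^sup>2) \<longlonglongrightarrow> (norm (word_sum c))\<^sup>2 * (real N * (norm F)\<^sup>2)"
    by (intro tendsto_intros) simp
  have "(norm (blinfun_apply (word_sum c) (?X k)))\<^sup>2 \<le> (norm (word_sum c))\<^sup>2 * (norm (?X k))\<^sup>2" for k
    using norm_blinfun[of "word_sum c" "?X k"] by (simp add: power_mono flip: power_mult_distrib)
  then have "(\<Sum>i<L. (norm (H0 i))\<^sup>2) \<le> (norm (word_sum c))\<^sup>2 * (real N * (norm F)\<^sup>2)"
    by (intro LIMSEQ_le[OF lim1 lim2]) auto
  then show ?thesis
    by (simp add: H0 mult_ac)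
qed

lemma degree_part_bound:
  assumes c: "finitely_supported c"
  shows "norm (blinfun_apply (word_sum (degree_part {n} c)) F) \<le> norm (word_sum c) * norm F"
proof -
  define W where "W = {w. c w \<noteq> 0}"
  have W: "finite W"
    using c by (simp add: W_def finitely_supported_def)
  define L where "L = Suc (Max (insert n ((\<lambda>w. snd (snd w)) ` W)))"
  have nL: "n < L"
    using W by (simp add: L_def less_Suc_eq_le)
  have "(\<Sum>i<L. (norm (blinfun_apply (word_sum (degree_part {n. n \<le> i \<and> i < n + 1} c)) F))\<^sup>2)
    \<le> real 1 * (norm (word_sum c))\<^sup>2 * (norm F)\<^sup>2"
  proof (rule degree_window_bound[OF c])
    show "snd (snd w) + 1 \<le> L" if "c w \<noteq> 0" for w
      using W that by (auto simp: L_def W_def intro!: Max_ge)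
  qed
  moreover have "(norm (blinfun_apply (word_sum (degree_part {n} c)) F))\<^sup>2 \<le>
      (\<Sum>i<L. (norm (blinfun_apply (word_sum (degree_part {n. n \<le> i \<and> i < n + 1} c)) F))\<^sup>2)"
  proof -
    have "{k. k \<le> n \<and> n < k + 1} = {n}"
      by auto
    then show ?thesis
      using nL member_le_sum[of n "{..<L}" "\<lambda>i. (norm (blinfun_apply (word_sum (degree_part {n. n \<le> i \<and> i < n + 1} c)) F))\<^sup>2"]
      by simp
  qed
  ultimately have "(norm (blinfun_apply (word_sum (degree_part {n} c)) F))\<^sup>2 \<le> (norm (word_sum c) * norm F)\<^sup>2"
    by (simp add: power_mult_distrib)
  then show ?thesis
    by (rule power2_le_imp_le) simp
qed

lemma phase_mean_zero:
  fixes z :: complex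
  assumes "cmod z = 1" "z \<noteq> 1"
  shows "(\<lambda>L. (\<Sum>j<L. z ^ j) / of_nat L) \<longlonglongrightarrow> 0"
proof (rule Lim_null_comparison)
  have "(\<lambda>L. 2 / cmod (1 - z) * inverse (real L)) \<longlonglongrightarrow> 2 / cmod (1 - z) * 0"
    by (intro tendsto_intros LIMSEQ_inverse_real_of_nat_add[where r = 0, simplified] tendsto_inverse_0_at_top filterlim_real_sequentially)
  then show "(\<lambda>L. 2 / cmod (1 - z) * inverse (real L)) \<longlonglongrightarrow> 0"
    by simp
  have "cmod ((\<Sum>j<L. z ^ j) / of_nat L) \<le> 2 / cmod (1 - z) * inverse (real L)" for L
  proof -
    have "(\<Sum>j<L. z ^ j) = (1 - z ^ L) / (1 - z)"
      using assms(2) by (simp add: sum_gp_strict)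
    then have "cmod (\<Sum>j<L. z ^ j) = cmod (1 - z ^ L) / cmod (1 - z)"
      by (simp add: norm_divide)
    also have "\<dots> \<le> 2 / cmod (1 - z)"
      using norm_triangle_ineq4[of 1 "z ^ L"] assms(1) by (intro divide_right_mono) (auto simp: norm_power)
    finally have "cmod (\<Sum>j<L. z ^ j) / real L \<le> 2 / cmod (1 - z) / real L"
      by (intro divide_right_mono) auto
    moreover have "cmod ((\<Sum>j<L. z ^ j) / of_nat L) = cmod (\<Sum>j<L. z ^ j) / real L"
      by (simp add: norm_divide)
    ultimately show ?thesis
      by (simp only: divide_inverse)
  qed
  then show "\<forall>\<^sub>F L in sequentially. cmod ((\<Sum>j<L. z ^ j) / of_nat L) \<le> 2 / cmod (1 - z) * inverse (real L)"
    by simp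
qed

text \<open>
  The off-diagonal terms are geometric sums and average out, provided that \<open>\<tau>\<close> separates the
  frequencies modulo \<open>2 * pi\<close>.
\<close>
lemma phase_mean_square:
  fixes S :: "real set" and G :: "real \<Rightarrow> L2R"
  assumes S: "finite S"
  shows "\<exists>\<tau>. (\<lambda>L. (\<Sum>j<L. (norm (\<Sum>m\<in>S. exp (- (\<i> * of_real (m * \<tau> * real j))) *\<^sub>C G m))\<^sup>2) / real L)
    \<longlonglongrightarrow> (\<Sum>m\<in>S. (norm (G m))\<^sup>2)"
proof -
  define R where "R = 1 + (\<Sum>m\<in>S. \<bar>m\<bar>)"
  have R: "0 < R"
    by (simp add: R_def add_pos_nonneg sum_nonneg)
  have mR: "\<bar>m\<bar> < R" if "m \<in> S" for m
    using member_le_sum[of m S abs] S that by (simp add: R_def)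
  \<comment> \<open>The differences of elements of \<open>S\<close> are below \<open>2 * R\<close>, so \<open>\<tau>\<close> maps them to phases in \<open>(- pi, pi)\<close>.\<close>
  define \<tau> where "\<tau> = pi / (2 * R)"
  define z where "z = (\<lambda>m p. exp (- (\<i> * of_real ((m - p) * \<tau>))))"
  have z1: "cmod (z m p) = 1" for m p
    by (simp add: z_def)
  have zne: "z m p \<noteq> 1" if "m \<in> S" "p \<in> S" "m \<noteq> p" for m p
  proof
    assume "z m p = 1"
    then have "exp (\<i> * of_real ((p - m) * \<tau>)) = 1"
      by (simp add: z_def algebra_simps)
    then obtain k :: int where k: "(p - m) * \<tau> = 2 * of_int k * pi"
      by (auto simp: exp_eq_1)
    then have "(p - m) * pi = (4 * of_int k * R) * pi"
      using R by (simp add: \<tau>_def field_simps)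
    then have "p - m = 4 * of_int k * R"
      by (simp only: mult_cancel_right pi_neq_zero simp_thms)
    moreover have "\<bar>p - m\<bar> < 2 * R"
      using mR[OF that(1)] mR[OF that(2)] by linarith
    moreover have "k \<noteq> 0"
      using k that(3) R by (auto simp: \<tau>_def)
    then have "1 \<le> \<bar>real_of_int k\<bar>"
      by linarith
    then have "4 * R \<le> \<bar>4 * of_int k * R\<bar>"
      using R by (simp add: abs_mult)
    ultimately show False
      using R by linarith
  qed
  define q where "q = (\<lambda>L m p. Re ((\<Sum>j<L. z m p ^ j) / of_nat L * cinner (G m) (G p)))"
  have expand: "(\<Sum>j<L. (norm (\<Sum>m\<in>S. exp (- (\<i> * of_real (m * \<tau> * real j))) *\<^sub>C G m))\<^sup>2) / real L =
      (\<Sum>m\<in>S. \<Sum>p\<in>S. q L m p)" for L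
  proof -
    have pair: "(exp (- (\<i> * of_real (m * \<tau> * real j))) *\<^sub>C G m) \<bullet> (exp (- (\<i> * of_real (p * \<tau> * real j))) *\<^sub>C G p) =
        Re (z m p ^ j * cinner (G m) (G p))" for m p j
    proof -
      let ?a = "exp (- (\<i> * of_real (m * \<tau> * real j)))" and ?b = "exp (- (\<i> * of_real (p * \<tau> * real j)))"
      have "?a * cnj ?b = z m p ^ j"
        by (simp add: z_def exp_cnj algebra_simps flip: exp_add exp_of_nat_mult)
      moreover have "cinner (?a *\<^sub>C G m) (?b *\<^sub>C G p) = ?a * cnj ?b * cinner (G m) (G p)"
        by (simp only: cinner_scaleC_left cinner_scaleC_right mult_ac)
      ultimately show ?thesis
        by (metis Re_cinner)
    qed
    have "(norm (\<Sum>m\<in>S. exp (- (\<i> * of_real (m * \<tau> * real j))) *\<^sub>C G m))\<^sup>2 =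
        (\<Sum>m\<in>S. \<Sum>p\<in>S. Re (z m p ^ j * cinner (G m) (G p)))" for j
      unfolding power2_norm_eq_inner inner_sum_left inner_sum_right pair by (rule sum.swap)
    then have "(\<Sum>j<L. (norm (\<Sum>m\<in>S. exp (- (\<i> * of_real (m * \<tau> * real j))) *\<^sub>C G m))\<^sup>2) =
        (\<Sum>j<L. \<Sum>m\<in>S. \<Sum>p\<in>S. Re (z m p ^ j * cinner (G m) (G p)))"
      by simp
    also have "\<dots> = (\<Sum>m\<in>S. \<Sum>j<L. \<Sum>p\<in>S. Re (z m p ^ j * cinner (G m) (G p)))"
      by (rule sum.swap)
    also have "\<dots> = (\<Sum>m\<in>S. \<Sum>p\<in>S. \<Sum>j<L. Re (z m p ^ j * cinner (G m) (G p)))"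
      by (intro sum.cong refl sum.swap)
    finally have "(\<Sum>j<L. (norm (\<Sum>m\<in>S. exp (- (\<i> * of_real (m * \<tau> * real j))) *\<^sub>C G m))\<^sup>2) / real L =
        (\<Sum>m\<in>S. \<Sum>p\<in>S. \<Sum>j<L. Re (z m p ^ j * cinner (G m) (G p))) / real L"
      by (rule arg_cong)
    also have "(\<Sum>m\<in>S. \<Sum>p\<in>S. \<Sum>j<L. Re (z m p ^ j * cinner (G m) (G p))) / real L = (\<Sum>m\<in>S. \<Sum>p\<in>S. q L m p)"
    proof -
      have "(\<Sum>j<L. z m p ^ j) / of_nat L * cinner (G m) (G p) = (\<Sum>j<L. z m p ^ j * cinner (G m) (G p)) / of_nat L" for m p
        by (simp add: sum_distrib_right)
      then have "q L m p = (\<Sum>j<L. Re (z m p ^ j * cinner (G m) (G p))) / real L" for m p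
        by (simp only: q_def Re_divide_of_nat Re_sum)
      then show ?thesis
        by (simp only: sum_divide_distrib)
    qed
    finally show ?thesis .
  qed
  have "(\<lambda>L. \<Sum>m\<in>S. \<Sum>p\<in>S. q L m p) \<longlonglongrightarrow> (\<Sum>m\<in>S. \<Sum>p\<in>S. if p = m then (norm (G m))\<^sup>2 else 0)"
  proof (intro tendsto_sum)
    fix m p assume mp: "m \<in> S" "p \<in> S"
    show "(\<lambda>L. q L m p) \<longlonglongrightarrow> (if p = m then (norm (G m))\<^sup>2 else 0)"
    proof (cases "p = m")
      case True
      have "\<forall>\<^sub>F L in sequentially. q L m p = (norm (G m))\<^sup>2"
        using eventually_gt_at_top[of 0]
        by eventually_elim (simp add: q_def True z_def power2_norm_eq_inner)
      then show ?thesis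
        using True by (simp add: tendsto_eventually)
    next
      case False
      have "(\<lambda>L. Re ((\<Sum>j<L. z m p ^ j) / of_nat L * cinner (G m) (G p))) \<longlonglongrightarrow> Re (0 * cinner (G m) (G p))"
        using mp False by (intro tendsto_intros phase_mean_zero z1 zne) auto
      then show ?thesis
        using False by (simp add: q_def)
    qed
  qed
  also have "(\<Sum>m\<in>S. \<Sum>p\<in>S. if p = m then (norm (G m))\<^sup>2 else 0) = (\<Sum>m\<in>S. (norm (G m))\<^sup>2)"
    using S by simp
  finally show ?thesis
    unfolding expand[symmetric] by blast
qed

section \<open>Operators are determined by their entries\<close>

text \<open>
  Modulating the input by \<open>exp (- n) * s\<close> multiplies the part with translation \<open>m\<close> by the phase
  \<open>exp (- \<i> m s)\<close>, up to a common unitary. The vectors \<open>G m\<close> are translates of one vector, multiplied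
  by entries, so the Bessel inequality bounds the sum of their squared norms in terms of the distance
  to any \<open>R\<close> with vanishing entries of this degree.
\<close>
lemma degree_part_modulated:
  assumes c: "finitely_supported c"
  shows "\<exists>S G. finite S \<and>
    (\<forall>s. norm (blinfun_apply (word_sum (degree_part {n} c)) (modulate (exp (- real n) * s) F)) =
       norm (\<Sum>m\<in>S. exp (- (\<i> * of_real (m * s))) *\<^sub>C G m)) \<and>
    (\<forall>R\<in>A_ph_Zplus. (\<forall>m y. entry R m n y = 0) \<longrightarrow>
       (\<Sum>m\<in>S. (norm (G m))\<^sup>2) \<le> (norm (word_sum c - R))\<^sup>2 * (norm F)\<^sup>2)"
proof -
  define W where "W = {w. c w \<noteq> 0 \<and> snd (snd w) = n}"
  have W: "finite W"
    using c by (auto simp: W_def finitely_supported_def elim!: finite_subset[rotated])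
  define S where "S = (\<lambda>w. fst (snd w)) ` W"
  have S: "finite S"
    using W by (simp add: S_def)
  \<comment> \<open>\<open>\<phi> m\<close> collects the words of degree \<open>n\<close> with translation \<open>m\<close> and turns out to be the entry of the word sum.\<close>
  define g where "g = dilate (real n) F"
  define \<phi> where "\<phi> = (\<lambda>m y. \<Sum>w\<in>{w\<in>W. fst (snd w) = m}. c w * exp (\<i> * of_real (fst w) * of_real y))"
  define G where "G = (\<lambda>m. multiply (\<phi> m) (translate m g))"
  have \<phi>sum: "admissible (\<phi> m) \<and> multiply (\<phi> m) H =
      (\<Sum>w\<in>{w\<in>W. fst (snd w) = m}. multiply (\<lambda>y. c w * exp (\<i> * of_real (fst w) * of_real y)) H)" for m H
    unfolding \<phi>_def by (rule multiply_sum[OF _ admissible_exp_term]) (use W in simp)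
  then have \<phi>: "admissible (\<phi> m)" for m
    by blast
  have multiply_\<phi>: "multiply (\<phi> m) H = (\<Sum>w\<in>{w\<in>W. fst (snd w) = m}. c w *\<^sub>C modulate (fst w) H)" for m H
  proof -
    have "multiply (\<phi> m) H = (\<Sum>w\<in>{w\<in>W. fst (snd w) = m}. multiply (\<lambda>y. c w * exp (\<i> * of_real (fst w) * of_real y)) H)"
      using \<phi>sum by blast
    then show ?thesis
      unfolding multiply_multiply[OF admissible_const admissible_exp, symmetric] multiply_exp multiply_const .
  qed
  have sum_W: "word_sum (degree_part {n} c) = (\<Sum>w\<in>W. scale_op (c w) (word3 w))"
  proof -
    have "word_sum (degree_part {n} c) = (\<Sum>w\<in>W. scale_op (degree_part {n} c w) (word3 w))"
      by (rule word_sum_superset[OF W]) (auto simp: W_def degree_part_def split: if_splits)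
    also have "\<dots> = (\<Sum>w\<in>W. scale_op (c w) (word3 w))"
      by (intro sum.cong refl) (simp add: W_def degree_part_def)
    finally show ?thesis .
  qed
  have app: "blinfun_apply (word_sum (degree_part {n} c)) H = (\<Sum>m\<in>S. multiply (\<phi> m) (translate m (dilate (real n) H)))" for H
  proof -
    have "blinfun_apply (word_sum (degree_part {n} c)) H =
        (\<Sum>w\<in>W. c w *\<^sub>C modulate (fst w) (translate (fst (snd w)) (dilate (real n) H)))"
      unfolding sum_W blinfun.sum_left by (intro sum.cong refl) (simp add: word3_def W_def)
    also have "\<dots> = (\<Sum>m\<in>S. \<Sum>w\<in>{w\<in>W. fst (snd w) = m}. c w *\<^sub>C modulate (fst w) (translate (fst (snd w)) (dilate (real n) H)))"
      by (rule sum.group[symmetric, OF W S]) (simp add: S_def)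
    also have "\<dots> = (\<Sum>m\<in>S. multiply (\<phi> m) (translate m (dilate (real n) H)))"
      unfolding multiply_\<phi> by (intro sum.cong refl) simp
    finally show ?thesis .
  qed
  have norms: "norm (blinfun_apply (word_sum (degree_part {n} c)) (modulate (exp (- real n) * s) F)) =
       norm (\<Sum>m\<in>S. exp (- (\<i> * of_real (m * s))) *\<^sub>C G m)" for s
  proof -
    have "multiply (\<phi> m) (translate m (dilate (real n) (modulate (exp (- real n) * s) F))) =
        modulate s (exp (- (\<i> * of_real (m * s))) *\<^sub>C G m)" for m
    proof -
      have "dilate (real n) (modulate (exp (- real n) * s) F) = modulate s g"
        by (simp add: dilate_modulate g_def mult.assoc[symmetric] flip: exp_add)
      then have "multiply (\<phi> m) (translate m (dilate (real n) (modulate (exp (- real n) * s) F))) =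
          exp (- (\<i> * of_real (s * m))) *\<^sub>C multiply (\<phi> m) (modulate s (translate m g))"
        by (simp add: translate_modulate multiply_scaleC)
      also have "multiply (\<phi> m) (modulate s (translate m g)) = modulate s (G m)"
        unfolding G_def multiply_exp[symmetric] multiply_multiply[OF \<phi> admissible_exp]
          multiply_multiply[OF admissible_exp \<phi>] by (simp add: mult.commute)
      finally show ?thesis
        by (simp add: modulate_scaleC mult.commute)
    qed
    then have "blinfun_apply (word_sum (degree_part {n} c)) (modulate (exp (- real n) * s) F) =
        modulate s (\<Sum>m\<in>S. exp (- (\<i> * of_real (m * s))) *\<^sub>C G m)"
      unfolding app by (simp add: linear_sum[OF bounded_linear.linear[OF bounded_linear_modulate]])
    then show ?thesis
      by (simp add: norm_modulate)
  qed
  have entry_\<phi>: "entry (word_sum c) m n y = \<phi> m y" for m y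
  proof -
    define f where "f = (\<lambda>T. entry T m n y)"
    have f: "A_functional f"
      unfolding f_def by (rule A_functional_entry)
    have fsum: "f (\<Sum>i\<in>I. scale_op (a i) (T i)) = (\<Sum>i\<in>I. a i * f (T i))"
      if "finite I" "\<And>i. i \<in> I \<Longrightarrow> T i \<in> A_ph_Zplus" for I a and T :: "'z \<Rightarrow> _"
      using that
    proof (induction I rule: finite_induct)
      case empty
      have "f (scale_op 0 0) = 0 * f 0"
        using f A_ph_Zplus_zero unfolding A_functional_def by blast
      then show ?case by simp
    next
      case (insert i I)
      then have "f (scale_op (a i) (T i) + (\<Sum>i\<in>I. scale_op (a i) (T i))) =
          f (scale_op (a i) (T i)) + f (\<Sum>i\<in>I. scale_op (a i) (T i))"
        unfolding f_def by (intro entry_add A_ph_Zplus_scale A_ph_Zplus_sum) auto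
      moreover have "f (scale_op (a i) (T i)) = a i * f (T i)"
        unfolding f_def using insert by (intro entry_scale) simp
      ultimately show ?case
        using insert by simp
    qed
    let ?V = "{w. c w \<noteq> 0}"
    have V: "finite ?V"
      using c by (simp add: finitely_supported_def)
    have word3_A: "word3 w \<in> A_ph_Zplus" if "w \<in> ?V" for w
      using c that unfolding finitely_supported_def word3_def by (intro word_A_ph_Zplus) blast+
    have "f (word_sum c) = (\<Sum>w\<in>?V. c w * f (word3 w))"
      unfolding word_sum_def by (rule fsum[OF V word3_A])
    also have "\<dots> = (\<Sum>w\<in>?V. if fst (snd w) = m \<and> snd (snd w) = n then c w * exp (\<i> * of_real (fst w) * of_real y) else 0)"
      by (intro sum.cong refl) (simp add: f_def word3_def entry_word)
    also have "\<dots> = (\<Sum>w\<in>{w\<in>?V. fst (snd w) = m \<and> snd (snd w) = n}. c w * exp (\<i> * of_real (fst w) * of_real y))"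
      by (rule sum.inter_filter[symmetric, OF V])
    also have "{w\<in>?V. fst (snd w) = m \<and> snd (snd w) = n} = {w\<in>W. fst (snd w) = m}"
      by (auto simp: W_def)
    finally show ?thesis
      by (simp add: f_def \<phi>_def)
  qed
  have "(\<Sum>m\<in>S. (norm (G m))\<^sup>2) \<le> (norm (word_sum c - R))\<^sup>2 * (norm F)\<^sup>2"
    if R: "R \<in> A_ph_Zplus" "\<And>m y. entry R m n y = 0" for R
  proof -
    have \<phi>a: "admissible (\<lambda>x. \<phi> m (x - - m))" for m
      using admissible_affine[OF \<phi>, of m 1 m] by simp
    have "norm (G m) = norm (multiply (\<lambda>x. \<phi> m (x - - m)) g)" for m
    proof -
      have "translate (- m) (G m) = multiply (\<lambda>x. \<phi> m (x - - m)) g"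
        unfolding G_def translate_multiply[OF \<phi>] by (simp add: translate_translate)
      then show ?thesis
        by (metis norm_translate)
    qed
    then have "(\<Sum>m\<in>S. (norm (G m))\<^sup>2) = (\<Sum>m\<in>S. (norm (multiply (\<lambda>x. \<phi> m (x - - m)) g))\<^sup>2)"
      by simp
    also have "\<dots> \<le> (norm (word_sum c - R))\<^sup>2 * (norm g)\<^sup>2"
    proof (rule sum_norm_multiply_le[OF S \<phi>a])
      fix x :: real
      have "(\<Sum>(m, k)\<in>S \<times> {n}. (cmod (entry (word_sum c - R) m k (m + exp (- real k) * (exp (real n) * x))))\<^sup>2)
          \<le> (norm (word_sum c - R))\<^sup>2"
        using S by (intro entry_bessel A_ph_Zplus_diff word_sum_A_ph_Zplus c R) auto
      moreover have "(\<Sum>(m, k)\<in>S \<times> {n}. (cmod (entry (word_sum c - R) m k (m + exp (- real k) * (exp (real n) * x))))\<^sup>2) =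
          (\<Sum>m\<in>S. (cmod (\<phi> m (x - - m)))\<^sup>2)"
        unfolding sum.cartesian_product[symmetric]
        by (simp add: entry_diff word_sum_A_ph_Zplus c R entry_\<phi> mult.assoc[symmetric] add.commute flip: exp_add)
      ultimately show "(\<Sum>m\<in>S. (cmod (\<phi> m (x - - m)))\<^sup>2) \<le> (norm (word_sum c - R))\<^sup>2"
        by simp
    qed
    finally show ?thesis
      by (simp add: g_def norm_dilate)
  qed
  with S norms show ?thesis
    by (intro exI[of _ S] exI[of _ G]) auto
qed

text \<open>
  The squared norm of the part of degree \<open>n\<close> on the modulated vector has a small mean over the modulation
  parameter \<open>s\<close>, by \<open>phase_mean_square\<close> and \<open>degree_part_modulated\<close>. As a function of \<open>s\<close> it is
  uniformly close to the one for a fixed index \<open>K\<close>, which returns to its value at \<open>s = 0\<close> with a density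
  independent of \<open>k\<close>. So the value at \<open>s = 0\<close> is small as well.
\<close>
lemma degree_part_tendsto_0:
  assumes c: "\<And>k. finitely_supported (c k)" and lim: "(\<lambda>k. word_sum (c k)) \<longlonglongrightarrow> R"
    and R: "R \<in> A_ph_Zplus" "\<And>m y. entry R m n y = 0"
  shows "(\<lambda>k. blinfun_apply (word_sum (degree_part {n} (c k))) F) \<longlonglongrightarrow> 0"
proof -
  let ?P = "\<lambda>k s. norm (blinfun_apply (word_sum (degree_part {n} (c k))) (modulate (exp (- real n) * s) F))"
  define Q where "Q = (\<lambda>k SG. finite (fst SG) \<and>
    (\<forall>s. ?P k s = norm (\<Sum>m\<in>fst SG. exp (- (\<i> * of_real (m * s))) *\<^sub>C snd SG m)) \<and>
    (\<Sum>m\<in>fst SG. (norm (snd SG m))\<^sup>2) \<le> (norm (word_sum (c k) - R))\<^sup>2 * (norm F)\<^sup>2)"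
  have "\<forall>k. \<exists>SG. Q k SG"
  proof
    fix k
    obtain S G where *: "finite S" "\<forall>s. ?P k s = norm (\<Sum>m\<in>S. exp (- (\<i> * of_real (m * s))) *\<^sub>C G m)"
      "\<forall>R\<in>A_ph_Zplus. (\<forall>m y. entry R m n y = 0) \<longrightarrow>
         (\<Sum>m\<in>S. (norm (G m))\<^sup>2) \<le> (norm (word_sum (c k) - R))\<^sup>2 * (norm F)\<^sup>2"
      using degree_part_modulated[OF c[of k], of n F] by (elim exE conjE) (rule that)
    then show "\<exists>SG. Q k SG"
      using R unfolding Q_def by (intro exI[of _ "(S, G)"]) simp
  qed
  then obtain h where h: "\<forall>k. Q k (h k)"
    by (rule choice[THEN exE])
  define S where "S = (\<lambda>k. fst (h k))"
  define G where "G = (\<lambda>k. snd (h k))"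
  have S: "finite (S k)"
    and P: "?P k s = norm (\<Sum>m\<in>S k. exp (- (\<i> * of_real (m * s))) *\<^sub>C G k m)"
    and G: "(\<Sum>m\<in>S k. (norm (G k m))\<^sup>2) \<le> (norm (word_sum (c k) - R))\<^sup>2 * (norm F)\<^sup>2" for k s
    using h unfolding Q_def S_def G_def by blast+
  have close: "\<bar>?P k s - ?P l s\<bar> \<le> norm (word_sum (c k) - word_sum (c l)) * norm F" for k l s
  proof -
    let ?H = "modulate (exp (- real n) * s) F"
    have "degree_part {n} (\<lambda>w. c k w - c l w) = (\<lambda>w. degree_part {n} (c k) w - degree_part {n} (c l) w)"
      by (auto simp: fun_eq_iff degree_part_def)
    then have "word_sum (degree_part {n} (\<lambda>w. c k w - c l w)) = word_sum (degree_part {n} (c k)) - word_sum (degree_part {n} (c l))"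
      by (simp add: word_sum_diff finitely_supported_degree_part c)
    moreover have "norm (blinfun_apply (word_sum (degree_part {n} (\<lambda>w. c k w - c l w))) ?H) \<le>
        norm (word_sum (\<lambda>w. c k w - c l w)) * norm ?H"
      by (intro degree_part_bound finitely_supported_diff c)
    ultimately have "norm (blinfun_apply (word_sum (degree_part {n} (c k))) ?H - blinfun_apply (word_sum (degree_part {n} (c l))) ?H)
        \<le> norm (word_sum (c k) - word_sum (c l)) * norm F"
      by (simp add: word_sum_diff c blinfun.diff_left norm_modulate)
    then show ?thesis
      using norm_triangle_ineq3 order_trans by blast
  qed
  have main: "\<forall>\<^sub>F k in sequentially. ?P k 0 < 5 * e" if e: "0 < e" for e
  proof -
    have "Cauchy (\<lambda>k. word_sum (c k))"
      using lim by (rule LIMSEQ_imp_Cauchy)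
    moreover have "0 < e / (norm F + 1)"
      using e by (simp add: add_nonneg_pos)
    ultimately obtain K where K: "\<And>k l. k \<ge> K \<Longrightarrow> l \<ge> K \<Longrightarrow> norm (word_sum (c k) - word_sum (c l)) < e / (norm F + 1)"
      unfolding Cauchy_iff by metis
    have near: "\<bar>?P k s - ?P K s\<bar> \<le> e" if "k \<ge> K" for k s
    proof -
      have "norm (word_sum (c k) - word_sum (c K)) * norm F \<le> e / (norm F + 1) * (norm F + 1)"
        using less_imp_le[OF K[OF that order_refl]] less_imp_le[OF \<open>0 < e / (norm F + 1)\<close>]
        by (intro mult_mono) (assumption | simp only: norm_ge_zero | simp)+
      also have "\<dots> = e"
        using norm_ge_zero[of F] by (simp add: add_nonneg_eq_0_iff)
      finally show ?thesis
        using close[of k s K] by linarith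
    qed
    \<comment> \<open>With this \<open>q\<close>, phases within \<open>e / q\<close> of one change the norm for the index \<open>K\<close> by at most \<open>e\<close>.\<close>
    define q where "q = (\<Sum>m\<in>S K. norm (G K m)) + 1"
    have q: "0 < q"
      by (simp add: q_def add_nonneg_pos sum_nonneg)
    obtain B where B: "0 < B" "\<And>\<tau> L. real L \<le> B * real (card {k\<in>{..<L}. \<forall>a\<in>S K. cmod (exp (\<i> * of_real (a * \<tau> * real k)) - 1) \<le> e / q})"
      using phase_recurrence_density[OF S[of K], of "e / q"] e q by auto
    have recur: "?P K 0 - e \<le> ?P K s" if "\<forall>a\<in>S K. cmod (exp (\<i> * of_real (a * s)) - 1) \<le> e / q" for s
    proof -
      have ph: "cmod (exp (- (\<i> * of_real (a * s))) - 1) \<le> e / q" if "a \<in> S K" for a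
      proof -
        have "exp (- (\<i> * of_real (a * s))) - 1 = cnj (exp (\<i> * of_real (a * s)) - 1)"
          by (simp add: exp_cnj)
        then show ?thesis
          using \<open>\<forall>a\<in>S K. cmod (exp (\<i> * of_real (a * s)) - 1) \<le> e / q\<close> that by (metis complex_mod_cnj)
      qed
      have "norm ((\<Sum>m\<in>S K. exp (- (\<i> * of_real (m * s))) *\<^sub>C G K m) - (\<Sum>m\<in>S K. exp (- (\<i> * of_real (m * 0))) *\<^sub>C G K m)) =
          norm (\<Sum>m\<in>S K. (exp (- (\<i> * of_real (m * s))) - 1) *\<^sub>C G K m)"
        by (simp add: sum_subtractf[symmetric] scaleC_diff_left)
      also have "\<dots> \<le> (\<Sum>m\<in>S K. e / q * norm (G K m))"
      proof (intro order_trans[OF norm_sum] sum_mono)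
        fix m assume m: "m \<in> S K"
        show "norm ((exp (- (\<i> * of_real (m * s))) - 1) *\<^sub>C G K m) \<le> e / q * norm (G K m)"
          unfolding norm_scaleC by (rule mult_right_mono[OF ph[OF m] norm_ge_zero])
      qed
      also have "\<dots> = e / q * (\<Sum>m\<in>S K. norm (G K m))"
        by (rule sum_distrib_left[symmetric])
      also have "\<dots> \<le> e / q * q"
        by (rule mult_left_mono) (use e q in \<open>simp_all add: q_def\<close>)
      also have "\<dots> = e"
        using q by simp
      finally show ?thesis
        unfolding P using norm_triangle_ineq2[of "\<Sum>m\<in>S K. exp (- (\<i> * of_real (m * 0))) *\<^sub>C G K m"
            "\<Sum>m\<in>S K. exp (- (\<i> * of_real (m * s))) *\<^sub>C G K m"]
        by (simp add: norm_minus_commute)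
    qed
    have bound: "(max 0 (?P k 0 - 3 * e))\<^sup>2 \<le> B * ((norm (word_sum (c k) - R))\<^sup>2 * (norm F)\<^sup>2)" if k: "k \<ge> K" for k
    proof -
      obtain \<tau> where \<tau>: "(\<lambda>L. (\<Sum>j<L. (norm (\<Sum>m\<in>S k. exp (- (\<i> * of_real (m * \<tau> * real j))) *\<^sub>C G k m))\<^sup>2) / real L)
          \<longlonglongrightarrow> (\<Sum>m\<in>S k. (norm (G k m))\<^sup>2)"
        using phase_mean_square[OF S[of k], of "G k"] by blast
      define x where "x = (max 0 (?P k 0 - 3 * e))\<^sup>2"
      have low: "x / B \<le> (\<Sum>j<L. (?P k (\<tau> * real j))\<^sup>2) / real L" if L: "0 < L" for L
      proof -
        define J where "J = {j\<in>{..<L}. \<forall>a\<in>S K. cmod (exp (\<i> * of_real (a * \<tau> * real j)) - 1) \<le> e / q}"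
        have "x \<le> (?P k (\<tau> * real j))\<^sup>2" if "j \<in> J" for j
          unfolding x_def
        proof (rule power_mono)
          have "?P K 0 - e \<le> ?P K (\<tau> * real j)"
            using that by (intro recur) (simp add: J_def mult.assoc)
          then show "max 0 (?P k 0 - 3 * e) \<le> ?P k (\<tau> * real j)"
            using near[OF k, of 0] near[OF k, of "\<tau> * real j"] by (simp add: abs_le_iff)
        qed simp
        then have "real (card J) * x \<le> (\<Sum>j\<in>J. (?P k (\<tau> * real j))\<^sup>2)"
          using sum_bounded_below[of J x "\<lambda>j. (?P k (\<tau> * real j))\<^sup>2"] by simp
        also have "\<dots> \<le> (\<Sum>j<L. (?P k (\<tau> * real j))\<^sup>2)"
          by (intro sum_mono2) (auto simp: J_def)
        finally have 1: "real (card J) * x \<le> (\<Sum>j<L. (?P k (\<tau> * real j))\<^sup>2)" .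
        have "real L / B \<le> real (card J)"
          using B(2)[of L \<tau>] B(1) by (simp add: J_def divide_le_eq mult.commute)
        then have "real L / B * x \<le> real (card J) * x"
          by (intro mult_right_mono) (simp_all add: x_def)
        with 1 have "real L / B * x \<le> (\<Sum>j<L. (?P k (\<tau> * real j))\<^sup>2)"
          by linarith
        then show ?thesis
          using L by (simp add: le_divide_eq mult_ac)
      qed
      have "x / B \<le> (\<Sum>m\<in>S k. (norm (G k m))\<^sup>2)"
      proof (rule tendsto_lowerbound[OF \<tau>])
        have "\<forall>\<^sub>F L in sequentially. x / B \<le> (\<Sum>j<L. (?P k (\<tau> * real j))\<^sup>2) / real L"
          using eventually_gt_at_top[of 0] by eventually_elim (rule low)
        then show "\<forall>\<^sub>F L in sequentially. x / B \<le> (\<Sum>j<L. (norm (\<Sum>m\<in>S k. exp (- (\<i> * of_real (m * \<tau> * real j))) *\<^sub>C G k m))\<^sup>2) / real L"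
          unfolding P by (simp add: mult.assoc)
      qed simp
      then have "x / B \<le> (norm (word_sum (c k) - R))\<^sup>2 * (norm F)\<^sup>2"
        using G[of k] by linarith
      then show ?thesis
        using B(1) by (simp add: x_def divide_le_eq mult.commute)
    qed
    have "(\<lambda>k. B * ((norm (word_sum (c k) - R))\<^sup>2 * (norm F)\<^sup>2)) \<longlonglongrightarrow> B * ((norm (R - R))\<^sup>2 * (norm F)\<^sup>2)"
      by (intro tendsto_intros lim)
    then have "\<forall>\<^sub>F k in sequentially. B * ((norm (word_sum (c k) - R))\<^sup>2 * (norm F)\<^sup>2) < e\<^sup>2"
      using e by (intro order_tendstoD(2)) auto
    then show ?thesis
      using eventually_ge_at_top[of K]
    proof eventually_elim
      case (elim k)
      then have "(max 0 (?P k 0 - 3 * e))\<^sup>2 < e\<^sup>2"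
        using bound[OF elim(2)] by linarith
      then have "max 0 (?P k 0 - 3 * e) < e"
        by (rule power2_less_imp_less) (rule less_imp_le[OF e])
      moreover have "?P k 0 - 3 * e \<le> max 0 (?P k 0 - 3 * e)"
        by (rule max.cobounded2)
      ultimately show ?case
        using e by linarith
    qed
  qed
  show ?thesis
  proof (rule tendsto_norm_zero_cancel, rule tendstoI)
    fix e :: real assume "0 < e"
    then show "\<forall>\<^sub>F k in sequentially. dist (norm (blinfun_apply (word_sum (degree_part {n} (c k))) F)) 0 < e"
      using main[of "e / 5"] by simp
  qed
qed

lemma word_sum_degree_le:
  assumes "finitely_supported c"
  shows "word_sum (degree_part {..i} c) = (\<Sum>n\<le>i. word_sum (degree_part {n} c))"
proof (induction i)
  case 0
  have "{..0::nat} = {0}" by auto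
  then show ?case by simp
next
  case (Suc i)
  have "degree_part {..Suc i} c = (\<lambda>w. degree_part {..i} c w + degree_part {Suc i} c w)"
    by (auto simp: fun_eq_iff degree_part_def)
  then show ?case
    using Suc by (simp add: word_sum_add finitely_supported_degree_part assms)
qed

text \<open>
  Let word sums \<open>c k\<close> approximate \<open>R\<close>, and let \<open>c K\<close> be one of them, of degree below \<open>D\<close>. For \<open>i\<close>
  between \<open>D\<close> and \<open>N\<close>, the window of degrees at \<open>i\<close> of the difference of \<open>c k\<close> and \<open>c K\<close> is a partial sum of
  \<open>c k\<close> minus all of \<open>c K\<close>. As \<open>k\<close> grows, the partial sums tend to zero degree by degree by
  \<open>degree_part_tendsto_0\<close>, and \<open>degree_window_bound\<close> becomes \<open>N - D\<close> copies of one bound on \<open>c K\<close>, against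
  \<open>N\<close> on the right. Averaging over the cut-off \<open>i\<close> plays the role that Fejer means play for Fourier series.
\<close>
lemma A_ph_Zplus_entry_zero:
  assumes R: "R \<in> A_ph_Zplus" and zero: "\<And>m n y. entry R m n y = 0"
  shows "R = 0"
proof -
  have "\<exists>c. finitely_supported c \<and> norm (word_sum c - R) < inverse (real (Suc k))" for k
  proof -
    obtain S where "S \<in> words" "norm (R - S) < inverse (real (Suc k))"
      using A_ph_Zplus_approx[OF R, of "inverse (real (Suc k))"] by auto
    then show ?thesis
      using words_word_sum[of S] by (metis norm_minus_commute)
  qed
  then obtain c where c: "\<And>k. finitely_supported (c k)"
      and cR: "\<And>k. norm (word_sum (c k) - R) < inverse (real (Suc k))"
    by metis
  have lim: "(\<lambda>k. word_sum (c k)) \<longlonglongrightarrow> R"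
  proof -
    have "(\<lambda>k. word_sum (c k) - R) \<longlonglongrightarrow> 0"
      by (rule Lim_null_comparison[OF always_eventually LIMSEQ_inverse_real_of_nat]) (use cR less_imp_le in blast)
    then show ?thesis
      by (simp add: LIM_zero_iff)
  qed
  have small: "norm (blinfun_apply R F) \<le> 3 * e * norm F" if e: "0 < e" for e F
  proof -
    have "\<forall>\<^sub>F k in sequentially. norm (word_sum (c k) - R) < e / 2"
      using tendstoD[OF lim, of "e / 2"] e by (simp add: dist_norm)
    then obtain K where K: "\<And>k. k \<ge> K \<Longrightarrow> norm (word_sum (c k) - R) < e / 2"
      by (auto simp: eventually_sequentially)
    let ?T = "word_sum (c K)"
    define W where "W = {w. c K w \<noteq> 0}"
    have W: "finite W"
      using c by (simp add: W_def finitely_supported_def)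
    define D where "D = (\<Sum>w\<in>W. Suc (snd (snd w)))"
    have D: "snd (snd w) < D" if "w \<in> W" for w
      using member_le_sum[of w W "\<lambda>w. Suc (snd (snd w))"] W that by (simp add: D_def)
    \<comment> \<open>With this \<open>N\<close> the window contains \<open>D + 2\<close> values of \<open>i\<close>, half of \<open>N\<close> or more.\<close>
    define N where "N = 2 * D + 2"
    have window: "(\<Sum>i\<in>{D..<N}. (norm ((\<Sum>n\<le>i. blinfun_apply (word_sum (degree_part {n} (c k))) F) - blinfun_apply ?T F))\<^sup>2)
        \<le> real N * e\<^sup>2 * (norm F)\<^sup>2" if k: "k \<ge> K" for k
    proof -
      define d where "d = (\<lambda>w. c k w - c K w)"
      have d: "finitely_supported d"
        unfolding d_def by (intro finitely_supported_diff c)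
      define V where "V = {w. d w \<noteq> 0}"
      have V: "finite V"
        using d by (simp add: V_def finitely_supported_def)
      define L where "L = N + (\<Sum>w\<in>V. snd (snd w))"
      have "(\<Sum>i<L. (norm (blinfun_apply (word_sum (degree_part {n. n \<le> i \<and> i < n + N} d)) F))\<^sup>2)
          \<le> real N * (norm (word_sum d))\<^sup>2 * (norm F)\<^sup>2"
      proof (rule degree_window_bound[OF d])
        show "snd (snd w) + N \<le> L" if "d w \<noteq> 0" for w
          using member_le_sum[of w V "\<lambda>w. snd (snd w)"] V that by (simp add: L_def V_def)
      qed
      also have "\<dots> \<le> real N * e\<^sup>2 * (norm F)\<^sup>2"
      proof (intro mult_right_mono mult_left_mono power_mono)
        have "norm (word_sum d) \<le> norm (word_sum (c k) - R) + norm (word_sum (c K) - R)"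
          using norm_triangle_ineq4[of "word_sum (c k) - R" "word_sum (c K) - R"] by (simp add: d_def word_sum_diff c)
        then show "norm (word_sum d) \<le> e"
          using K[OF k] K[of K] by simp
      qed auto
      finally have A: "(\<Sum>i<L. (norm (blinfun_apply (word_sum (degree_part {n. n \<le> i \<and> i < n + N} d)) F))\<^sup>2)
          \<le> real N * e\<^sup>2 * (norm F)\<^sup>2" .
      have eq: "word_sum (degree_part {n. n \<le> i \<and> i < n + N} d) = (\<Sum>n\<le>i. word_sum (degree_part {n} (c k))) - ?T"
        if i: "i \<in> {D..<N}" for i
      proof -
        have "degree_part {n. n \<le> i \<and> i < n + N} d = (\<lambda>w. degree_part {..i} (c k) w - c K w)"
        proof
          fix w
          have "c K w = 0" if "\<not> snd (snd w) \<le> i"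
            using D[of w] i that by (fastforce simp: W_def)
          then show "degree_part {n. n \<le> i \<and> i < n + N} d w = degree_part {..i} (c k) w - c K w"
            using i by (auto simp: degree_part_def d_def)
        qed
        then show ?thesis
          using word_sum_degree_le[OF c[of k], of i]
          by (simp add: word_sum_diff finitely_supported_degree_part c)
      qed
      have "(\<Sum>i\<in>{D..<N}. (norm ((\<Sum>n\<le>i. blinfun_apply (word_sum (degree_part {n} (c k))) F) - blinfun_apply ?T F))\<^sup>2) =
          (\<Sum>i\<in>{D..<N}. (norm (blinfun_apply (word_sum (degree_part {n. n \<le> i \<and> i < n + N} d)) F))\<^sup>2)"
      proof (intro sum.cong refl)
        fix i assume i: "i \<in> {D..<N}"
        show "(norm ((\<Sum>n\<le>i. blinfun_apply (word_sum (degree_part {n} (c k))) F) - blinfun_apply ?T F))\<^sup>2 =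
            (norm (blinfun_apply (word_sum (degree_part {n. n \<le> i \<and> i < n + N} d)) F))\<^sup>2"
          unfolding eq[OF i] by (simp add: blinfun.diff_left blinfun.sum_left)
      qed
      also have "\<dots> \<le> (\<Sum>i<L. (norm (blinfun_apply (word_sum (degree_part {n. n \<le> i \<and> i < n + N} d)) F))\<^sup>2)"
        by (intro sum_mono2) (auto simp: L_def)
      finally show ?thesis
        using A by linarith
    qed
    have "(\<lambda>k. \<Sum>i\<in>{D..<N}. (norm ((\<Sum>n\<le>i. blinfun_apply (word_sum (degree_part {n} (c k))) F) - blinfun_apply ?T F))\<^sup>2)
        \<longlonglongrightarrow> (\<Sum>i\<in>{D..<N}. (norm ((\<Sum>n\<le>i. 0) - blinfun_apply ?T F))\<^sup>2)"
      by (intro tendsto_intros degree_part_tendsto_0[OF c lim R zero])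
    then have "(\<Sum>i\<in>{D..<N}. (norm ((\<Sum>n\<le>i. 0) - blinfun_apply ?T F))\<^sup>2) \<le> real N * e\<^sup>2 * (norm F)\<^sup>2"
      by (rule LIMSEQ_le_const2) (use window in blast)
    then have 1: "real (N - D) * (norm (blinfun_apply ?T F))\<^sup>2 \<le> real N * (e\<^sup>2 * (norm F)\<^sup>2)"
      by simp
    have 2: "real N \<le> 2 * real (N - D)" "0 < real (N - D)"
      by (auto simp: N_def)
    have "x \<le> 2 * y" if "M * x \<le> n * y" "n \<le> 2 * M" "0 < M" "0 \<le> y" for M n x y :: real
    proof -
      have "M * x \<le> M * (2 * y)"
        using that(1) mult_right_mono[OF that(2) that(4)] by (simp add: mult_ac)
      then show ?thesis
        using that(3) by (simp only: mult_le_cancel_left_pos)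
    qed
    from this[OF 1 2] have "(norm (blinfun_apply ?T F))\<^sup>2 \<le> 2 * (e\<^sup>2 * (norm F)\<^sup>2)"
      by simp
    also have "\<dots> \<le> (2 * e * norm F)\<^sup>2"
      by (simp add: power_mult_distrib)
    finally have T: "norm (blinfun_apply ?T F) \<le> 2 * e * norm F"
      by (rule power2_le_imp_le) (use e in simp)
    have "norm (?T - R) \<le> e"
      using K[OF order_refl] e by linarith
    then have "norm (blinfun_apply (?T - R) F) \<le> e * norm F"
      by (intro order_trans[OF norm_blinfun mult_right_mono] norm_ge_zero)
    then show ?thesis
      using T norm_triangle_ineq4[of "blinfun_apply ?T F" "blinfun_apply (?T - R) F"]
      by (simp add: blinfun.diff_left)
  qed
  show "R = 0"
  proof (rule blinfun_eqI)
    fix F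
    have "norm (blinfun_apply R F) \<le> 0 + e" if "0 < e" for e
    proof -
      have p: "0 < e / (3 * (norm F + 1))"
        using that by (simp add: add_nonneg_pos)
      have "norm (blinfun_apply R F) \<le> 3 * (e / (3 * (norm F + 1))) * norm F"
        by (rule small[OF p])
      also have "\<dots> \<le> 3 * (e / (3 * (norm F + 1))) * (norm F + 1)"
        using p by (intro mult_left_mono) auto
      also have "\<dots> = e"
      proof -
        have "3 * (e / (3 * x)) * x = e" if "x \<noteq> 0" for x
          using that by simp
        moreover have "norm F + 1 \<noteq> 0"
          using norm_ge_zero[of F] by linarith
        ultimately show ?thesis by blast
      qed
      finally show ?thesis by simp
    qed
    then have "norm (blinfun_apply R F) \<le> 0"
      by (rule field_le_epsilon)
    then show "blinfun_apply R F = blinfun_apply 0 F"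
      by simp
  qed
qed

section \<open>Relations between the generators\<close>

lemma A_ph_Zplus_one: "id_blinfun \<in> A_ph_Zplus"
  using word_A_ph_Zplus[of 0 0 0] by simp

lemma norm_M_op_le: "norm (M_op l) \<le> 1"
  by (rule norm_blinfun_bound) (simp_all add: norm_modulate)

lemma norm_D_op_le: "norm (D_op m) \<le> 1"
  by (rule norm_blinfun_bound) (simp_all add: norm_translate)

lemma norm_V_op_le: "norm (V_op t) \<le> 1"
  by (rule norm_blinfun_bound) (simp_all add: norm_dilate)

lemma M_op_add: "M_op (s + t) = M_op s o\<^sub>L M_op t"
  by (rule blinfun_eqI) (simp add: modulate_modulate)

lemma D_op_add: "D_op (s + t) = D_op s o\<^sub>L D_op t"
  by (rule blinfun_eqI) (simp add: translate_translate)

lemma V_op_add: "V_op (s + t) = V_op s o\<^sub>L V_op t"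
  by (rule blinfun_eqI) (simp add: dilate_dilate)

lemma M_op_zero [simp]: "M_op 0 = id_blinfun" and D_op_zero [simp]: "D_op 0 = id_blinfun"
  and V_op_zero [simp]: "V_op 0 = id_blinfun"
  by (rule blinfun_eqI, simp)+

lemma M_D_commutation: "M_op l o\<^sub>L D_op m = scale_op (exp (\<i> * of_real (l * m))) (D_op m o\<^sub>L M_op l)"
  by (rule blinfun_eqI) (simp add: modulate_translate)

lemma V_M_commutation: "V_op t o\<^sub>L M_op l = M_op (exp t * l) o\<^sub>L V_op t"
  by (rule blinfun_eqI) (simp add: dilate_modulate)

lemma V_D_commutation: "V_op t o\<^sub>L D_op m = D_op (exp (- t) * m) o\<^sub>L V_op t"
  by (rule blinfun_eqI) (simp add: dilate_translate)

lemma V_op_1_A: "V_op 1 \<in> A_ph_Zplus"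
  using generators_A_ph_Zplus(3)[of 1] by simp

lemma V_op_1_word: "V_op 1 = word 0 0 1"
  using V_op_word[of 1] by simp

lemma word_generated:
  assumes one: "P id_blinfun"
    and mult: "\<And>S T. S \<in> A_ph_Zplus \<Longrightarrow> T \<in> A_ph_Zplus \<Longrightarrow> P S \<Longrightarrow> P T \<Longrightarrow> P (S o\<^sub>L T)"
    and M: "\<And>l. 0 < l \<Longrightarrow> P (M_op l)" and D: "\<And>m. 0 < m \<Longrightarrow> P (D_op m)" and V: "P (V_op 1)"
    and lm: "0 \<le> l" "0 \<le> m"
  shows "P (word l m n)"
proof -
  have "P (M_op l)"
    using M[of l] one lm by (cases "l = 0") auto
  moreover have "P (D_op m)"
    using D[of m] one lm by (cases "m = 0") auto
  moreover have "P (V_op (real n))"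
  proof (induction n)
    case 0
    then show ?case using one by simp
  next
    case (Suc n)
    have "V_op (real (Suc n)) = V_op 1 o\<^sub>L V_op (real n)"
      using V_op_add[of 1 "real n"] by simp
    then show ?case
      using mult[OF V_op_1_A generators_A_ph_Zplus(3)[of n] V Suc] by simp
  qed
  ultimately show ?thesis
    unfolding word_def
    by (intro mult A_ph_Zplus_mult generators_A_ph_Zplus lm)
qed

text \<open>
  Halving shows that \<open>g\<close> vanishes at arbitrarily small times, and hence afterwards.
\<close>
lemma semigroup_zero:
  fixes g :: "real \<Rightarrow> complex"
  assumes mult: "\<And>s t. 0 < s \<Longrightarrow> 0 < t \<Longrightarrow> g (s + t) = g s * g t"
    and a: "0 < a" "g a = 0" and t: "0 < t"
  shows "g t = 0"
proof -
  have half: "g (a / 2 ^ n) = 0" for n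
  proof (induction n)
    case (Suc n)
    have "g (a / 2 ^ n) = g (a / 2 ^ Suc n) * g (a / 2 ^ Suc n)"
      using mult[of "a / 2 ^ Suc n" "a / 2 ^ Suc n"] a by simp
    then show ?case using Suc by simp
  qed (simp add: a)
  obtain n :: nat where n: "a / t < 2 ^ n"
    using real_arch_pow[of 2 "a / t"] by auto
  then have lt: "a / 2 ^ n < t"
    using t by (simp add: field_simps)
  have "g (a / 2 ^ n + (t - a / 2 ^ n)) = g (a / 2 ^ n) * g (t - a / 2 ^ n)"
    using a lt by (intro mult) auto
  then show ?thesis
    using half[of n] by simp
qed

section \<open>The characters and derivations of an automorphism\<close>

locale A_ph_Zplus_automorphism =
  fixes \<Phi> :: "(L2R \<Rightarrow>\<^sub>L L2R) \<Rightarrow> (L2R \<Rightarrow>\<^sub>L L2R)"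
  assumes isometric_automorphism: "isometric_automorphism A_ph_Zplus \<Phi>"
begin

lemma \<Phi>_A: "T \<in> A_ph_Zplus \<Longrightarrow> \<Phi> T \<in> A_ph_Zplus"
  and \<Phi>_add: "S \<in> A_ph_Zplus \<Longrightarrow> T \<in> A_ph_Zplus \<Longrightarrow> \<Phi> (S + T) = \<Phi> S + \<Phi> T"
  and \<Phi>_scale: "T \<in> A_ph_Zplus \<Longrightarrow> \<Phi> (scale_op c T) = scale_op c (\<Phi> T)"
  and \<Phi>_mult: "S \<in> A_ph_Zplus \<Longrightarrow> T \<in> A_ph_Zplus \<Longrightarrow> \<Phi> (S o\<^sub>L T) = \<Phi> S o\<^sub>L \<Phi> T"
  and norm_\<Phi>: "T \<in> A_ph_Zplus \<Longrightarrow> norm (\<Phi> T) = norm T"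
  using isometric_automorphism by (auto simp: isometric_automorphism_def bij_betw_def)

lemma \<Phi>_surj:
  assumes "S \<in> A_ph_Zplus"
  obtains T where "T \<in> A_ph_Zplus" "\<Phi> T = S"
proof -
  have "\<Phi> ` A_ph_Zplus = A_ph_Zplus"
    using isometric_automorphism by (simp add: isometric_automorphism_def bij_betw_def)
  then obtain T where "T \<in> A_ph_Zplus" "S = \<Phi> T"
    using assms by blast
  then show ?thesis
    by (intro that[of T]) auto
qed

lemma \<Phi>_one: "\<Phi> id_blinfun = id_blinfun"
proof -
  obtain T where T: "T \<in> A_ph_Zplus" "\<Phi> T = id_blinfun"
    using \<Phi>_surj[OF A_ph_Zplus_one] by blast
  have "id_blinfun o\<^sub>L T = T"
    by (rule blinfun_eqI) simp
  then have "\<Phi> id_blinfun o\<^sub>L id_blinfun = id_blinfun"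
    using \<Phi>_mult[OF A_ph_Zplus_one T(1)] T(2) by simp
  moreover have "\<Phi> id_blinfun o\<^sub>L id_blinfun = \<Phi> id_blinfun"
    by (rule blinfun_eqI) simp
  ultimately show ?thesis by simp
qed

lemma A_functional_\<Phi>:
  assumes f: "A_functional f"
  shows "A_functional (\<lambda>T. f (\<Phi> T))"
proof -
  obtain K where K: "\<And>T. T \<in> A_ph_Zplus \<Longrightarrow> cmod (f T) \<le> K * norm T"
    using f unfolding A_functional_def by metis
  have "\<forall>T\<in>A_ph_Zplus. cmod (f (\<Phi> T)) \<le> K * norm T"
    using K[OF \<Phi>_A] by (simp add: norm_\<Phi>)
  then have "\<exists>K. \<forall>T\<in>A_ph_Zplus. cmod (f (\<Phi> T)) \<le> K * norm T" ..
  then show ?thesis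
    using f unfolding A_functional_def by (simp add: \<Phi>_A \<Phi>_add \<Phi>_scale)
qed

text \<open>
  For fixed \<open>x\<close> this is a character of the algebra: evaluation of the coefficient of degree zero,
  pulled back along the automorphism.
\<close>
definition \<rho> :: "(L2R \<Rightarrow>\<^sub>L L2R) \<Rightarrow> real \<Rightarrow> complex" where
  "\<rho> T x = entry (\<Phi> T) 0 0 x"

text \<open>
  For fixed \<open>x\<close> this is a derivation into the complex numbers with \<open>\<rho>\<close> at \<open>x\<close> acting on the left and
  \<open>\<rho>\<close> at \<open>exp 1 * x\<close> on the right.
\<close>
definition \<delta> :: "(L2R \<Rightarrow>\<^sub>L L2R) \<Rightarrow> real \<Rightarrow> complex" where
  "\<delta> T x = entry (\<Phi> T) 0 1 x"

lemma A_functional_\<rho>: "A_functional (\<lambda>T. \<rho> T x)"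
  unfolding \<rho>_def by (rule A_functional_\<Phi>[OF A_functional_entry])

lemma A_functional_\<delta>: "A_functional (\<lambda>T. \<delta> T x)"
  unfolding \<delta>_def by (rule A_functional_\<Phi>[OF A_functional_entry])

lemma \<rho>_scale: "T \<in> A_ph_Zplus \<Longrightarrow> \<rho> (scale_op c T) x = c * \<rho> T x"
  using A_functional_\<rho>[of x] by (simp add: A_functional_def)

lemma \<rho>_mult: "S \<in> A_ph_Zplus \<Longrightarrow> T \<in> A_ph_Zplus \<Longrightarrow> \<rho> (S o\<^sub>L T) x = \<rho> S x * \<rho> T x"
  by (simp add: \<rho>_def \<Phi>_mult \<Phi>_A entry_mult_00)

lemma \<delta>_mult: "S \<in> A_ph_Zplus \<Longrightarrow> T \<in> A_ph_Zplus \<Longrightarrow>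
    \<delta> (S o\<^sub>L T) x = \<rho> S x * \<delta> T x + \<delta> S x * \<rho> T (exp 1 * x)"
  using entry_mult_01[OF \<Phi>_A \<Phi>_A, of S T x] by (simp add: \<rho>_def \<delta>_def \<Phi>_mult)

lemma \<rho>_one: "\<rho> id_blinfun x = 1" and \<delta>_one: "\<delta> id_blinfun x = 0"
  by (simp_all add: \<rho>_def \<delta>_def \<Phi>_one entry_one)

lemma analytic_ap_\<rho>: "T \<in> A_ph_Zplus \<Longrightarrow> analytic_ap (\<rho> T)"
  using analytic_ap_entry[OF \<Phi>_A] by (simp add: \<rho>_def[abs_def])

lemma analytic_ap_\<delta>: "T \<in> A_ph_Zplus \<Longrightarrow> analytic_ap (\<delta> T)"
  using analytic_ap_entry[OF \<Phi>_A] by (simp add: \<delta>_def[abs_def])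

lemma norm_\<rho>_le: "T \<in> A_ph_Zplus \<Longrightarrow> cmod (\<rho> T x) \<le> norm T"
  using norm_entry_le[OF \<Phi>_A] by (simp add: \<rho>_def norm_\<Phi>)

lemma norm_\<delta>_le: "T \<in> A_ph_Zplus \<Longrightarrow> cmod (\<delta> T x) \<le> norm T"
  using norm_entry_le[OF \<Phi>_A] by (simp add: \<delta>_def norm_\<Phi>)

text \<open>
  Surjectivity yields \<open>T\<close> with \<open>\<Phi> T = M_op 1\<close>, on which \<open>\<rho>\<close> is the character \<open>exp (\<i> x)\<close>.
\<close>
lemma \<rho>_not_all_constant:
  assumes M: "\<And>l x. 0 < l \<Longrightarrow> \<rho> (M_op l) x = \<rho> (M_op l) 0"
    and D: "\<And>m x. 0 < m \<Longrightarrow> \<rho> (D_op m) x = \<rho> (D_op m) 0"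
    and V: "\<And>x. \<rho> (V_op 1) x = \<rho> (V_op 1) 0"
  shows False
proof -
  obtain T where T: "T \<in> A_ph_Zplus" "\<Phi> T = M_op 1"
    using \<Phi>_surj[OF generators_A_ph_Zplus(1)[of 1]] by auto
  have "\<rho> T pi = \<rho> T 0"
  proof (rule A_functional_eqI[OF A_functional_\<rho> A_functional_\<rho> _ T(1)])
    fix l m :: real and n :: nat assume "0 \<le> l" "0 \<le> m"
    then show "\<rho> (word l m n) pi = \<rho> (word l m n) 0"
      by (intro word_generated[where P = "\<lambda>T. \<rho> T pi = \<rho> T 0"]) (auto simp: \<rho>_one \<rho>_mult intro: M D V)
  qed
  moreover have "\<rho> T x = exp (\<i> * of_real x)" for x
    by (simp add: \<rho>_def T(2) M_op_word entry_word)
  ultimately show False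
    by (simp add: mult.commute[of \<i>])
qed

text \<open>
  The hypotheses say that the derivation \<open>\<delta>\<close> takes the same value on \<open>S T\<close> and \<open>T S\<close> for all generators
  \<open>T\<close>. Being derivations in \<open>T\<close>, both sides then agree on the whole algebra. For the \<open>T\<close> with
  \<open>\<Phi> T = V_op 1\<close>, where \<open>\<rho>\<close> is zero and \<open>\<delta>\<close> is one, this says that \<open>\<rho> S\<close> is invariant under scaling by
  \<open>exp 1\<close>, and continuity at zero makes it constant.
\<close>
lemma commuting_constant:
  assumes S: "S \<in> A_ph_Zplus"
    and M: "\<And>l x. 0 < l \<Longrightarrow> (\<rho> S x - \<rho> S (exp 1 * x)) * \<delta> (M_op l) x =
      \<delta> S x * (\<rho> (M_op l) x - \<rho> (M_op l) (exp 1 * x))"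
    and D: "\<And>m x. 0 < m \<Longrightarrow> (\<rho> S x - \<rho> S (exp 1 * x)) * \<delta> (D_op m) x =
      \<delta> S x * (\<rho> (D_op m) x - \<rho> (D_op m) (exp 1 * x))"
    and V: "\<And>x. (\<rho> S x - \<rho> S (exp 1 * x)) * \<delta> (V_op 1) x =
      \<delta> S x * (\<rho> (V_op 1) x - \<rho> (V_op 1) (exp 1 * x))"
  shows "\<rho> S x = \<rho> S 0"
proof -
  obtain T where T: "T \<in> A_ph_Zplus" "\<Phi> T = V_op 1"
    using \<Phi>_surj[OF V_op_1_A] by auto
  have inv: "\<rho> S (exp 1 * x) = \<rho> S x" for x
  proof -
    have "(\<rho> S x - \<rho> S (exp 1 * x)) * \<delta> T x = \<delta> S x * (\<rho> T x + (- 1) * \<rho> T (exp 1 * x))"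
    proof (rule A_functional_eqI[OF _ _ _ T(1)])
      show "A_functional (\<lambda>T. (\<rho> S x - \<rho> S (exp 1 * x)) * \<delta> T x)"
        by (intro A_functional_cmult A_functional_\<delta>)
      show "A_functional (\<lambda>T. \<delta> S x * (\<rho> T x + (- 1) * \<rho> T (exp 1 * x)))"
        by (intro A_functional_cmult A_functional_add A_functional_\<rho>)
      fix l m :: real and n :: nat assume lm: "0 \<le> l" "0 \<le> m"
      have "(\<rho> S x - \<rho> S (exp 1 * x)) * \<delta> (word l m n) x =
          \<delta> S x * (\<rho> (word l m n) x - \<rho> (word l m n) (exp 1 * x))"
      proof (rule word_generated[where P = "\<lambda>T. (\<rho> S x - \<rho> S (exp 1 * x)) * \<delta> T x =
          \<delta> S x * (\<rho> T x - \<rho> T (exp 1 * x))", OF _ _ M D V lm])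
        show "(\<rho> S x - \<rho> S (exp 1 * x)) * \<delta> id_blinfun x =
            \<delta> S x * (\<rho> id_blinfun x - \<rho> id_blinfun (exp 1 * x))"
          by (simp add: \<rho>_one \<delta>_one)
        fix P Q assume PQ: "P \<in> A_ph_Zplus" "Q \<in> A_ph_Zplus"
          and P: "(\<rho> S x - \<rho> S (exp 1 * x)) * \<delta> P x = \<delta> S x * (\<rho> P x - \<rho> P (exp 1 * x))"
          and Q: "(\<rho> S x - \<rho> S (exp 1 * x)) * \<delta> Q x = \<delta> S x * (\<rho> Q x - \<rho> Q (exp 1 * x))"
        have "(\<rho> S x - \<rho> S (exp 1 * x)) * \<delta> (P o\<^sub>L Q) x =
            \<rho> P x * ((\<rho> S x - \<rho> S (exp 1 * x)) * \<delta> Q x) + ((\<rho> S x - \<rho> S (exp 1 * x)) * \<delta> P x) * \<rho> Q (exp 1 * x)"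
          unfolding \<delta>_mult[OF PQ] by (simp only: distrib_left mult_ac)
        also have "\<dots> = \<delta> S x * (\<rho> P x * \<rho> Q x - \<rho> P (exp 1 * x) * \<rho> Q (exp 1 * x))"
          unfolding P Q by (simp add: algebra_simps)
        finally show "(\<rho> S x - \<rho> S (exp 1 * x)) * \<delta> (P o\<^sub>L Q) x =
            \<delta> S x * (\<rho> (P o\<^sub>L Q) x - \<rho> (P o\<^sub>L Q) (exp 1 * x))"
          unfolding \<rho>_mult[OF PQ] .
      qed
      then show "(\<rho> S x - \<rho> S (exp 1 * x)) * \<delta> (word l m n) x =
          \<delta> S x * (\<rho> (word l m n) x + (- 1) * \<rho> (word l m n) (exp 1 * x))"
        by simp
    qed
    moreover have "\<rho> T y = 0" "\<delta> T y = 1" for y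
      by (simp_all add: \<rho>_def \<delta>_def T(2) V_op_1_word entry_word)
    ultimately show ?thesis by simp
  qed
  have pow: "\<rho> S (exp (- real n) * x) = \<rho> S x" for n
  proof (induction n)
    case (Suc n)
    have "exp 1 * (exp (- real (Suc n)) * x) = exp (- real n) * x"
      by (simp add: mult.assoc[symmetric] flip: exp_add)
    then show ?case
      using inv[of "exp (- real (Suc n)) * x"] Suc by metis
  qed simp
  have "(\<lambda>n. exp (- real n) * x) \<longlonglongrightarrow> 0 * x"
    by (intro tendsto_mult_right) real_asymp
  then have "(\<lambda>n. \<rho> S (exp (- real n) * x)) \<longlonglongrightarrow> \<rho> S 0"
    using continuous_on_tendsto_compose[OF analytic_ap_continuous[OF analytic_ap_\<rho>[OF S]]] by simp
  then show ?thesis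
    unfolding pow by (simp add: LIMSEQ_const_iff)
qed

end

locale A_ph_Zplus_semigroup = A_ph_Zplus_automorphism +
  fixes K :: "real \<Rightarrow> (L2R \<Rightarrow>\<^sub>L L2R)"
  assumes K_A: "\<And>t. 0 \<le> t \<Longrightarrow> K t \<in> A_ph_Zplus" and K_add: "\<And>s t. K (s + t) = K s o\<^sub>L K t"
    and norm_K: "\<And>t. norm (K t) \<le> 1"
begin

lemma \<rho>_K_add: "0 < s \<Longrightarrow> 0 < t \<Longrightarrow> \<rho> (K (s + t)) x = \<rho> (K s) x * \<rho> (K t) x"
  by (simp add: K_add \<rho>_mult K_A)

lemma \<rho>_K_zero: "0 < a \<Longrightarrow> \<rho> (K a) x = 0 \<Longrightarrow> 0 < t \<Longrightarrow> \<rho> (K t) x = 0"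
  by (rule semigroup_zero[where g = "\<lambda>t. \<rho> (K t) x", OF \<rho>_K_add])

lemma \<delta>_K_zero:
  assumes zero: "\<And>x. \<rho> (K (t / 2)) x = 0" and t: "0 < t"
  shows "\<delta> (K t) x = 0"
proof -
  have "\<delta> (K (t / 2 + t / 2)) x = \<rho> (K (t / 2)) x * \<delta> (K (t / 2)) x + \<delta> (K (t / 2)) x * \<rho> (K (t / 2)) (exp 1 * x)"
    unfolding K_add using t by (intro \<delta>_mult K_A) auto
  then show ?thesis
    using zero by simp
qed

text \<open>
  Invariance under \<open>t \<mapsto> exp 1 * t\<close> and multiplicativity leave for \<open>\<rho>\<close> only the values zero and one. In
  the first case \<open>\<delta>\<close> vanishes by the product rule, in the second it is additive in \<open>t\<close> and bounded.
\<close>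
lemma scaling_invariant_constant:
  assumes inv: "\<And>t x. 0 < t \<Longrightarrow> \<rho> (K (exp 1 * t)) x = \<rho> (K t) x" and t: "0 < t"
  shows "\<rho> (K t) x = \<rho> (K t) 0 \<and> \<delta> (K t) x = 0"
proof -
  have e1: "1 < exp (1::real)"
    by simp
  have alt: "(\<forall>x. \<rho> (K s) x = 1) \<or> (\<forall>t>0. \<forall>x. \<rho> (K t) x = 0)" if s: "0 < s" for s
  proof -
    \<comment> \<open>Chosen so that \<open>exp 1 * a = a + s\<close>, which turns invariance into a multiplicative relation at \<open>s\<close>.\<close>
    define a where "a = s / (exp 1 - 1)"
    have a: "0 < a" using s e1 by (simp add: a_def)
    have "a * (exp 1 - 1) = s"
      using e1 by (simp add: a_def)
    then have "exp 1 * a = a + s"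
      by (simp add: algebra_simps)
    then have "\<rho> (K a) x * \<rho> (K s) x = \<rho> (K a) x" for x
      using inv[OF a, of x] \<rho>_K_add[OF a s, of x] by simp
    then have prod: "\<rho> (K a) x * (\<rho> (K s) x - \<rho> id_blinfun x) = 0" for x
      by (simp add: \<rho>_one right_diff_distrib)
    have "(\<forall>x. \<rho> (K a) x = 0) \<or> (\<forall>x. \<rho> (K s) x - \<rho> id_blinfun x = 0)"
      using a s by (intro analytic_ap_zero_divisor[OF _ _ prod] analytic_ap_diff analytic_ap_\<rho> K_A A_ph_Zplus_one) auto
    then show ?thesis
      using \<rho>_K_zero[OF a] by (auto simp: \<rho>_one)
  qed
  show ?thesis
  proof (cases "\<forall>t>0. \<forall>x. \<rho> (K t) x = 0")
    case True
    then show ?thesis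
      using t \<delta>_K_zero[of t x] by simp
  next
    case False
    then have one: "\<rho> (K s) x = 1" if "0 < s" for s x
      using alt[OF that] by blast
    have add: "\<delta> (K (s + u)) x = \<delta> (K s) x + \<delta> (K u) x" if "0 < s" "0 < u" for s u
      using that \<delta>_mult[OF K_A K_A, of s u x] by (simp add: K_add one)
    have mult: "\<delta> (K (real (Suc n) * t)) x = of_nat (Suc n) * \<delta> (K t) x" for n
    proof (induction n)
      case (Suc n)
      have "real (Suc (Suc n)) * t = t + real (Suc n) * t"
        by (simp add: algebra_simps)
      moreover have "\<delta> (K (t + real (Suc n) * t)) x = \<delta> (K t) x + \<delta> (K (real (Suc n) * t)) x"
        using t by (intro add) auto
      ultimately show ?case
        using Suc by (simp add: algebra_simps)
    qed simp
    have "cmod (\<delta> (K t) x) \<le> inverse (real (Suc n))" for n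
    proof -
      have "real (Suc n) * cmod (\<delta> (K t) x) = cmod (\<delta> (K (real (Suc n) * t)) x)"
        unfolding mult norm_mult norm_of_nat ..
      also have "\<dots> \<le> 1"
        using norm_\<delta>_le[OF K_A, of "real (Suc n) * t" x] norm_K[of "real (Suc n) * t"] t by simp
      finally show ?thesis
        by (simp add: field_simps del: of_nat_Suc)
    qed
    then have "cmod (\<delta> (K t) x) \<le> 0"
      by (intro LIMSEQ_le_const[OF LIMSEQ_inverse_real_of_nat]) auto
    then show ?thesis
      using one[OF t] by simp
  qed
qed

end

context A_ph_Zplus_automorphism
begin

sublocale M: A_ph_Zplus_semigroup \<Phi> M_op
  by unfold_locales (auto intro: generators_A_ph_Zplus M_op_add norm_M_op_le)

sublocale D: A_ph_Zplus_semigroup \<Phi> D_op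
  by unfold_locales (auto intro: generators_A_ph_Zplus D_op_add norm_D_op_le)

section \<open>The image of the modulations\<close>

lemma \<rho>_V_M: "0 < l \<Longrightarrow> \<rho> (V_op 1) x * \<rho> (M_op l) x = \<rho> (M_op (exp 1 * l)) x * \<rho> (V_op 1) x"
  using arg_cong[OF V_M_commutation[of 1 l], of "\<lambda>T. \<rho> T x"]
  by (simp add: \<rho>_mult V_op_1_A generators_A_ph_Zplus)

lemma \<rho>_V_D: "0 < m \<Longrightarrow> \<rho> (V_op 1) x * \<rho> (D_op (exp 1 * m)) x = \<rho> (D_op m) x * \<rho> (V_op 1) x"
  using arg_cong[OF V_D_commutation[of 1 "exp 1 * m"], of "\<lambda>T. \<rho> T x"]
  by (simp add: \<rho>_mult V_op_1_A generators_A_ph_Zplus mult.assoc[symmetric] flip: exp_add)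

text \<open>
  Otherwise \<open>\<rho> (V_op 1)\<close> cancels from the commutation relations, and \<open>\<rho>\<close> would be invariant under scaling on
  both semigroups. Then it would be constant on all generators.
\<close>
lemma \<rho>_V_zero: "\<rho> (V_op 1) x = 0"
proof (rule ccontr)
  assume nz: "\<rho> (V_op 1) x \<noteq> 0"
  have apV: "analytic_ap (\<rho> (V_op 1))"
    by (rule analytic_ap_\<rho>[OF V_op_1_A])
  have M: "\<rho> (M_op (exp 1 * t)) y = \<rho> (M_op t) y" if t: "0 < t" for t y
  proof -
    have prod: "\<rho> (V_op 1) x * (\<rho> (M_op (exp 1 * t)) x - \<rho> (M_op t) x) = 0" for x
      using \<rho>_V_M[OF t, of x] by algebra
    have "(\<forall>x. \<rho> (V_op 1) x = 0) \<or> (\<forall>x. \<rho> (M_op (exp 1 * t)) x - \<rho> (M_op t) x = 0)"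
      using t by (intro analytic_ap_zero_divisor[OF _ _ prod] apV analytic_ap_diff analytic_ap_\<rho> generators_A_ph_Zplus) simp_all
    then show ?thesis using nz by auto
  qed
  have D: "\<rho> (D_op (exp 1 * t)) y = \<rho> (D_op t) y" if t: "0 < t" for t y
  proof -
    have prod: "\<rho> (V_op 1) x * (\<rho> (D_op (exp 1 * t)) x - \<rho> (D_op t) x) = 0" for x
      using \<rho>_V_D[OF t, of x] by algebra
    have "(\<forall>x. \<rho> (V_op 1) x = 0) \<or> (\<forall>x. \<rho> (D_op (exp 1 * t)) x - \<rho> (D_op t) x = 0)"
      using t by (intro analytic_ap_zero_divisor[OF _ _ prod] apV analytic_ap_diff analytic_ap_\<rho> generators_A_ph_Zplus) simp_all
    then show ?thesis using nz by auto
  qed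
  have M': "\<rho> (M_op t) x = \<rho> (M_op t) 0 \<and> \<delta> (M_op t) x = 0" if "0 < t" for t x
    by (rule M.scaling_invariant_constant[OF _ that]) (rule M)
  have D': "\<rho> (D_op t) x = \<rho> (D_op t) 0 \<and> \<delta> (D_op t) x = 0" if "0 < t" for t x
    by (rule D.scaling_invariant_constant[OF _ that]) (rule D)
  have V: "\<rho> (V_op 1) y = \<rho> (V_op 1) 0" for y
  proof (rule commuting_constant[OF V_op_1_A])
    fix l x :: real assume l: "0 < l"
    have "\<rho> (M_op l) x = \<rho> (M_op l) (exp 1 * x)" "\<delta> (M_op l) x = 0"
      using M'[OF l, of x] M'[OF l, of "exp 1 * x"] by auto
    then show "(\<rho> (V_op 1) x - \<rho> (V_op 1) (exp 1 * x)) * \<delta> (M_op l) x =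
        \<delta> (V_op 1) x * (\<rho> (M_op l) x - \<rho> (M_op l) (exp 1 * x))"
      by simp
  next
    fix l x :: real assume l: "0 < l"
    have "\<rho> (D_op l) x = \<rho> (D_op l) (exp 1 * x)" "\<delta> (D_op l) x = 0"
      using D'[OF l, of x] D'[OF l, of "exp 1 * x"] by auto
    then show "(\<rho> (V_op 1) x - \<rho> (V_op 1) (exp 1 * x)) * \<delta> (D_op l) x =
        \<delta> (V_op 1) x * (\<rho> (D_op l) x - \<rho> (D_op l) (exp 1 * x))"
      by simp
  qed simp
  show False
    by (rule \<rho>_not_all_constant) (use M' D' V in blast)+
qed

text \<open>
  The commutator of a modulation and a translation is a scalar different from one, so a character
  vanishes on their product.
\<close>
lemma \<rho>_dichotomy: "(\<forall>t>0. \<forall>x. \<rho> (M_op t) x = 0) \<or> (\<forall>t>0. \<forall>x. \<rho> (D_op t) x = 0)"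
proof -
  have "\<rho> (M_op 1 o\<^sub>L D_op 1) x = exp \<i> * \<rho> (D_op 1 o\<^sub>L M_op 1) x" for x
    unfolding M_D_commutation
    by (subst \<rho>_scale) (simp_all add: A_ph_Zplus_mult generators_A_ph_Zplus)
  then have "\<rho> (M_op 1) x * \<rho> (D_op 1) x = exp \<i> * (\<rho> (M_op 1) x * \<rho> (D_op 1) x)" for x
    by (simp add: \<rho>_mult generators_A_ph_Zplus mult.commute)
  then have "(1 - exp \<i>) * (\<rho> (M_op 1) x * \<rho> (D_op 1) x) = 0" for x
    by (simp add: left_diff_distrib)
  moreover have "exp \<i> \<noteq> 1"
  proof
    assume "exp \<i> = 1"
    then obtain k :: int where "1 = 2 * of_int k * pi"
      by (auto simp: exp_eq_1)
    then have "1 = 2 * \<bar>of_int k\<bar> * pi"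
      by (metis abs_mult abs_numeral abs_of_pos abs_one pi_gt_zero)
    moreover have "k \<noteq> 0"
      using \<open>1 = 2 * of_int k * pi\<close> by auto
    then have "1 \<le> \<bar>real_of_int k\<bar>"
      by linarith
    then have "1 * pi \<le> \<bar>real_of_int k\<bar> * pi"
      by (intro mult_right_mono) auto
    ultimately show False
      using pi_gt3 by linarith
  qed
  ultimately have "\<rho> (M_op 1) x * \<rho> (D_op 1) x = 0" for x
    by simp
  then have "(\<forall>x. \<rho> (M_op 1) x = 0) \<or> (\<forall>x. \<rho> (D_op 1) x = 0)"
    by (intro analytic_ap_zero_divisor analytic_ap_\<rho> generators_A_ph_Zplus) auto
  then show ?thesis
    using M.\<rho>_K_zero[of 1] D.\<rho>_K_zero[of 1] by auto
qed

lemma \<delta>_commute: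
  assumes "S \<in> A_ph_Zplus" "T \<in> A_ph_Zplus" "S o\<^sub>L T = T o\<^sub>L S"
  shows "(\<rho> S x - \<rho> S (exp 1 * x)) * \<delta> T x = \<delta> S x * (\<rho> T x - \<rho> T (exp 1 * x))"
  using arg_cong[OF assms(3), of "\<lambda>T. \<delta> T x"] assms(1,2) by (simp add: \<delta>_mult algebra_simps)

text \<open>
  If \<open>\<delta>\<close> vanished on \<open>V_op 1\<close>, then \<open>commuting_constant\<close> would apply to the semigroup on which \<open>\<rho>\<close> may
  be nonzero, and all values of \<open>\<rho>\<close> on generators would be constant.
\<close>
lemma \<delta>_V_nonzero: "\<exists>x. \<delta> (V_op 1) x \<noteq> 0"
proof (rule ccontr)
  assume "\<not> ?thesis"
  then have \<delta>V: "\<delta> (V_op 1) x = 0" for x by blast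
  have \<rho>V: "\<rho> (V_op 1) x = \<rho> (V_op 1) 0" for x
    by (simp add: \<rho>_V_zero)
  from \<rho>_dichotomy show False
  proof
    assume M: "\<forall>t>0. \<forall>x. \<rho> (M_op t) x = 0"
    have D': "\<rho> (D_op t) x = \<rho> (D_op t) 0" if t: "0 < t" for t x
    proof (rule commuting_constant)
      show D: "D_op t \<in> A_ph_Zplus" using t by (simp add: generators_A_ph_Zplus)
      show "(\<rho> (D_op t) x - \<rho> (D_op t) (exp 1 * x)) * \<delta> (M_op l) x = \<delta> (D_op t) x * (\<rho> (M_op l) x - \<rho> (M_op l) (exp 1 * x))"
        if "0 < l" for l x
        using M that M.\<delta>_K_zero[of l x] by simp
      show "(\<rho> (D_op t) x - \<rho> (D_op t) (exp 1 * x)) * \<delta> (D_op m) x = \<delta> (D_op t) x * (\<rho> (D_op m) x - \<rho> (D_op m) (exp 1 * x))"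
        if "0 < m" for m x
        using that t D by (intro \<delta>_commute generators_A_ph_Zplus) (auto simp: add.commute simp flip: D_op_add)
      show "(\<rho> (D_op t) x - \<rho> (D_op t) (exp 1 * x)) * \<delta> (V_op 1) x = \<delta> (D_op t) x * (\<rho> (V_op 1) x - \<rho> (V_op 1) (exp 1 * x))"
        for x by (simp add: \<delta>V \<rho>_V_zero)
    qed
    show False
      by (rule \<rho>_not_all_constant[OF _ D' \<rho>V]) (use M in simp)
  next
    assume D: "\<forall>t>0. \<forall>x. \<rho> (D_op t) x = 0"
    have M': "\<rho> (M_op t) x = \<rho> (M_op t) 0" if t: "0 < t" for t x
    proof (rule commuting_constant)
      show M: "M_op t \<in> A_ph_Zplus" using t by (simp add: generators_A_ph_Zplus)
      show "(\<rho> (M_op t) x - \<rho> (M_op t) (exp 1 * x)) * \<delta> (D_op l) x = \<delta> (M_op t) x * (\<rho> (D_op l) x - \<rho> (D_op l) (exp 1 * x))"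
        if "0 < l" for l x
        using D that D.\<delta>_K_zero[of l x] by simp
      show "(\<rho> (M_op t) x - \<rho> (M_op t) (exp 1 * x)) * \<delta> (M_op m) x = \<delta> (M_op t) x * (\<rho> (M_op m) x - \<rho> (M_op m) (exp 1 * x))"
        if "0 < m" for m x
        using that t M by (intro \<delta>_commute generators_A_ph_Zplus) (auto simp: add.commute simp flip: M_op_add)
      show "(\<rho> (M_op t) x - \<rho> (M_op t) (exp 1 * x)) * \<delta> (V_op 1) x = \<delta> (M_op t) x * (\<rho> (V_op 1) x - \<rho> (V_op 1) (exp 1 * x))"
        for x by (simp add: \<delta>V \<rho>_V_zero)
    qed
    show False
      by (rule \<rho>_not_all_constant[OF M' _ \<rho>V]) (use D in simp_all)
  qed
qed

text \<open>
  The product rule for \<open>\<delta>\<close> reduces to one term on each side because \<open>\<rho>\<close> vanishes on \<open>V_op 1\<close>, and the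
  nonzero factor \<open>\<delta> (V_op 1)\<close> cancels.
\<close>
lemma entry_01_V_relation:
  assumes S: "S \<in> A_ph_Zplus" and T: "T \<in> A_ph_Zplus" and VS: "V_op 1 o\<^sub>L S = T o\<^sub>L V_op 1"
  shows "\<rho> S (exp 1 * x) = \<rho> T x"
proof -
  obtain x0 where x0: "\<delta> (V_op 1) x0 \<noteq> 0"
    using \<delta>_V_nonzero by blast
  have "\<delta> (V_op 1) x * (\<rho> S (exp 1 * x) - \<rho> T x) = 0" for x
    using arg_cong[OF VS, of "\<lambda>T. \<delta> T x"]
    by (simp add: \<delta>_mult S T V_op_1_A \<rho>_V_zero right_diff_distrib mult.commute)
  moreover obtain F G H where "hardy_extension (\<rho> S) F" "hardy_extension (\<rho> T) G" "hardy_extension (\<delta> (V_op 1)) H"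
    using analytic_ap_hardy_extension[OF analytic_ap_\<rho>[OF S]] analytic_ap_hardy_extension[OF analytic_ap_\<rho>[OF T]]
      analytic_ap_hardy_extension[OF analytic_ap_\<delta>[OF V_op_1_A]] by blast
  ultimately have "(\<forall>x. \<delta> (V_op 1) x = 0) \<or> (\<forall>x. \<rho> S (exp 1 * x) - \<rho> T x = 0)"
    by (intro hardy_zero_divisor[OF _ hardy_extension_diff[OF hardy_extension_dilate]]) auto
  then show ?thesis
    using x0 by auto
qed

lemma \<rho>_hardy: "T \<in> A_ph_Zplus \<Longrightarrow> \<exists>F. hardy_extension (\<rho> T) F"
  by (rule analytic_ap_hardy_extension[OF analytic_ap_\<rho>])

text \<open>
  If \<open>\<rho>\<close> were nonzero on the translations, their contracting scaling law would make \<open>\<rho>\<close> constant on all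
  generators. So it is nonzero on the modulations, which obey the expanding law.
\<close>
lemma \<rho>_M_exponential:
  shows "\<forall>t>0. \<exists>\<alpha> k. cmod \<alpha> = 1 \<and> 0 \<le> k \<and> (\<forall>x. \<rho> (M_op t) x = \<alpha> * exp (\<i> * of_real k * of_real x))"
    and "\<exists>t>0. \<exists>x. \<rho> (M_op t) x \<noteq> \<rho> (M_op t) 0"
proof -
  have D_zero: "\<forall>t>0. \<forall>x. \<rho> (D_op t) x = 0"
  proof (rule ccontr)
    assume nD: "\<not> ?thesis"
    then have M: "\<forall>t>0. \<forall>x. \<rho> (M_op t) x = 0"
      using \<rho>_dichotomy by blast
    have nz: "\<exists>x. \<rho> (D_op t) x \<noteq> 0" if t: "0 < t" for t
    proof (rule ccontr)
      assume "\<not> ?thesis"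
      then have "\<rho> (D_op t) x = 0" for x by blast
      then show False
        using nD D.\<rho>_K_zero[OF t] by blast
    qed
    have "\<exists>\<alpha>. \<forall>x. \<rho> (D_op t) x = \<alpha>" if t: "0 < t" for t
    proof (rule hardy_semigroup_contracting[where f = "\<lambda>t. \<rho> (D_op t)"])
      show "\<exists>F. hardy_extension (\<rho> (D_op t)) F" if "0 < t" for t
        using that by (intro \<rho>_hardy generators_A_ph_Zplus) simp
      show "\<rho> (D_op (s + t)) x = \<rho> (D_op s) x * \<rho> (D_op t) x" if "0 < s" "0 < t" for s t x
        using that by (rule D.\<rho>_K_add)
      show "\<exists>x. \<rho> (D_op t) x \<noteq> 0" if "0 < t" for t
        using that by (rule nz)
      show "cmod (\<rho> (D_op t) x) \<le> 1" if "0 < t" for t x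
        using norm_\<rho>_le[of "D_op t" x] norm_D_op_le[of t] that generators_A_ph_Zplus(2)[of t] by simp
      show "\<rho> (D_op (exp 1 * t)) (exp 1 * x) = \<rho> (D_op t) x" if "0 < t" for t x
      proof (rule entry_01_V_relation)
        show "D_op (exp 1 * t) \<in> A_ph_Zplus" "D_op t \<in> A_ph_Zplus"
          using that by (auto intro!: generators_A_ph_Zplus)
        show "V_op 1 o\<^sub>L D_op (exp 1 * t) = D_op t o\<^sub>L V_op 1"
          using V_D_commutation[of 1 "exp 1 * t"] by (simp add: mult.assoc[symmetric] flip: exp_add)
      qed
    qed (rule t)
    then have D': "\<rho> (D_op t) x = \<rho> (D_op t) 0" if "0 < t" for t x
      using that by metis
    show False
      by (rule \<rho>_not_all_constant[OF _ D']) (use M \<rho>_V_zero in simp_all)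
  qed
  show ex: "\<exists>t>0. \<exists>x. \<rho> (M_op t) x \<noteq> \<rho> (M_op t) 0"
  proof (rule ccontr)
    assume "\<not> ?thesis"
    then have M': "\<rho> (M_op t) x = \<rho> (M_op t) 0" if "0 < t" for t x
      using that by blast
    show False
      by (rule \<rho>_not_all_constant[OF M']) (use D_zero \<rho>_V_zero in simp_all)
  qed
  have nz: "\<exists>x. \<rho> (M_op t) x \<noteq> 0" if t: "0 < t" for t
  proof (rule ccontr)
    assume "\<not> ?thesis"
    then have z: "\<rho> (M_op t) x = 0" for x by blast
    obtain u y where "0 < u" "\<rho> (M_op u) y \<noteq> \<rho> (M_op u) 0"
      using ex by blast
    then show False
      using M.\<rho>_K_zero[OF t z, of u] by simp
  qed
  show "\<forall>t>0. \<exists>\<alpha> k. cmod \<alpha> = 1 \<and> 0 \<le> k \<and> (\<forall>x. \<rho> (M_op t) x = \<alpha> * exp (\<i> * of_real k * of_real x))"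
  proof (intro allI impI)
    fix t :: real assume t: "0 < t"
    show "\<exists>\<alpha> k. cmod \<alpha> = 1 \<and> 0 \<le> k \<and> (\<forall>x. \<rho> (M_op t) x = \<alpha> * exp (\<i> * of_real k * of_real x))"
    proof (rule hardy_semigroup_expanding[where f = "\<lambda>t. \<rho> (M_op t)"])
      show "\<exists>F. hardy_extension (\<rho> (M_op t)) F" if "0 < t" for t
        using that by (intro \<rho>_hardy generators_A_ph_Zplus) simp
      show "\<rho> (M_op (s + t)) x = \<rho> (M_op s) x * \<rho> (M_op t) x" if "0 < s" "0 < t" for s t x
        using that by (rule M.\<rho>_K_add)
      show "\<exists>x. \<rho> (M_op t) x \<noteq> 0" if "0 < t" for t
        using that by (rule nz)
      show "cmod (\<rho> (M_op t) x) \<le> 1" if "0 < t" for t x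
        using norm_\<rho>_le[of "M_op t" x] norm_M_op_le[of t] that generators_A_ph_Zplus(1)[of t] by simp
      show "\<rho> (M_op t) (exp 1 * x) = \<rho> (M_op (exp 1 * t)) x" if "0 < t" for t x
        using that by (intro entry_01_V_relation V_M_commutation generators_A_ph_Zplus) simp_all
    qed (rule t)
  qed
qed

text \<open>
  The entry of degree zero has modulus one, which already exhausts the Bessel inequality.
\<close>
lemma \<Phi>_M_phase:
  assumes t: "0 < t"
  shows "\<exists>\<alpha> k. cmod \<alpha> = 1 \<and> 0 \<le> k \<and> \<Phi> (M_op t) = scale_op \<alpha> (M_op k)"
proof -
  obtain \<alpha> k where k: "cmod \<alpha> = 1" "0 \<le> k" "\<And>x. \<rho> (M_op t) x = \<alpha> * exp (\<i> * of_real k * of_real x)"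
    using \<rho>_M_exponential(1) t by blast
  let ?U = "\<Phi> (M_op t)"
  have M: "M_op t \<in> A_ph_Zplus"
    using t by (simp add: generators_A_ph_Zplus)
  have U: "?U \<in> A_ph_Zplus" "norm ?U \<le> 1"
    using M norm_M_op_le[of t] by (simp_all add: \<Phi>_A norm_\<Phi>)
  have B: "scale_op \<alpha> (M_op k) \<in> A_ph_Zplus"
    using k(2) by (intro A_ph_Zplus_scale generators_A_ph_Zplus)
  have entry_B: "entry (scale_op \<alpha> (M_op k)) m n y = (if m = 0 \<and> n = 0 then \<alpha> * exp (\<i> * of_real k * of_real y) else 0)" for m n y
    unfolding entry_scale[OF generators_A_ph_Zplus(1)[OF k(2)]] by (auto simp: M_op_word entry_word)
  have "entry ?U m n y = 0" if mn: "(m, n) \<noteq> (0, 0)" for m n y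
  proof -
    define x where "x = exp (real n) * (y - m)"
    have y: "m + exp (- real n) * x = y"
      by (simp add: x_def mult.assoc[symmetric] flip: exp_add)
    have "(\<Sum>(m, n)\<in>{(0, 0), (m, n)}. (cmod (entry ?U m n (m + exp (- real n) * x)))\<^sup>2) \<le> (norm ?U)\<^sup>2"
      by (rule entry_bessel[OF U(1)]) simp
    then have "(cmod (\<rho> (M_op t) x))\<^sup>2 + (cmod (entry ?U m n y))\<^sup>2 \<le> (norm ?U)\<^sup>2"
      using mn y by (simp add: \<rho>_def)
    moreover have "(cmod (\<rho> (M_op t) x))\<^sup>2 = 1"
      using k by (simp add: norm_mult)
    moreover have "(norm ?U)\<^sup>2 \<le> 1"
      using U(2) by (simp add: power_le_one)
    ultimately have "(cmod (entry ?U m n y))\<^sup>2 \<le> 0"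
      by linarith
    then show ?thesis
      by simp
  qed
  then have "entry (?U - scale_op \<alpha> (M_op k)) m n y = 0" for m n y
    unfolding entry_diff[OF U(1) B] entry_B using k(3)[of y] by (cases "(m, n) = (0, 0)") (auto simp: \<rho>_def)
  then have "?U - scale_op \<alpha> (M_op k) = 0"
    by (intro A_ph_Zplus_entry_zero A_ph_Zplus_diff U B)
  then show ?thesis
    using k by auto
qed

lemma \<Phi>_M_linear_phase:
  "\<exists>\<alpha> k. 0 < k \<and> (\<forall>s>0. \<forall>t>0. \<alpha> (s + t) = \<alpha> s * \<alpha> t) \<and>
     (\<forall>t>0. cmod (\<alpha> t) = 1 \<and> \<Phi> (M_op t) = scale_op (\<alpha> t) (M_op (k * t)))"
proof -
  have "\<forall>t. \<exists>p. 0 < t \<longrightarrow> cmod (fst p) = 1 \<and> 0 \<le> snd p \<and> \<Phi> (M_op t) = scale_op (fst p) (M_op (snd p))"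
    using \<Phi>_M_phase by (metis fst_conv snd_conv)
  then obtain p where p: "\<And>t. 0 < t \<Longrightarrow> cmod (fst (p t)) = 1 \<and> 0 \<le> snd (p t) \<and> \<Phi> (M_op t) = scale_op (fst (p t)) (M_op (snd (p t)))"
    by metis
  define \<alpha> where "\<alpha> = (\<lambda>t::real. fst (p t) :: complex)"
  define \<kappa> where "\<kappa> = (\<lambda>t::real. snd (p t) :: real)"
  have p': "cmod (\<alpha> t) = 1" "0 \<le> \<kappa> t" "\<Phi> (M_op t) = scale_op (\<alpha> t) (M_op (\<kappa> t))" if "0 < t" for t
    using p[OF that] by (auto simp: \<alpha>_def \<kappa>_def)
  have \<rho>: "\<rho> (M_op t) x = \<alpha> t * exp (\<i> * of_real (\<kappa> t) * of_real x)" if t: "0 < t" for t x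
    unfolding \<rho>_def p'(3)[OF t] entry_scale[OF generators_A_ph_Zplus(1)[OF p'(2)[OF t]]]
    by (simp add: M_op_word entry_word)
  have add: "\<alpha> (s + t) = \<alpha> s * \<alpha> t \<and> \<kappa> (s + t) = \<kappa> s + \<kappa> t" if st: "0 < s" "0 < t" for s t
  proof (rule exp_phase_eq_all)
    show "\<alpha> (s + t) * exp (\<i> * of_real (\<kappa> (s + t)) * of_real x) = \<alpha> s * \<alpha> t * exp (\<i> * of_real (\<kappa> s + \<kappa> t) * of_real x)" for x
      using M.\<rho>_K_add[OF st, of x] \<rho>[OF st(1), of x] \<rho>[OF st(2), of x] \<rho>[of "s + t" x] st
      by (simp add: distrib_left distrib_right exp_add)
    show "\<alpha> (s + t) \<noteq> 0"
      using p'(1)[of "s + t"] st by auto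
  qed
  have lin: "\<kappa> t = t * \<kappa> 1" if "0 < t" for t
    by (rule additive_nonneg_linear[where g = \<kappa>]) (use add p'(2) that in auto)
  have "\<kappa> 1 \<noteq> 0"
  proof
    assume "\<kappa> 1 = 0"
    then have "\<kappa> t = 0" if "0 < t" for t
      using lin[OF that] by simp
    then have "\<rho> (M_op t) x = \<rho> (M_op t) 0" if "0 < t" for t x
      unfolding \<rho>[OF that] using that by simp
    then show False
      using \<rho>_M_exponential(2) by blast
  qed
  then have "0 < \<kappa> 1"
    using p'(2)[of 1] by simp
  moreover have "\<Phi> (M_op t) = scale_op (\<alpha> t) (M_op (\<kappa> 1 * t))" if "0 < t" for t
    unfolding p'(3)[OF that] lin[OF that] by (simp add: mult.commute)
  ultimately show ?thesis
    using add p'(1) by blast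
qed

end

section \<open>The images of the translations and dilations\<close>

text \<open>
  An equation that holds wherever an entry is nonzero thus holds at two different points, which is enough to
  separate an affine function of the point into slope and constant.
\<close>
lemma entry_nonzero_nearby:
  assumes T: "T \<in> A_ph_Zplus" and nz: "entry T m n y \<noteq> 0"
  obtains y' where "y' \<noteq> y" "entry T m n y' \<noteq> 0"
proof -
  have "isCont (entry T m n) y"
    using analytic_ap_continuous[OF analytic_ap_entry[OF T]] by (simp add: continuous_on_eq_continuous_at)
  then have "(\<lambda>i. entry T m n (y + inverse (real (Suc i)))) \<longlonglongrightarrow> entry T m n (y + 0)"
    by (intro isCont_tendsto_compose[of _ "entry T m n"] tendsto_intros LIMSEQ_inverse_real_of_nat) auto
  then have "\<forall>\<^sub>F i in sequentially. entry T m n (y + inverse (real (Suc i))) \<noteq> 0"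
    using nz by (intro tendsto_imp_eventually_ne) auto
  then obtain i where "entry T m n (y + inverse (real (Suc i))) \<noteq> 0"
    using eventually_happens'[OF sequentially_bot] by blast
  then show ?thesis
    by (intro that[of "y + inverse (real (Suc i))"]) auto
qed

text \<open>
  Both sides have the same entries.
\<close>
lemma supported_entry_factor:
  assumes S: "S \<in> A_ph_Zplus" and m0: "0 \<le> m0"
    and supp: "\<And>m n y. entry S m n y \<noteq> 0 \<Longrightarrow> m = m0 \<and> n = n0"
  shows "S = mult_op (entry S m0 n0) o\<^sub>L word 0 m0 n0"
proof -
  have ap: "analytic_ap (entry S m0 n0)"
    by (rule analytic_ap_entry[OF S])
  have W: "word 0 m0 n0 \<in> A_ph_Zplus"
    using m0 by (simp add: word_A_ph_Zplus)
  have A: "mult_op (entry S m0 n0) o\<^sub>L word 0 m0 n0 \<in> A_ph_Zplus"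
    by (rule A_ph_Zplus_mult[OF mult_op_A_ph_Zplus[OF ap] W])
  have "entry (S - (mult_op (entry S m0 n0) o\<^sub>L word 0 m0 n0)) m n y = 0" for m n y
    unfolding entry_diff[OF S A] entry_mult_op[OF ap W] using supp[of m n y] by (auto simp: entry_word)
  then have "S - (mult_op (entry S m0 n0) o\<^sub>L word 0 m0 n0) = 0"
    by (intro A_ph_Zplus_entry_zero A_ph_Zplus_diff S A)
  then show ?thesis by simp
qed

lemma scale_op_word_eqD:
  assumes "0 \<le> l" "0 \<le> m" "scale_op a (word l m n) = scale_op b (word l m n)"
  shows "a = b"
  using arg_cong[OF assms(3), of "\<lambda>T. entry T m n 0"] assms(1,2)
  by (simp add: entry_scale word_A_ph_Zplus entry_word)

context A_ph_Zplus_automorphism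
begin

lemma \<Phi>_eq_zeroD: "T \<in> A_ph_Zplus \<Longrightarrow> \<Phi> T = 0 \<Longrightarrow> T = 0"
  using norm_\<Phi>[of T] by simp

text \<open>
  This is the form of the automorphism that scales the line by \<open>k\<close> and then conjugates by the
  translation \<open>D_op d\<close>, up to coefficient functions. Every nonzero entry of \<open>\<Phi> (V_op 1)\<close> and of
  \<open>\<Phi> (D_op p)\<close> is constrained by the commutation relation with all modulations, in which the entry
  itself cancels.
\<close>
lemma \<Phi>_form:
  "\<exists>k d. 0 < k \<and> 0 \<le> d \<and>
     (\<forall>l>0. \<Phi> (M_op l) = scale_op (exp (\<i> * of_real (l * (- (k * d))))) (M_op (k * l))) \<and>
     (\<forall>m n y. entry (\<Phi> (V_op 1)) m n y \<noteq> 0 \<longrightarrow> n = 1 \<and> m * exp 1 = d * (exp 1 - 1)) \<and>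
     (\<forall>p\<ge>0. \<forall>m n y. entry (\<Phi> (D_op p)) m n y \<noteq> 0 \<longrightarrow> n = 0 \<and> k * m = p)"
proof -
  obtain \<alpha> k where k: "0 < k" and \<alpha>_add: "\<And>s t. 0 < s \<Longrightarrow> 0 < t \<Longrightarrow> \<alpha> (s + t) = \<alpha> s * \<alpha> t"
    and \<alpha>: "\<And>t. 0 < t \<Longrightarrow> cmod (\<alpha> t) = 1"
    and \<Phi>_M: "\<And>t. 0 < t \<Longrightarrow> \<Phi> (M_op t) = scale_op (\<alpha> t) (M_op (k * t))"
    using \<Phi>_M_linear_phase by blast
  have e1: "1 < exp (1::real)" by simp
  have \<alpha>_nz: "\<alpha> t \<noteq> 0" if "0 < t" for t
    using \<alpha>[OF that] by auto
  have M_A: "M_op (k * l) \<in> A_ph_Zplus" if "0 < l" for l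
    using that k by (simp add: generators_A_ph_Zplus)
  have entry_left: "entry (\<Phi> (M_op l o\<^sub>L T)) m n y = \<alpha> l * exp (\<i> * of_real (k * l * y)) * entry (\<Phi> T) m n y"
    if l: "0 < l" and T: "T \<in> A_ph_Zplus" for l T m n y
    using \<Phi>_mult[OF generators_A_ph_Zplus(1)[of l] T] k l T M_A[OF l]
    by (simp add: \<Phi>_M scale_op_compose_left entry_scale A_ph_Zplus_mult \<Phi>_A entry_M_mult mult.assoc)
  have entry_right: "entry (\<Phi> (T o\<^sub>L M_op l)) m n y =
      \<alpha> l * exp (\<i> * of_real (k * l * (exp (real n) * (y - m)))) * entry (\<Phi> T) m n y"
    if l: "0 < l" and T: "T \<in> A_ph_Zplus" for l T m n y
    using \<Phi>_mult[OF T generators_A_ph_Zplus(1)[of l]] k l T M_A[OF l]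
    by (simp add: \<Phi>_M scale_op_compose_right A_ph_Zplus_bounded_ops entry_scale A_ph_Zplus_mult \<Phi>_A entry_mult_M mult_ac)
  let ?X = "\<Phi> (V_op 1)"
  have X: "?X \<in> A_ph_Zplus"
    by (rule \<Phi>_A[OF V_op_1_A])
  have X_phase: "exp (\<i> * of_real (l * (k * (exp (real n) * (y - m) - exp 1 * y)))) * \<alpha> l = \<alpha> (exp 1 * l)"
    if nz: "entry ?X m n y \<noteq> 0" and l: "0 < l" for m n y l
  proof -
    have "entry (\<Phi> (V_op 1 o\<^sub>L M_op l)) m n y = entry (\<Phi> (M_op (exp 1 * l) o\<^sub>L V_op 1)) m n y"
      by (simp add: V_M_commutation)
    then have "\<alpha> l * exp (\<i> * of_real (k * l * (exp (real n) * (y - m)))) =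
        \<alpha> (exp 1 * l) * exp (\<i> * of_real (k * (exp 1 * l) * y))"
      using nz l by (simp add: entry_left entry_right V_op_1_A)
    from exp_phase_balance[OF this] show ?thesis
      by (simp add: algebra_simps)
  qed
  have X_const: "exp (real n) * (y - m) - exp 1 * y = exp (real n') * (y' - m') - exp 1 * y'"
    if nz: "entry ?X m n y \<noteq> 0" "entry ?X m' n' y' \<noteq> 0" for m n y m' n' y'
  proof -
    have "k * (exp (real n) * (y - m) - exp 1 * y) = k * (exp (real n') * (y' - m') - exp 1 * y')"
    proof (rule exp_phase_eq)
      fix l :: real assume l: "0 < l"
      show "exp (\<i> * of_real (l * (k * (exp (real n) * (y - m) - exp 1 * y)))) =
          exp (\<i> * of_real (l * (k * (exp (real n') * (y' - m') - exp 1 * y'))))"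
        using X_phase[OF nz(1) l] X_phase[OF nz(2) l] \<alpha>_nz[OF l] by (metis mult_right_cancel)
    qed
    then show ?thesis using k by simp
  qed
  have X_degree: "n = 1" if nz: "entry ?X m n y \<noteq> 0" for m n y
  proof -
    obtain y' where y': "y' \<noteq> y" "entry ?X m n y' \<noteq> 0"
      using entry_nonzero_nearby[OF X nz] by blast
    have "(exp (real n) - exp 1) * (y - y') = 0"
      using X_const[OF nz y'(2)] by (simp add: algebra_simps)
    then have "exp (real n) = exp 1"
      using y'(1) by simp
    then show ?thesis by simp
  qed
  have "\<not> (\<forall>m n y. entry ?X m n y = 0)"
  proof
    assume "\<forall>m n y. entry ?X m n y = 0"
    then have "?X = 0"
      by (intro A_ph_Zplus_entry_zero[OF X]) blast
    then have "V_op 1 = 0"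
      by (rule \<Phi>_eq_zeroD[OF V_op_1_A])
    then have "entry (word 0 0 1) 0 1 0 = entry (0 - 0) 0 1 0"
      by (simp add: V_op_1_word)
    then show False
      unfolding entry_diff[OF A_ph_Zplus_zero A_ph_Zplus_zero] by (simp add: entry_word)
  qed
  then obtain m0 n0 y0 where nz0': "entry ?X m0 n0 y0 \<noteq> 0" by blast
  then have nz0: "entry ?X m0 1 y0 \<noteq> 0"
    using X_degree by blast
  have m0: "0 \<le> m0"
    using entry_negative[OF X, of m0 1 y0] nz0 by (meson not_le)
  \<comment> \<open>The product of \<open>D_op d\<close>, \<open>V_op 1\<close> and \<open>D_op (- d)\<close> is \<open>V_op 1\<close> followed by a translation by \<open>d * (1 - exp (- 1)) = m0\<close>.\<close>
  define d where "d = m0 * exp 1 / (exp 1 - 1)"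
  have d0: "0 \<le> d"
    using m0 e1 by (simp add: d_def)
  have d: "m0 * exp 1 = d * (exp 1 - 1)"
    using e1 by (simp add: d_def)
  have X_supp: "n = 1 \<and> m * exp 1 = d * (exp 1 - 1)" if nz: "entry ?X m n y \<noteq> 0" for m n y
  proof -
    have n: "n = 1" by (rule X_degree[OF nz])
    have "m * exp 1 = m0 * exp 1"
      using X_const[OF nz nz0] unfolding n by (simp add: algebra_simps)
    then show ?thesis using n d by simp
  qed
  have M_phase: "\<Phi> (M_op l) = scale_op (exp (\<i> * of_real (l * (- (k * d))))) (M_op (k * l))" if l: "0 < l" for l
  proof -
    \<comment> \<open>Chosen so that \<open>exp 1 * s = l + s\<close>: the phase relation of \<open>V_op 1\<close> at \<open>s\<close> then determines \<open>\<alpha> l\<close>.\<close>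
    define s where "s = l / (exp 1 - 1)"
    have s: "0 < s" "s * (exp 1 - 1) = l"
      using l e1 by (simp_all add: s_def)
    have es: "exp 1 * s = l + s"
      using s(2) by (simp add: algebra_simps)
    have "exp (real 1) * (y0 - m0) - exp 1 * y0 = - (d * (exp 1 - 1))"
      using d by (simp add: algebra_simps)
    then have "exp (\<i> * of_real (s * (k * (- (d * (exp 1 - 1)))))) * \<alpha> s = \<alpha> l * \<alpha> s"
      using X_phase[OF nz0 s(1)] \<alpha>_add[OF l s(1)] by (simp only: es)
    moreover have "s * (k * (- (d * (exp 1 - 1)))) = l * (- (k * d))"
      unfolding s(2)[symmetric] by simp
    ultimately have "exp (\<i> * of_real (l * (- (k * d)))) * \<alpha> s = \<alpha> l * \<alpha> s"
      by (simp only:)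
    then have "\<alpha> l = exp (\<i> * of_real (l * (- (k * d))))"
      using \<alpha>_nz[OF s(1)] by (metis mult_right_cancel)
    then show ?thesis
      by (simp add: \<Phi>_M[OF l])
  qed
  have D_const: "k * y = p + k * (exp (real n) * (y - m))"
    if p: "0 \<le> p" and nz: "entry (\<Phi> (D_op p)) m n y \<noteq> 0" for p m n y
  proof (rule exp_phase_eq)
    fix l :: real assume l: "0 < l"
    have D: "D_op p \<in> A_ph_Zplus" using p by (rule generators_A_ph_Zplus)
    have DM: "D_op p o\<^sub>L M_op l \<in> A_ph_Zplus"
      using D l by (simp add: A_ph_Zplus_mult generators_A_ph_Zplus)
    have "entry (\<Phi> (M_op l o\<^sub>L D_op p)) m n y = exp (\<i> * of_real (l * p)) * entry (\<Phi> (D_op p o\<^sub>L M_op l)) m n y"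
      unfolding M_D_commutation \<Phi>_scale[OF DM] by (rule entry_scale[OF \<Phi>_A[OF DM]])
    then have "exp (\<i> * of_real (k * l * y)) =
        exp (\<i> * of_real (l * p)) * exp (\<i> * of_real (k * l * (exp (real n) * (y - m))))"
      using nz \<alpha>_nz[OF l] unfolding entry_left[OF l D] entry_right[OF l D] by simp
    then show "exp (\<i> * of_real (l * (k * y))) = exp (\<i> * of_real (l * (p + k * (exp (real n) * (y - m)))))"
      by (simp add: distrib_left exp_add mult_ac)
  qed
  have D_supp: "n = 0 \<and> k * m = p" if p: "0 \<le> p" and nz: "entry (\<Phi> (D_op p)) m n y \<noteq> 0" for p m n y
  proof -
    have D: "\<Phi> (D_op p) \<in> A_ph_Zplus"
      using p by (intro \<Phi>_A generators_A_ph_Zplus)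
    obtain y' where y': "y' \<noteq> y" "entry (\<Phi> (D_op p)) m n y' \<noteq> 0"
      using entry_nonzero_nearby[OF D nz] by blast
    have "k * ((exp (real n) - 1) * (y - y')) = 0"
      using D_const[OF p nz] D_const[OF p y'(2)] by (simp add: algebra_simps)
    then have n: "n = 0"
      using k y'(1) by simp
    then show ?thesis
      using D_const[OF p nz] by (simp add: algebra_simps)
  qed
  show ?thesis
    using k d0 M_phase X_supp D_supp by blast
qed

lemma inverse_automorphism: "A_ph_Zplus_automorphism (inv_into A_ph_Zplus \<Phi>)"
proof -
  let ?\<Psi> = "inv_into A_ph_Zplus \<Phi>"
  have bij: "bij_betw \<Phi> A_ph_Zplus A_ph_Zplus"
    using isometric_automorphism by (simp add: isometric_automorphism_def)
  have \<Psi>: "?\<Psi> T \<in> A_ph_Zplus" "\<Phi> (?\<Psi> T) = T" if "T \<in> A_ph_Zplus" for T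
    using bij that by (auto simp: bij_betw_def f_inv_into_f inv_into_into)
  have eq: "?\<Psi> T = S" if "S \<in> A_ph_Zplus" "\<Phi> S = T" for S T
    using bij_betw_inv_into_left[OF bij that(1)] that(2) by simp
  have "?\<Psi> (S + T) = ?\<Psi> S + ?\<Psi> T" if "S \<in> A_ph_Zplus" "T \<in> A_ph_Zplus" for S T
    using that by (intro eq) (simp_all add: A_ph_Zplus_add \<Psi> \<Phi>_add)
  moreover have "?\<Psi> (scale_op c T) = scale_op c (?\<Psi> T)" if "T \<in> A_ph_Zplus" for c T
    using that by (intro eq) (simp_all add: A_ph_Zplus_scale \<Psi> \<Phi>_scale)
  moreover have "?\<Psi> (S o\<^sub>L T) = ?\<Psi> S o\<^sub>L ?\<Psi> T" if "S \<in> A_ph_Zplus" "T \<in> A_ph_Zplus" for S T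
    using that by (intro eq) (simp_all add: A_ph_Zplus_mult \<Psi> \<Phi>_mult)
  moreover have "norm (?\<Psi> T) = norm T" if "T \<in> A_ph_Zplus" for T
    using norm_\<Phi>[OF \<Psi>(1)[OF that]] \<Psi>(2)[OF that] by simp
  ultimately show ?thesis
    by unfold_locales (simp add: isometric_automorphism_def bij_betw_inv_into[OF bij])
qed

lemma \<Phi>_inverse: "T \<in> A_ph_Zplus \<Longrightarrow> \<Phi> (inv_into A_ph_Zplus \<Phi> T) = T"
  using isometric_automorphism by (auto simp: isometric_automorphism_def bij_betw_def intro: f_inv_into_f)

text \<open>
  The automorphism acts on multiplication operators as the substitution \<open>x \<mapsto> k * x\<close>, as it does on
  the modulations.
\<close>
lemma entry_\<Phi>_mult_op:
  assumes M: "\<And>l. 0 \<le> l \<Longrightarrow> \<Phi> (M_op l) = M_op (k * l)" and k: "0 < k"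
    and g: "analytic_ap g" and T: "T \<in> A_ph_Zplus"
  shows "entry (\<Phi> (mult_op g o\<^sub>L T)) m n y = g (k * y) * entry (\<Phi> T) m n y"
proof (rule A_functional_mult_op[where f = "\<lambda>S. entry (\<Phi> (S o\<^sub>L T)) m n y", OF _ _ g])
  show "A_functional (\<lambda>S. entry (\<Phi> (S o\<^sub>L T)) m n y)"
    by (intro A_functional_compose_right[where f = "\<lambda>S. entry (\<Phi> S) m n y"] A_functional_\<Phi>[OF A_functional_entry] T)
  fix l :: real assume l: "0 \<le> l"
  show "entry (\<Phi> (M_op l o\<^sub>L T)) m n y = exp (\<i> * of_real l * of_real (k * y)) * entry (\<Phi> T) m n y"
    using l k by (simp add: \<Phi>_mult generators_A_ph_Zplus T M entry_M_mult \<Phi>_A mult_ac)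
qed

text \<open>
  Here \<open>w\<close> is the coefficient that the inverse automorphism produces. Composing the two shows that
  \<open>v\<close> and \<open>x \<mapsto> w (k * x)\<close> are contractive and inverse to each other, so \<open>hardy_inverse_constant\<close>
  applies.
\<close>
lemma \<Phi>_word_scaled:
  assumes M: "\<And>l. 0 \<le> l \<Longrightarrow> \<Phi> (M_op l) = M_op (k * l)" and k: "0 < k"
    and S: "S \<in> A_ph_Zplus" and m: "0 \<le> m"
    and v: "analytic_ap v" "\<And>x. cmod (v x) \<le> 1" and w: "analytic_ap w" "\<And>x. cmod (w x) \<le> 1"
    and \<Phi>S: "\<Phi> S = mult_op v o\<^sub>L word 0 m n" and \<Phi>wS: "\<Phi> (mult_op w o\<^sub>L S) = word 0 m n"
  shows "\<exists>c. c \<noteq> 0 \<and> \<Phi> S = scale_op c (word 0 m n)"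
proof -
  have W: "word 0 m n \<in> A_ph_Zplus"
    using m by (simp add: word_A_ph_Zplus)
  have eS: "entry (\<Phi> S) m n y = v y" for y
    unfolding \<Phi>S entry_mult_op[OF v(1) W] by (simp add: entry_word)
  have prod: "v y * w (k * y) = 1" for y
    using entry_\<Phi>_mult_op[OF M k w(1) S, of m n y] unfolding \<Phi>wS eS by (simp add: entry_word mult.commute)
  obtain F G where "hardy_extension v F" "hardy_extension w G"
    using analytic_ap_hardy_extension v(1) w(1) by blast
  then have "\<exists>c. \<forall>x. v x = c"
    using v(2) w(2) prod
    by (intro hardy_inverse_constant[where g = "\<lambda>x. w (k * x)", OF _ hardy_extension_dilate[OF _ k]])
  then obtain c where c: "\<And>x. v x = c" by blast
  have "entry (\<Phi> S - scale_op c (word 0 m n)) m' n' y = 0" for m' n' y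
    unfolding entry_diff[OF \<Phi>_A[OF S] A_ph_Zplus_scale[OF W]] entry_scale[OF W]
    unfolding \<Phi>S entry_mult_op[OF v(1) W] c by simp
  then have "\<Phi> S - scale_op c (word 0 m n) = 0"
    by (intro A_ph_Zplus_entry_zero A_ph_Zplus_diff A_ph_Zplus_scale W \<Phi>_A S)
  moreover have "c \<noteq> 0"
    using prod[of 0] c by auto
  ultimately show ?thesis by auto
qed

text \<open>
  The composition of \<open>\<Phi>\<close> with its inverse multiplies \<open>M_op l\<close> by a phase that contains the sum of the
  two shifts with positive weights. Both shifts are nonnegative, so they vanish.
\<close>
lemma \<Phi>_M_scaling:
  "\<exists>k k'. 0 < k \<and> 0 < k' \<and> k * k' = 1 \<and> (\<forall>l\<ge>0. \<Phi> (M_op l) = M_op (k * l)) \<and>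
     (\<forall>m n y. entry (\<Phi> (V_op 1)) m n y \<noteq> 0 \<longrightarrow> m = 0 \<and> n = 1) \<and>
     (\<forall>p\<ge>0. \<forall>m n y. entry (\<Phi> (D_op p)) m n y \<noteq> 0 \<longrightarrow> m = k' * p \<and> n = 0) \<and>
     (\<forall>m n y. entry (inv_into A_ph_Zplus \<Phi> (V_op 1)) m n y \<noteq> 0 \<longrightarrow> m = 0 \<and> n = 1) \<and>
     (\<forall>p\<ge>0. \<forall>m n y. entry (inv_into A_ph_Zplus \<Phi> (D_op p)) m n y \<noteq> 0 \<longrightarrow> m = k * p \<and> n = 0)"
proof -
  interpret \<Psi>: A_ph_Zplus_automorphism "inv_into A_ph_Zplus \<Phi>"
    by (rule inverse_automorphism)
  let ?\<Psi> = "inv_into A_ph_Zplus \<Phi>"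
  obtain k d where form: "0 < k" "0 \<le> d"
    "\<forall>l>0. \<Phi> (M_op l) = scale_op (exp (\<i> * of_real (l * (- (k * d))))) (M_op (k * l))"
    "\<forall>m n y. entry (\<Phi> (V_op 1)) m n y \<noteq> 0 \<longrightarrow> n = 1 \<and> m * exp 1 = d * (exp 1 - 1)"
    "\<forall>p\<ge>0. \<forall>m n y. entry (\<Phi> (D_op p)) m n y \<noteq> 0 \<longrightarrow> n = 0 \<and> k * m = p"
    using \<Phi>_form by (elim exE conjE) (rule that)
  note k = form(1,2) and M = form(3)[rule_format]
  obtain k' d' where form': "0 < k'" "0 \<le> d'"
    "\<forall>l>0. ?\<Psi> (M_op l) = scale_op (exp (\<i> * of_real (l * (- (k' * d'))))) (M_op (k' * l))"
    "\<forall>m n y. entry (?\<Psi> (V_op 1)) m n y \<noteq> 0 \<longrightarrow> n = 1 \<and> m * exp 1 = d' * (exp 1 - 1)"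
    "\<forall>p\<ge>0. \<forall>m n y. entry (?\<Psi> (D_op p)) m n y \<noteq> 0 \<longrightarrow> n = 0 \<and> k' * m = p"
    using \<Psi>.\<Phi>_form by (elim exE conjE) (rule that)
  note k' = form'(1,2) and M' = form'(3)[rule_format]
  \<comment> \<open>The exponents on both sides of \<open>\<Phi> (?\<Psi> (M_op l)) = M_op l\<close> as functions of the base point \<open>y\<close>.\<close>
  have phase: "- (k' * d') + - (k' * (k * d)) + k * k' * y = y" for y
  proof (rule exp_phase_eq)
    fix l :: real assume l: "0 < l"
    have kl: "0 < k' * l" "0 \<le> k * (k' * l)" using l k k' by simp_all
    have "M_op l = \<Phi> (?\<Psi> (M_op l))"
      using l by (simp add: \<Phi>_inverse generators_A_ph_Zplus)
    also have "\<dots> = scale_op (exp (\<i> * of_real (l * (- (k' * d')))) * exp (\<i> * of_real (k' * l * (- (k * d))))) (M_op (k * (k' * l)))"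
      unfolding M'[OF l] using kl by (subst \<Phi>_scale) (simp_all add: generators_A_ph_Zplus M)
    finally have "entry (M_op l) 0 0 y = entry (scale_op (exp (\<i> * of_real (l * (- (k' * d')))) * exp (\<i> * of_real (k' * l * (- (k * d))))) (M_op (k * (k' * l)))) 0 0 y"
      by (rule arg_cong)
    then have "exp (\<i> * of_real l * of_real y) =
        exp (\<i> * of_real (l * (- (k' * d')))) * exp (\<i> * of_real (k' * l * (- (k * d)))) * exp (\<i> * of_real (k * (k' * l)) * of_real y)"
      unfolding entry_scale[OF generators_A_ph_Zplus(1)[OF kl(2)]] unfolding M_op_word entry_word by simp
    then show "exp (\<i> * of_real (l * (- (k' * d') + - (k' * (k * d)) + k * k' * y))) = exp (\<i> * of_real (l * y))"
      by (simp add: algebra_simps flip: exp_add)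
  qed
  have "k' * d' + k' * (k * d) = 0"
    using phase[of 0] by simp
  moreover have "0 \<le> k' * d'" "0 \<le> k' * (k * d)"
    using k k' by simp_all
  ultimately have "k' * d' = 0" "k' * (k * d) = 0"
    by linarith+
  then have d: "d = 0" "d' = 0"
    using k k' by simp_all
  have kk: "k * k' = 1"
    using phase[of 1] d by simp
  have inv: "m = k' * p" if "k * m = p" for m p
    using that kk by (metis mult.assoc mult.commute mult_1)
  have inv': "m = k * p" if "k' * m = p" for m p
    using that kk by (metis mult.assoc mult_1)
  have "\<Phi> (M_op l) = M_op (k * l)" if "0 \<le> l" for l
    using M[of l] that by (cases "l = 0") (simp_all add: \<Phi>_one d)
  moreover have "m = 0 \<and> n = 1" if "entry (\<Phi> (V_op 1)) m n y \<noteq> 0" for m n y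
    using form(4)[rule_format, OF that] d by simp
  moreover have "m = k' * p \<and> n = 0" if "0 \<le> p" "entry (\<Phi> (D_op p)) m n y \<noteq> 0" for p m n y
    using form(5)[rule_format, OF that] inv by blast
  moreover have "m = 0 \<and> n = 1" if "entry (?\<Psi> (V_op 1)) m n y \<noteq> 0" for m n y
    using form'(4)[rule_format, OF that] d by simp
  moreover have "m = k * p \<and> n = 0" if "0 \<le> p" "entry (?\<Psi> (D_op p)) m n y \<noteq> 0" for p m n y
    using form'(5)[rule_format, OF that] inv' by blast
  ultimately show ?thesis
    using k(1) k'(1) kk by (intro exI[of _ k] exI[of _ k']) simp
qed

lemma \<Phi>_on_generators:
  "\<exists>k1 k2 c. 0 < k1 \<and> 0 < k2 \<and> k1 * k2 = 1 \<and>
     (\<forall>l\<ge>0. \<Phi> (M_op l) = M_op (k1 * l)) \<and> (\<forall>m\<ge>0. \<Phi> (D_op m) = D_op (k2 * m)) \<and>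
     (\<forall>t. \<Phi> (V_op (real t)) = scale_op (c ^ t) (V_op (real t)))"
proof -
  interpret \<Psi>: A_ph_Zplus_automorphism "inv_into A_ph_Zplus \<Phi>"
    by (rule inverse_automorphism)
  let ?\<Psi> = "inv_into A_ph_Zplus \<Phi>"
  obtain k k' where scaling: "0 < k" "0 < k'" "k * k' = 1" "\<forall>l\<ge>0. \<Phi> (M_op l) = M_op (k * l)"
    "\<forall>m n y. entry (\<Phi> (V_op 1)) m n y \<noteq> 0 \<longrightarrow> m = 0 \<and> n = 1"
    "\<forall>p\<ge>0. \<forall>m n y. entry (\<Phi> (D_op p)) m n y \<noteq> 0 \<longrightarrow> m = k' * p \<and> n = 0"
    "\<forall>m n y. entry (?\<Psi> (V_op 1)) m n y \<noteq> 0 \<longrightarrow> m = 0 \<and> n = 1"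
    "\<forall>p\<ge>0. \<forall>m n y. entry (?\<Psi> (D_op p)) m n y \<noteq> 0 \<longrightarrow> m = k * p \<and> n = 0"
    using \<Phi>_M_scaling by (elim exE conjE) (rule that)
  note k = scaling(1,2) and kk = scaling(3) and M = scaling(4)[rule_format] and V = scaling(5)[rule_format]
    and D = scaling(6)[rule_format] and V' = scaling(7)[rule_format] and D' = scaling(8)[rule_format]
  have scaled: "\<exists>c. c \<noteq> 0 \<and> \<Phi> (word 0 p n) = scale_op c (word 0 q n)"
    if p: "0 \<le> p" and q: "0 \<le> q" and norms: "norm (word 0 p n) \<le> 1" "norm (word 0 q n) \<le> 1"
      and supp: "\<And>m j y. entry (\<Phi> (word 0 p n)) m j y \<noteq> 0 \<Longrightarrow> m = q \<and> j = n"
      and supp': "\<And>m j y. entry (?\<Psi> (word 0 q n)) m j y \<noteq> 0 \<Longrightarrow> m = p \<and> j = n" for p q n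
  proof -
    have A: "word 0 p n \<in> A_ph_Zplus" "word 0 q n \<in> A_ph_Zplus"
      using p q by (simp_all add: word_A_ph_Zplus)
    have \<Psi>_A: "?\<Psi> (word 0 q n) \<in> A_ph_Zplus"
      by (rule \<Psi>.\<Phi>_A[OF A(2)])
    show ?thesis
    proof (rule \<Phi>_word_scaled[OF M k(1) A(1) q])
      show "analytic_ap (entry (\<Phi> (word 0 p n)) q n)" "analytic_ap (entry (?\<Psi> (word 0 q n)) p n)"
        by (intro analytic_ap_entry \<Phi>_A A \<Psi>_A)+
      show "cmod (entry (\<Phi> (word 0 p n)) q n x) \<le> 1" for x
        using norm_entry_le[OF \<Phi>_A[OF A(1)], of q n x] norms(1) by (simp add: norm_\<Phi> A)
      show "cmod (entry (?\<Psi> (word 0 q n)) p n x) \<le> 1" for x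
        using norm_entry_le[OF \<Psi>_A, of p n x] norms(2) by (simp add: \<Psi>.norm_\<Phi> A)
      show "\<Phi> (word 0 p n) = mult_op (entry (\<Phi> (word 0 p n)) q n) o\<^sub>L word 0 q n"
        by (rule supported_entry_factor[OF \<Phi>_A[OF A(1)] q supp])
      have "?\<Psi> (word 0 q n) = mult_op (entry (?\<Psi> (word 0 q n)) p n) o\<^sub>L word 0 p n"
        by (rule supported_entry_factor[OF \<Psi>_A p supp'])
      then show "\<Phi> (mult_op (entry (?\<Psi> (word 0 q n)) p n) o\<^sub>L word 0 p n) = word 0 q n"
        using \<Phi>_inverse[OF A(2)] by simp
    qed
  qed
  have "\<exists>c. c \<noteq> 0 \<and> \<Phi> (V_op 1) = scale_op c (V_op 1)"
    by (rule scaled[of 0 0 1, folded V_op_1_word]) (rule order_refl norm_V_op_le | erule V V')+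
  then obtain c where c: "c \<noteq> 0" "\<Phi> (V_op 1) = scale_op c (V_op 1)" by blast
  have "\<exists>\<beta>. \<beta> \<noteq> 0 \<and> \<Phi> (D_op p) = scale_op \<beta> (D_op (k' * p))" if p: "0 \<le> p" for p
  proof -
    have kp: "0 \<le> k' * p" "k * (k' * p) = p"
      using p k kk by (simp_all flip: mult.assoc)
    show ?thesis
      by (rule scaled[OF p kp(1), of 0, folded D_op_word])
        (rule norm_D_op_le | erule D[OF p] D'[OF kp(1), unfolded kp(2)])+
  qed
  then obtain \<beta> where \<beta>: "\<And>p. 0 \<le> p \<Longrightarrow> \<beta> p \<noteq> 0"
    and \<Phi>_D: "\<And>p. 0 \<le> p \<Longrightarrow> \<Phi> (D_op p) = scale_op (\<beta> p) (D_op (k' * p))"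
    by metis
  have \<beta>_add: "\<beta> (p + q) = \<beta> p * \<beta> q" if pq: "0 \<le> p" "0 \<le> q" for p q
  proof (rule scale_op_word_eqD)
    have A: "D_op p \<in> A_ph_Zplus" "D_op q \<in> A_ph_Zplus"
      using pq by (simp_all add: generators_A_ph_Zplus)
    have "scale_op (\<beta> (p + q)) (D_op (k' * (p + q))) = \<Phi> (D_op p o\<^sub>L D_op q)"
      using \<Phi>_D[of "p + q"] pq by (simp flip: D_op_add)
    also have "\<dots> = scale_op (\<beta> p) (D_op (k' * p)) o\<^sub>L scale_op (\<beta> q) (D_op (k' * q))"
      using pq by (simp add: \<Phi>_mult A \<Phi>_D)
    also have "\<dots> = scale_op (\<beta> p * \<beta> q) (D_op (k' * (p + q)))"
      by (simp add: scale_op_compose_left scale_op_compose_right generators_bounded_ops distrib_left flip: D_op_add)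
    finally show "scale_op (\<beta> (p + q)) (word 0 (k' * (p + q)) 0) = scale_op (\<beta> p * \<beta> q) (word 0 (k' * (p + q)) 0)"
      by (simp flip: D_op_word)
  qed (use pq k in simp_all)
  have \<beta>_scale: "\<beta> p = \<beta> (exp (- 1) * p)" if p: "0 \<le> p" for p
  proof -
    have A: "D_op p \<in> A_ph_Zplus" "D_op (exp (- 1) * p) \<in> A_ph_Zplus"
      using p by (simp_all add: generators_A_ph_Zplus)
    have word: "V_op 1 o\<^sub>L D_op (k' * p) = word 0 (k' * (exp (- 1) * p)) 1"
      unfolding V_D_commutation word_def by (intro blinfun_eqI) (simp add: mult.left_commute)
    have "scale_op (c * \<beta> p) (V_op 1 o\<^sub>L D_op (k' * p)) = \<Phi> (V_op 1 o\<^sub>L D_op p)"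
      using p by (simp add: \<Phi>_mult A V_op_1_A \<Phi>_D c scale_op_compose_left scale_op_compose_right generators_bounded_ops)
    also have "\<dots> = scale_op (\<beta> (exp (- 1) * p) * c) (D_op (k' * (exp (- 1) * p)) o\<^sub>L V_op 1)"
      unfolding V_D_commutation using p
      by (simp add: \<Phi>_mult A V_op_1_A \<Phi>_D c scale_op_compose_left scale_op_compose_right generators_bounded_ops)
    also have "D_op (k' * (exp (- 1) * p)) o\<^sub>L V_op 1 = V_op 1 o\<^sub>L D_op (k' * p)"
      unfolding V_D_commutation by (simp add: mult.left_commute)
    finally have "c * \<beta> p = \<beta> (exp (- 1) * p) * c"
      unfolding word by (rule scale_op_word_eqD[rotated 2]) (use p k in simp_all)
    then show ?thesis
      using c(1) by simp
  qed
  have e1: "exp (- 1) < (1::real)" by simp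
  have \<beta>1: "\<beta> p = 1" if p: "0 \<le> p" for p
  proof -
    \<comment> \<open>Chosen so that \<open>q\<close> and \<open>exp (- 1) * q\<close> differ by \<open>p\<close>.\<close>
    define q where "q = p / (1 - exp (- 1))"
    have q: "0 \<le> q" "q * (1 - exp (- 1)) = p"
      using p e1 by (simp_all add: q_def)
    have "q = exp (- 1) * q + p"
      unfolding q(2)[symmetric] by (simp add: algebra_simps)
    then have "\<beta> q = \<beta> (exp (- 1) * q) * \<beta> p"
      using \<beta>_add[of "exp (- 1) * q" p] p q(1) by simp
    then show ?thesis
      using \<beta>_scale[OF q(1)] \<beta>[OF q(1)] by simp
  qed
  have "\<Phi> (V_op (real t)) = scale_op (c ^ t) (V_op (real t))" for t
  proof (induction t)
    case 0
    then show ?case by (simp add: \<Phi>_one)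
  next
    case (Suc t)
    have "V_op (real (Suc t)) = V_op 1 o\<^sub>L V_op (real t)"
      using V_op_add[of 1 "real t"] by simp
    moreover have "\<Phi> (V_op 1 o\<^sub>L V_op (real t)) = scale_op (c ^ Suc t) (V_op 1 o\<^sub>L V_op (real t))"
      by (simp add: \<Phi>_mult V_op_1_A generators_A_ph_Zplus c Suc scale_op_compose_left scale_op_compose_right generators_bounded_ops)
    ultimately show ?case by metis
  qed
  moreover have "\<Phi> (D_op p) = D_op (k' * p)" if "0 \<le> p" for p
    using \<Phi>_D[OF that] \<beta>1[OF that] by simp
  ultimately show ?thesis
    using k kk M by blast
qed

end

theorem theorem4p9:
  fixes \<Phi> :: "(L2R \<Rightarrow>\<^sub>L L2R) \<Rightarrow> (L2R \<Rightarrow>\<^sub>L L2R)"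
  assumes "isometric_automorphism A_ph_Zplus \<Phi>"
  shows "\<exists>(k1::real) (k2::real) (c :: nat \<Rightarrow> complex).
           k1 > 0 \<and> k2 > 0 \<and> k1 * k2 = 1 \<and>
           (\<forall>s t. c (s + t) = c s * c t) \<and>
           (\<forall>l\<ge>0. \<Phi> (M_op l) = M_op (k1 * l)) \<and>
           (\<forall>m\<ge>0. \<Phi> (D_op m) = D_op (k2 * m)) \<and>
           (\<forall>t. \<Phi> (V_op (real t)) = scale_op (c t) (V_op (real t)))"
proof -
  interpret A_ph_Zplus_automorphism \<Phi>
    by unfold_locales (rule assms)
  obtain k1 k2 :: real and c :: complex where "0 < k1 \<and> 0 < k2 \<and> k1 * k2 = 1 \<and>
      (\<forall>l\<ge>0. \<Phi> (M_op l) = M_op (k1 * l)) \<and> (\<forall>m\<ge>0. \<Phi> (D_op m) = D_op (k2 * m)) \<and>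
      (\<forall>t. \<Phi> (V_op (real t)) = scale_op (c ^ t) (V_op (real t)))"
    using \<Phi>_on_generators by blast
  then show ?thesis
    by (intro exI[of _ k1] exI[of _ k2] exI[of _ "\<lambda>t. c ^ t"]) (simp add: power_add)
qed

end
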